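(* The $\mathbb C[t]$-algebra $\mathcal A_t$ (defined in the context) is flat over $\mathbb C[t]$. Furthermore, there are algebra isomorphisms $$\mathcal A_t/(t-1)\cong\mathcal U_v(\widehat{\mathfrak{sl}_2})_{1,1},\qquad \mathcal A_t/(t)\cong\mathcal U_v^{ad}(\widehat{\mathfrak{sl}_2})^{FT}_{1,1}.$$
   Context: $v$ is an indeterminate, $[n]=\frac{v^n-v^{-n}}{v-v^{-1}}$, $[x,y]=xy-yx$. **(a) The relations ( * )** on symbols $E_l,F_l$ ($l\in\mathbb Z$), $H_n$ ($n\in\mathbb Z\setminus\{0\}$), $S^{\pm1},K^{\pm1},C^{\pm1/2}$: $S^2=KC^{1/2}$; $SE_kS^{-1}=vE_k$; $SF_kS^{-1}=v^{-1}F_k$; $SH_nS^{-1}=H_n$; $E_{k+1}E_l-v^2E_lE_{k+1}=v^2E_kE_{l+1}-E_{l+1}E_k$; $F_{k+1}F_l-v^{-2}F_lF_{k+1}=v^{-2}F_kF_{l+1}-F_{l+1}F_k$; $[E_k,F_l]=\frac{C^{(k-l)/2}\Psi_{k+l}-C^{(l-k)/2}\Phi_{k+l}}{v-v^{-1}}$; $[H_l,E_k]=\frac{[2l]}{l}C^{-|l|/2}E_{k+l}$; $[H_l,F_k]=-\frac{[2l]}{l}C^{|l|/2}F_{k+l}$; $[H_l,H_k]=\delta_{l,-k}\frac{[2l]}{l}\frac{C^l-C^{-l}}{v-v^{-1}}$; where $\sum_{k\ge0}\Psi_{k-1}u^k=K\exp\big((v-v^{-1})\sum_{k\ge1}H_ku^k\big)$,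 $\sum_{k\ge0}\Phi_{-k+1}u^k=K^{-1}\exp\big(-(v-v^{-1})\sum_{k\ge1}H_{-k}u^k\big)$, and $\Psi_k=0$ for $k<-1$, $\Phi_k=0$ for $k>1$. **(b)** The deformed quantum affine algebra $\mathcal U_v(\widehat{\mathfrak{sl}_2})_{1,1}$ is the $\mathbb C(v)$-algebra generated by $E_l,F_l,H_n,S^{\pm1},K^{\pm1},C^{\pm1/2}$ subject to ( * ) and $C^{1/2}$ central. **(c)** $\mathcal A_t$ is the $\mathbb C(v)[t]$-algebra generated by $E_l,F_l,H_n,S^{\pm1},K^{\pm1},C^{\pm1/2},\tilde C^{\pm1/2}$ subject to ( * ), $\tilde C^{1/2}$ central, and $C^{1/2}-1=t(\tilde C^{1/2}-1)$. **(d)** The adjoint shifted quantum affine algebra $\mathcal U_v^{ad}(\widehat{\mathfrak{sl}_2})^{FT}_{1,1}$ (Finkelberg–Tsymbaliuk) is the $\mathbb C(v)$-algebra generated by $e_l,f_l$ ($l\in\mathbb Z$), $h_n$ ($n\in\mathbb Z\setminus\{0\}$), $(\phi^{\pm})^{\pm1}$ with relations: $\phi^+\phi^-=\phi^-\phi^+$; $\phi^\pm e_k(\phi^\pm)^{-1}=v^{\pm1}e_k$; $\phi^\pm f_k(\phi^\pm)^{-1}=v^{\mp1}f_k$; $\phi^\pm h_n(\phi^\pm)^{-1}=h_n$; $e_{k+1}e_l-v^2e_le_{k+1}=v^2e_ke_{l+1}-e_{l+1}e_k$; $f_{k+1}f_l-v^{-2}f_lf_{k+1}=v^{-2}f_kf_{l+1}-f_{l+1}f_k$;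 $[e_k,f_l]=\frac{\psi^+_{k+l}-\psi^-_{k+l}}{v-v^{-1}}$; $[h_l,e_k]=\frac{[2l]}{l}e_{k+l}$; $[h_l,f_k]=-\frac{[2l]}{l}f_{k+l}$; $[h_l,h_k]=0$; where $\sum_{k\ge0}\psi^+_{k-1}u^k=(\phi^+)^2\exp\big((v-v^{-1})\sum_{k\ge1}h_ku^k\big)$, $\sum_{k\ge0}\psi^-_{-k+1}u^k=(\phi^-)^2\exp\big(-(v-v^{-1})\sum_{k\ge1}h_{-k}u^k\big)$, and $\psi^+_k=0$ for $k<-1$, $\psi^-_k=0$ for $k>1$. *)

theory Defs
  imports
    "HOL-Algebra.Algebra"
    "HOL-Algebra.Algebraic_Closure_Type"
    "HOL-Library.Poly_Mapping"
    "HOL-Computational_Algebra.Computational_Algebra"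
begin

section \<open>Associative algebras given by generators and relations\<close>

text \<open>
  An associative unital algebra over a commutative ring is a record of the HOL-Algebra type
  \<^type>\<open>module\<close>, which has both a (not necessarily commutative) multiplication and a
  scalar multiplication.  The type class based ring structures enter through
  \<^const>\<open>ring_of_type_algebra\<close>.
\<close>

text \<open>The free monoid on \<open>'g\<close>, written additively because \<open>poly_mapping\<close> takes its
  convolution product from an additive monoid of exponents.\<close>

datatype 'g word = Word (letters: "'g list")

instantiation word :: (type) monoid_add
begin
definition zero_word :: "'a word" where "0 = Word []"
definition plus_word :: "'a word \<Rightarrow> 'a word \<Rightarrow> 'a word"
  where "a + b = Word (letters a @ letters b)"
instance
  by standard (simp_all add: zero_word_def plus_word_def)
end

type_synonym ('g, 'r) free_alg = "'g word \<Rightarrow>\<^sub>0 'r"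

definition scalar :: "'r::comm_ring_1 \<Rightarrow> ('g, 'r) free_alg"
  where "scalar c = Poly_Mapping.single 0 c"

definition gen :: "'g \<Rightarrow> ('g, 'r::comm_ring_1) free_alg"
  where "gen g = Poly_Mapping.single (Word [g]) 1"

definition free_algebra :: "('r::comm_ring_1, ('g, 'r) free_alg) module"
  where "free_algebra = ring.extend ring_of_type_algebra (module.fields (\<lambda>c p. scalar c * p))"

definition quotient_algebra :: "('r, 'a, 'm) module_scheme \<Rightarrow> 'a set \<Rightarrow> ('r, 'a set) module"
  where "quotient_algebra A J =
    ring.extend (A Quot J) (module.fields (\<lambda>c Y. \<Union>a\<in>Y. J +>\<^bsub>A\<^esub> (c \<odot>\<^bsub>A\<^esub> a)))"

text \<open>A relation \<open>a = b\<close> is represented by the element \<open>a - b\<close>; \<^const>\<open>genideal\<close> is the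
  two-sided ideal generated by a set.\<close>

definition presented_algebra ::
    "('g, 'r::comm_ring_1) free_alg set \<Rightarrow> ('r, ('g, 'r) free_alg set) module"
  where "presented_algebra rels = quotient_algebra free_algebra (genideal free_algebra rels)"

definition restrict_scalars :: "('s \<Rightarrow> 'r) \<Rightarrow> ('r, 'a, 'm) module_scheme \<Rightarrow> ('s, 'a) module"
  where "restrict_scalars \<phi> A =
    ring.extend (ring.truncate A) (module.fields (\<lambda>c x. \<phi> c \<odot>\<^bsub>A\<^esub> x))"

definition algebra_isomorphic ::
    "('r, 'k) ring_scheme \<Rightarrow> ('r, 'a, 'm) module_scheme \<Rightarrow> ('r, 'b, 'n) module_scheme \<Rightarrow> bool"
  where "algebra_isomorphic R A B \<longleftrightarrow>
    (\<exists>h \<in> ring_iso A B. \<forall>c\<in>carrier R. \<forall>x\<in>carrier A. h (c \<odot>\<^bsub>A\<^esub> x) = c \<odot>\<^bsub>B\<^esub> h x)"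


section \<open>Tensor products and flatness\<close>

text \<open>The tensor product is formed as an abelian group: the quotient of the free abelian group
  on pairs by the bilinearity relations.  Its \<open>R\<close>-module structure is not needed to speak
  about injectivity of maps.\<close>

definition tensor_rels ::
    "('r, 'k) ring_scheme \<Rightarrow> ('r, 'm, 'x) module_scheme \<Rightarrow> ('r, 'n, 'y) module_scheme
      \<Rightarrow> ('m \<times> 'n \<Rightarrow>\<^sub>0 int) set"
  where "tensor_rels R M N =
    {frag_of (x \<oplus>\<^bsub>M\<^esub> x', y) - frag_of (x, y) - frag_of (x', y) | x x' y.
        x \<in> carrier M \<and> x' \<in> carrier M \<and> y \<in> carrier N} \<union>
    {frag_of (x, y \<oplus>\<^bsub>N\<^esub> y') - frag_of (x, y) - frag_of (x, y') | x y y'.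
        x \<in> carrier M \<and> y \<in> carrier N \<and> y' \<in> carrier N} \<union>
    {frag_of (r \<odot>\<^bsub>M\<^esub> x, y) - frag_of (x, r \<odot>\<^bsub>N\<^esub> y) | r x y.
        r \<in> carrier R \<and> x \<in> carrier M \<and> y \<in> carrier N}"

definition tensor_kernel ::
    "('r, 'k) ring_scheme \<Rightarrow> ('r, 'm, 'x) module_scheme \<Rightarrow> ('r, 'n, 'y) module_scheme
      \<Rightarrow> ('m \<times> 'n \<Rightarrow>\<^sub>0 int) set"
  where "tensor_kernel R M N =
    generate (free_Abelian_group (carrier M \<times> carrier N)) (tensor_rels R M N)"

definition tensor ::
    "('r, 'k) ring_scheme \<Rightarrow> ('r, 'm, 'x) module_scheme \<Rightarrow> ('r, 'n, 'y) module_scheme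
      \<Rightarrow> ('m \<times> 'n \<Rightarrow>\<^sub>0 int) set monoid"
  where "tensor R M N =
    free_Abelian_group (carrier M \<times> carrier N) Mod tensor_kernel R M N"

text \<open>The map \<open>id \<otimes> f : M \<otimes> N \<rightarrow> M \<otimes> P\<close>, on cosets.\<close>

definition tensor_map ::
    "('r, 'k) ring_scheme \<Rightarrow> ('r, 'm, 'x) module_scheme \<Rightarrow> ('r, 'p, 'y) module_scheme
      \<Rightarrow> ('n \<Rightarrow> 'p) \<Rightarrow> ('m \<times> 'n \<Rightarrow>\<^sub>0 int) set \<Rightarrow> ('m \<times> 'p \<Rightarrow>\<^sub>0 int) set"
  where "tensor_map R M P f Y =
    (\<Union>c\<in>Y. tensor_kernel R M P #>\<^bsub>free_Abelian_group (carrier M \<times> carrier P)\<^esub>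
              frag_extend (\<lambda>(x, y). frag_of (x, f y)) c)"

definition linear_maps ::
    "('r, 'k) ring_scheme \<Rightarrow> ('r, 'n, 'x) module_scheme \<Rightarrow> ('r, 'p, 'y) module_scheme
      \<Rightarrow> ('n \<Rightarrow> 'p) set"
  where "linear_maps R N P =
    {f \<in> carrier N \<rightarrow> carrier P.
      (\<forall>x\<in>carrier N. \<forall>y\<in>carrier N. f (x \<oplus>\<^bsub>N\<^esub> y) = f x \<oplus>\<^bsub>P\<^esub> f y) \<and>
      (\<forall>r\<in>carrier R. \<forall>x\<in>carrier N. f (r \<odot>\<^bsub>N\<^esub> x) = r \<odot>\<^bsub>P\<^esub> f x)}"

text \<open>Flatness: \<open>M \<otimes>\<^sub>R -\<close> preserves injectivity.  HOL cannot quantify over types inside a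
  formula, so the carrier types \<open>'n\<close>, \<open>'p\<close> of the test modules are parameters; a theorem with
  \<open>'n\<close> and \<open>'p\<close> free asserts the property for all test modules.\<close>

definition flat_module ::
    "'n itself \<Rightarrow> 'p itself \<Rightarrow> ('r, 'k) ring_scheme \<Rightarrow> ('r, 'm, 'x) module_scheme \<Rightarrow> bool"
  where "flat_module _ _ R M \<longleftrightarrow>
    Module.module R M \<and>
    (\<forall>(N :: ('r, 'n) module) (P :: ('r, 'p) module). \<forall>f \<in> linear_maps R N P.
      Module.module R N \<longrightarrow> Module.module R P \<longrightarrow> inj_on f (carrier N) \<longrightarrow>
      inj_on (tensor_map R M P f) (carrier (tensor R M N)))"


section \<open>Scalars and generating series\<close>

type_synonym cv = "complex poly fract"  \<comment> \<open>the field \<open>\<complex>(v)\<close>\<close>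

definition vv :: cv
  where "vv = Fraction_Field.Fract [:0, 1:] 1"

definition qint :: "int \<Rightarrow> cv"
  where "qint n = (vv powi n - vv powi (- n)) / (vv - inverse vv)"

text \<open>\<open>x\<^sup>n\<close> for an element \<open>x\<close> with designated inverse \<open>x'\<close>.\<close>

definition zpow :: "'a::ring_1 \<Rightarrow> 'a \<Rightarrow> int \<Rightarrow> 'a"
  where "zpow x x' n = (if n \<ge> 0 then x ^ nat n else x' ^ nat (- n))"

definition commutator :: "'a::ring_1 \<Rightarrow> 'a \<Rightarrow> 'a"
  where "commutator x y = x * y - y * x"

text \<open>In this section and the next, \<open>\<iota>\<close> is the structure map of a \<open>\<complex>(v)\<close>-algebra.
  \<open>exp_series \<iota> q h\<close> is \<open>exp (q \<Sum>\<^sub>k\<^sub>\<ge>\<^sub>1 h\<^sub>k u\<^sup>k)\<close> as a power series in \<open>u\<close>.\<close>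

definition exp_series :: "(cv \<Rightarrow> 'a::ring_1) \<Rightarrow> cv \<Rightarrow> (nat \<Rightarrow> 'a) \<Rightarrow> 'a fps"
  where "exp_series \<iota> q h =
    Abs_fps (\<lambda>n. \<iota> (1 / of_nat (fact n))) oo Abs_fps (\<lambda>k. if k = 0 then 0 else \<iota> q * h k)"

text \<open>\<open>\<Sum>\<^sub>k\<^sub>\<ge>\<^sub>0 \<Psi>\<^sub>k\<^sub>-\<^sub>1 u\<^sup>k = a exp ((v - v\<^sup>-\<^sup>1) \<Sum>\<^sub>k\<^sub>\<ge>\<^sub>1 H\<^sub>k u\<^sup>k)\<close>, with \<open>\<Psi>\<^sub>k = 0\<close> for \<open>k < -1\<close>\<close>

definition plus_mode :: "(cv \<Rightarrow> 'a::ring_1) \<Rightarrow> 'a \<Rightarrow> (int \<Rightarrow> 'a) \<Rightarrow> int \<Rightarrow> 'a"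
  where "plus_mode \<iota> a H k =
    (if k < -1 then 0
     else fps_nth (fps_const a * exp_series \<iota> (vv - inverse vv) (\<lambda>j. H (int j))) (nat (k + 1)))"

text \<open>\<open>\<Sum>\<^sub>k\<^sub>\<ge>\<^sub>0 \<Phi>\<^sub>-\<^sub>k\<^sub>+\<^sub>1 u\<^sup>k = a exp (-(v - v\<^sup>-\<^sup>1) \<Sum>\<^sub>k\<^sub>\<ge>\<^sub>1 H\<^sub>-\<^sub>k u\<^sup>k)\<close>, with \<open>\<Phi>\<^sub>k = 0\<close> for \<open>k > 1\<close>\<close>

definition minus_mode :: "(cv \<Rightarrow> 'a::ring_1) \<Rightarrow> 'a \<Rightarrow> (int \<Rightarrow> 'a) \<Rightarrow> int \<Rightarrow> 'a"
  where "minus_mode \<iota> a H k =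
    (if k > 1 then 0
     else fps_nth (fps_const a * exp_series \<iota> (- (vv - inverse vv)) (\<lambda>j. H (- int j))) (nat (1 - k)))"


section \<open>The algebras\<close>

typedef nonzero_int = "{n :: int. n \<noteq> 0}"
  by (rule exI[of _ 1]) simp

text \<open>\<open>GenC\<close> stands for \<open>C\<^sup>1\<^sup>/\<^sup>2\<close>, and a trailing \<open>i\<close> marks the inverse.\<close>

datatype drinfeld_gen =
  GenE int | GenF int | GenH nonzero_int | GenS | GenSi | GenK | GenKi | GenC | GenCi

text \<open>The Drinfeld-type relations shared by the deformed algebra and its \<open>t\<close>-family, for an
  interpretation \<open>x\<close> of the symbols in a ring.
  Note that \<open>c = C\<^sup>1\<^sup>/\<^sup>2\<close>, so \<open>C\<^sup>l\<close> is \<open>c\<close> to the power \<open>2 l\<close>.  The symbols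
  \<open>S\<^sup>\<plusminus>\<^sup>1\<close>, \<open>K\<^sup>\<plusminus>\<^sup>1\<close>, \<open>C\<^sup>\<plusminus>\<^sup>1\<^sup>/\<^sup>2\<close> being mutually inverse is part of the relations.\<close>

definition drinfeld_rels :: "(cv \<Rightarrow> 'a::ring_1) \<Rightarrow> (drinfeld_gen \<Rightarrow> 'a) \<Rightarrow> 'a set"
  where "drinfeld_rels \<iota> x =
   (let E = (\<lambda>l. x (GenE l)); F = (\<lambda>l. x (GenF l)); H = (\<lambda>n. x (GenH (Abs_nonzero_int n)));
        S = x GenS; Si = x GenSi; K = x GenK; Ki = x GenKi; c = x GenC; ci = x GenCi;
        \<Psi> = plus_mode \<iota> K H; \<Phi> = minus_mode \<iota> Ki H
    in
      {S * Si - 1, Si * S - 1, K * Ki - 1, Ki * K - 1, c * ci - 1, ci * c - 1} \<union>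
      {S * S - K * c} \<union>
      {S * E k * Si - \<iota> vv * E k | k. True} \<union>
      {S * F k * Si - \<iota> (inverse vv) * F k | k. True} \<union>
      {S * H n * Si - H n | n. n \<noteq> 0} \<union>
      {(E (k + 1) * E l - \<iota> (vv ^ 2) * E l * E (k + 1))
        - (\<iota> (vv ^ 2) * E k * E (l + 1) - E (l + 1) * E k) | k l. True} \<union>
      {(F (k + 1) * F l - \<iota> (vv powi (-2)) * F l * F (k + 1))
        - (\<iota> (vv powi (-2)) * F k * F (l + 1) - F (l + 1) * F k) | k l. True} \<union>
      {commutator (E k) (F l)
        - \<iota> (1 / (vv - inverse vv))
          * (zpow c ci (k - l) * \<Psi> (k + l) - zpow c ci (l - k) * \<Phi> (k + l)) | k l. True} \<union>
      {commutator (H l) (E k)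
        - \<iota> (qint (2 * l) / of_int l) * zpow c ci (- \<bar>l\<bar>) * E (k + l) | k l. l \<noteq> 0} \<union>
      {commutator (H l) (F k)
        + \<iota> (qint (2 * l) / of_int l) * zpow c ci \<bar>l\<bar> * F (k + l) | k l. l \<noteq> 0} \<union>
      {commutator (H l) (H k)
        - (if l = - k
           then \<iota> (qint (2 * l) / of_int l) *
                (\<iota> (1 / (vv - inverse vv)) * (zpow c ci (2 * l) - zpow c ci (- (2 * l))))
           else 0) | k l. k \<noteq> 0 \<and> l \<noteq> 0})"

definition central_rels :: "'a::ring_1 \<Rightarrow> 'a set"
  where "central_rels z = {commutator z y | y. True}"

definition deformed_qaffine :: "(cv, (drinfeld_gen, cv) free_alg set) module"
  where "deformed_qaffine =
    presented_algebra (drinfeld_rels scalar gen \<union> central_rels (gen GenC))"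

text \<open>\<open>TildeC\<close> stands for the square root of \<open>C\<close> with a tilde.\<close>

datatype At_gen = Base drinfeld_gen | TildeC | TildeCi

text \<open>\<open>cv poly\<close> is \<open>\<complex>(v)[t]\<close>, with \<open>t = [:0, 1:]\<close>.\<close>

definition At :: "(cv poly, (At_gen, cv poly) free_alg set) module"
  where "At = presented_algebra
    (drinfeld_rels (\<lambda>a. scalar [:a:]) (\<lambda>g. gen (Base g)) \<union>
     {gen TildeC * gen TildeCi - 1, gen TildeCi * gen TildeC - 1} \<union>
     central_rels (gen TildeC) \<union>
     {(gen (Base GenC) - 1) - scalar [:0, 1:] * (gen TildeC - 1)})"

text \<open>The quotient of a \<open>\<complex>(v)[t]\<close>-algebra by the ideal generated by \<open>p(t)\<close>, as a
  \<open>\<complex>(v)\<close>-algebra.\<close>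

definition specialize :: "(cv poly, 'a) module \<Rightarrow> cv poly \<Rightarrow> (cv, 'a set) module"
  where "specialize A p =
    restrict_scalars (\<lambda>a. [:a:]) (quotient_algebra A (genideal A {p \<odot>\<^bsub>A\<^esub> \<one>\<^bsub>A\<^esub>}))"

text \<open>The inclusion of \<open>\<complex>[t]\<close> into \<open>\<complex>(v)[t]\<close>.\<close>

definition incl_Ct :: "complex poly \<Rightarrow> cv poly"
  where "incl_Ct = map_poly (\<lambda>a. Fraction_Field.Fract [:a:] 1)"

datatype ft_gen =
  Gen_e int | Gen_f int | Gen_h nonzero_int | Gen_phip | Gen_phip_i | Gen_phim | Gen_phim_i

definition ft_rels :: "(cv \<Rightarrow> 'a::ring_1) \<Rightarrow> (ft_gen \<Rightarrow> 'a) \<Rightarrow> 'a set"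
  where "ft_rels \<iota> x =
   (let e = (\<lambda>l. x (Gen_e l)); f = (\<lambda>l. x (Gen_f l)); h = (\<lambda>n. x (Gen_h (Abs_nonzero_int n)));
        p = x Gen_phip; pinv = x Gen_phip_i; m = x Gen_phim; minv = x Gen_phim_i;
        \<psi>p = plus_mode \<iota> (p ^ 2) h; \<psi>m = minus_mode \<iota> (m ^ 2) h
    in
      {p * pinv - 1, pinv * p - 1, m * minv - 1, minv * m - 1} \<union>
      {p * m - m * p} \<union>
      {p * e k * pinv - \<iota> vv * e k | k. True} \<union>
      {m * e k * minv - \<iota> (inverse vv) * e k | k. True} \<union>
      {p * f k * pinv - \<iota> (inverse vv) * f k | k. True} \<union>
      {m * f k * minv - \<iota> vv * f k | k. True} \<union>
      {p * h n * pinv - h n | n. n \<noteq> 0} \<union>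
      {m * h n * minv - h n | n. n \<noteq> 0} \<union>
      {(e (k + 1) * e l - \<iota> (vv ^ 2) * e l * e (k + 1))
        - (\<iota> (vv ^ 2) * e k * e (l + 1) - e (l + 1) * e k) | k l. True} \<union>
      {(f (k + 1) * f l - \<iota> (vv powi (-2)) * f l * f (k + 1))
        - (\<iota> (vv powi (-2)) * f k * f (l + 1) - f (l + 1) * f k) | k l. True} \<union>
      {commutator (e k) (f l)
        - \<iota> (1 / (vv - inverse vv)) * (\<psi>p (k + l) - \<psi>m (k + l)) | k l. True} \<union>
      {commutator (h l) (e k) - \<iota> (qint (2 * l) / of_int l) * e (k + l) | k l. l \<noteq> 0} \<union>
      {commutator (h l) (f k) + \<iota> (qint (2 * l) / of_int l) * f (k + l) | k l. l \<noteq> 0} \<union>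
      {commutator (h l) (h k) | k l. k \<noteq> 0 \<and> l \<noteq> 0})"

definition adjoint_shifted_qaffine :: "(cv, (ft_gen, cv) free_alg set) module"
  where "adjoint_shifted_qaffine = presented_algebra (ft_rels scalar gen)"

end

theory Submission
  imports Defs
begin

text \<open>Write \<open>c = C\<^sup>1\<^sup>/\<^sup>2\<close> and \<open>y\<close> for its companion with a tilde, so that \<open>c = 1 + t (y - 1)\<close> in the family
\<open>\<A>\<^sub>t\<close>.

\<^emph>\<open>Flatness.\<close>  \<open>\<complex>[t]\<close> is a principal ideal domain, so it suffices to show that \<open>\<A>\<^sub>t\<close> has no torsion: in
a torsion-free module, the finitely many elements that occur in an element of a tensor product lie in a
finitely generated submodule, which is free (\<open>torsion_free_imp_flat\<close>).
To exclude torsion, let \<open>R\<close> be the localization of \<open>\<complex>(v)[t][y, y\<^sup>-\<^sup>1]\<close> at \<open>c\<close>, and let \<open>M\<close> be the free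
\<open>R\<close>-module on all formal monomials \<open>F\<^sub>w E\<^sub>u H\<^sub>\<mu> S\<^sup>i\<close>, where \<open>w\<close> and \<open>u\<close> are words and \<open>\<mu>\<close> is a multiset.
Moving a generator to its place in such a monomial with the help of the relations defines operators on \<open>M\<close>.
They satisfy all relations of \<open>\<A>\<^sub>t\<close> except the quadratic ones among the \<open>E\<close> and among the \<open>F\<close>; the values
of the latter generate a submodule \<open>N\<close>.  The point of the construction is that \<open>N\<close> is stable under all
operators.  For \<open>E\<^sub>k\<close> this rests on the fact that the commutator of a quadratic relation of one current
with the opposite current vanishes identically (\<open>bracket_E\<close>, \<open>bracket_F\<close>), which is an identity between
the exponential series in the \<open>H\<^sub>n\<close>.  Hence \<open>\<A>\<^sub>t\<close> acts on \<open>M / N\<close>.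
Reading a formal monomial as a product in \<open>\<A>\<^sub>t\<close> gives a map \<open>\<sigma>\<close> from \<open>M\<close> that kills \<open>N\<close> and sends the image
of the vacuum under \<open>f\<close> back to \<open>f\<close>; so \<open>f = 0\<close> in \<open>\<A>\<^sub>t\<close> if and only if \<open>f\<close> sends the vacuum into \<open>N\<close>.
Finally \<open>N\<close> is spanned over \<open>R\<close> by vectors with coefficients in the field \<open>\<complex>(v)\<close>, so it is a direct
summand of \<open>M\<close>, and if \<open>p f\<close> sends the vacuum into \<open>N\<close> for some \<open>p \<noteq> 0\<close> in \<open>\<complex>(v)[t]\<close>, so does \<open>f\<close>
(\<open>N_saturated\<close>, \<open>at_torsion_free\<close>).

\<^emph>\<open>The fibres.\<close>  At \<open>t = 1\<close> the defining relation becomes \<open>c = y\<close>, which makes \<open>c\<close> central and removes the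
additional generator.  At \<open>t = 0\<close> it becomes \<open>c = 1\<close>, and \<open>y\<close> survives as a central invertible element.
All relations with \<open>c = 1\<close> are homogeneous for the grading by the index of the generators, so
\<open>e\<^sub>k = y\<^sup>k E\<^sub>k\<close>, \<open>f\<^sub>k = y\<^sup>k\<^sup>+\<^sup>1 F\<^sub>k\<close>, \<open>h\<^sub>k = y\<^sup>k H\<^sub>k\<close> satisfy the same relations up to a power of \<open>y\<close>; with
\<open>\<phi>\<^sup>+ = S\<close> and \<open>\<phi>\<^sup>- = y S\<^sup>-\<^sup>1\<close> these are the relations of the shifted algebra, where conversely \<open>y\<close> is
recovered as \<open>\<phi>\<^sup>+ \<phi>\<^sup>-\<close>.\<close>

section \<open>Linear extension\<close>

lemma poly_mapping_linear_induct [case_names zero single add]: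
  fixes f :: "'a \<Rightarrow>\<^sub>0 'b::comm_monoid_add"
  assumes "P 0" "\<And>k v. P (Poly_Mapping.single k v)" "\<And>f g. P f \<Longrightarrow> P g \<Longrightarrow> P (f + g)"
  shows "P f"
proof (induction f rule: update_induct)
  case const then show ?case by (simp add: assms)
next
  case (update f a b)
  have "Poly_Mapping.update a b f = f + Poly_Mapping.single a b"
    using update(1) by (intro poly_mapping_eqI)
      (auto simp: lookup_update lookup_add lookup_single when_def in_keys_iff)
  then show ?case using assms update by metis
qed

definition lin_ext :: "('a \<Rightarrow> 'r \<Rightarrow> 'm) \<Rightarrow> ('a \<Rightarrow>\<^sub>0 'r::zero) \<Rightarrow> 'm::comm_monoid_add"
  where "lin_ext \<phi> f = (\<Sum>k\<in>Poly_Mapping.keys f. \<phi> k (Poly_Mapping.lookup f k))"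

lemma lin_ext_superset:
  assumes "finite A" "Poly_Mapping.keys f \<subseteq> A" "\<And>k. \<phi> k 0 = 0"
  shows "lin_ext \<phi> f = (\<Sum>k\<in>A. \<phi> k (Poly_Mapping.lookup f k))"
  unfolding lin_ext_def using assms
  by (intro sum.mono_neutral_left) (auto simp: in_keys_iff)

lemma lin_ext_zero [simp]: "lin_ext \<phi> 0 = 0"
  by (simp add: lin_ext_def)

lemma lin_ext_single [simp]:
  assumes "\<phi> k 0 = 0" shows "lin_ext \<phi> (Poly_Mapping.single k r) = \<phi> k r"
  using assms by (cases "r = 0") (auto simp: lin_ext_def)

lemma lin_ext_add:
  fixes f g :: "'a \<Rightarrow>\<^sub>0 'r::comm_monoid_add"
  assumes "\<And>k. \<phi> k 0 = 0" "\<And>k a b. \<phi> k (a + b) = \<phi> k a + \<phi> k b"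
  shows "lin_ext \<phi> (f + g) = lin_ext \<phi> f + lin_ext \<phi> g"
proof -
  let ?A = "Poly_Mapping.keys f \<union> Poly_Mapping.keys g"
  have "Poly_Mapping.keys (f + g) \<subseteq> ?A" by (rule keys_add)
  then show ?thesis
    using assms lin_ext_superset[of ?A f \<phi>] lin_ext_superset[of ?A g \<phi>] lin_ext_superset[of ?A "f + g" \<phi>]
    by (simp add: lookup_add sum.distrib)
qed

section \<open>Ring homomorphisms and evaluation\<close>

locale rhom =
  fixes h :: "'a::ring_1 \<Rightarrow> 'b::ring_1"
  assumes hom_add: "h (x + y) = h x + h y"
    and hom_mult: "h (x * y) = h x * h y"
    and hom_one: "h 1 = 1"
begin
lemma hom_zero: "h 0 = 0" using hom_add[of 0 0] by simp
lemma hom_minus: "h (- x) = - h x" using hom_add[of x "- x"] hom_zero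
  by (simp add: eq_neg_iff_add_eq_0 add.commute)
lemma hom_diff: "h (x - y) = h x - h y" using hom_add[of x "- y"] hom_minus by simp
lemma hom_power: "h (x ^ n) = h x ^ n" by (induction n) (simp_all add: hom_one hom_mult)
lemma hom_sum: "h (sum f A) = (\<Sum>a\<in>A. h (f a))"
  by (induction A rule: infinite_finite_induct) (simp_all add: hom_zero hom_add)
lemmas homs = hom_zero hom_add hom_mult hom_one hom_minus hom_diff hom_power hom_sum
end

lemma rhom_compose: "rhom f \<Longrightarrow> rhom g \<Longrightarrow> rhom (\<lambda>x. g (f x))"
  unfolding rhom_def by auto

text \<open>The structure map of an algebra.\<close>

locale central_hom = rhom \<iota> for \<iota> :: "'r::comm_ring_1 \<Rightarrow> 'b::ring_1" +
  assumes central: "\<iota> a * x = x * \<iota> a"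

definition ev :: "('r::comm_ring_1 \<Rightarrow> 'b::ring_1) \<Rightarrow> ('g \<Rightarrow> 'b) \<Rightarrow> ('g, 'r) free_alg \<Rightarrow> 'b"
  where "ev \<iota> x = lin_ext (\<lambda>w r. \<iota> r * prod_list (map x (letters w)))"

lemma letters_zero [simp]: "letters 0 = []" and letters_plus [simp]: "letters (a + b) = letters a @ letters b"
  by (simp_all add: zero_word_def plus_word_def)

context central_hom begin
lemma ev_single: "ev \<iota> x (Poly_Mapping.single w r) = \<iota> r * prod_list (map x (letters w))"
  by (simp add: ev_def homs)
lemma ev_add: "ev \<iota> x (f + g) = ev \<iota> x f + ev \<iota> x g"
  unfolding ev_def by (rule lin_ext_add) (simp_all add: homs algebra_simps)
lemma ev_mult: "ev \<iota> x (f * g) = ev \<iota> x f * ev \<iota> x g"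
proof (induction f rule: poly_mapping_linear_induct)
  case zero then show ?case by (simp add: ev_def)
next
  case (add f f') then show ?case by (simp add: ev_add distrib_right)
next
  case (single w r)
  show ?case
  proof (induction g rule: poly_mapping_linear_induct)
    case zero then show ?case by (simp add: ev_def)
  next
    case (add f f') then show ?case by (simp add: ev_add distrib_left)
  next
    case (single w' r')
    have "\<iota> r * \<iota> r' * (p * q) = \<iota> r * p * (\<iota> r' * q)" for p q
      using central[of r' p] by (metis mult.assoc)
    then show ?case by (simp add: ev_single mult_single homs)
  qed
qed
lemma ev_scalar: "ev \<iota> x (scalar r) = \<iota> r" by (simp add: scalar_def ev_single)
lemma ev_gen: "ev \<iota> x (gen g) = x g" by (simp add: gen_def ev_single homs)
lemma rhom_ev: "rhom (ev \<iota> x)"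
  using ev_scalar[of x 1] by unfold_locales (simp_all add: ev_add ev_mult scalar_def homs)
end

lemma central_hom_scalar: "central_hom (scalar :: 'r::comm_ring_1 \<Rightarrow> ('g,'r) free_alg)"
proof
  show "scalar a * x = x * scalar a" for a :: 'r and x :: "('g,'r) free_alg"
    by (induction x rule: poly_mapping_linear_induct)
      (simp_all add: scalar_def mult_single distrib_left distrib_right mult.commute)
qed (simp_all add: scalar_def single_add mult_single)

interpretation scalar: central_hom "scalar :: 'r::comm_ring_1 \<Rightarrow> ('g,'r) free_alg"
  by (rule central_hom_scalar)

lemma free_alg_single: "Poly_Mapping.single w r = scalar r * prod_list (map gen (letters w))"
proof -
  have "prod_list (map gen ws) = (Poly_Mapping.single (Word ws) 1 :: ('a,'b) free_alg)" for ws
    by (induction ws) (simp_all add: gen_def mult_single zero_word_def[symmetric] plus_word_def)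
  then show ?thesis by (simp add: scalar_def mult_single)
qed

lemma free_alg_induct [case_names scalar gen add mult]:
  fixes f :: "('g,'r::comm_ring_1) free_alg"
  assumes "\<And>r. P (scalar r)" "\<And>g. P (gen g)" "\<And>f g. P f \<Longrightarrow> P g \<Longrightarrow> P (f + g)"
    "\<And>f g. P f \<Longrightarrow> P g \<Longrightarrow> P (f * g)"
  shows "P f"
proof (induction f rule: poly_mapping_linear_induct)
  case zero then show ?case using assms(1)[of 0] by (simp add: scalar_def)
next
  case (single w r)
  have "P (scalar 1 * prod_list (map gen ws))" for ws
    by (induction ws) (use assms in \<open>auto simp: scalar.hom_one\<close>, metis assms(1) scalar.hom_one)
  then have "P (prod_list (map gen (letters w)))" by (simp add: scalar.hom_one)
  then show ?case unfolding free_alg_single using assms(1,4) by blast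
qed (use assms in auto)

lemma rhom_free_alg_eqI:
  fixes h h' :: "('g,'r::comm_ring_1) free_alg \<Rightarrow> 'b::ring_1"
  assumes "rhom h" "rhom h'" "\<And>r. h (scalar r) = h' (scalar r)" "\<And>g. h (gen g) = h' (gen g)"
  shows "h f = h' f"
  by (induction f rule: free_alg_induct) (use assms in \<open>auto simp: rhom_def\<close>)

section \<open>Two-sided ideals\<close>

text \<open>Two-sided ideals of a ring whose carrier is a type: \<open>ideal\<close> asks for a record, which the types of cosets below do not have.\<close>

locale two_sided =
  fixes J :: "'a::ring_1 set"
  assumes J_zero: "0 \<in> J" and J_add: "\<lbrakk>x \<in> J; y \<in> J\<rbrakk> \<Longrightarrow> x + y \<in> J"
    and J_left: "x \<in> J \<Longrightarrow> a * x \<in> J" and J_right: "x \<in> J \<Longrightarrow> x * a \<in> J"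
begin
lemma J_minus: "x \<in> J \<Longrightarrow> - x \<in> J" using J_left[of x "-1"] by simp
lemma J_diff: "\<lbrakk>x \<in> J; y \<in> J\<rbrakk> \<Longrightarrow> x - y \<in> J" using J_add[of x "- y"] J_minus by simp
lemma J_equivp: "equivp (\<lambda>x y. x - y \<in> J)"
proof (rule equivpI)
  show "reflp (\<lambda>x y. x - y \<in> J)" by (auto simp: reflp_def J_zero)
  show "symp (\<lambda>x y. x - y \<in> J)" using J_minus by (force simp: symp_def)
  show "transp (\<lambda>x y. x - y \<in> J)" unfolding transp_def
  proof (intro allI impI)
    fix x y z assume "x - y \<in> J" "y - z \<in> J"
    then show "x - z \<in> J" using J_add[of "x - y" "y - z"] by simp
  qed
qed
lemma J_cong_add: "x - x' \<in> J \<Longrightarrow> y - y' \<in> J \<Longrightarrow> (x + y) - (x' + y') \<in> J"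
  using J_add[of "x - x'" "y - y'"] by (simp add: algebra_simps)
lemma J_cong_minus: "x - x' \<in> J \<Longrightarrow> (- x) - (- x') \<in> J"
  using J_minus[of "x - x'"] by (simp add: algebra_simps)
lemma J_cong_diff: "x - x' \<in> J \<Longrightarrow> y - y' \<in> J \<Longrightarrow> (x - y) - (x' - y') \<in> J"
  using J_diff[of "x - x'" "y - y'"] by (simp add: algebra_simps)
lemma J_cong_mult: "x - x' \<in> J \<Longrightarrow> y - y' \<in> J \<Longrightarrow> x * y - x' * y' \<in> J"
  using J_add[OF J_right[of "x - x'" y] J_left[of "y - y'" x']] by (simp add: algebra_simps)
end

lemma two_sided_kernel: "rhom h \<Longrightarrow> two_sided {x. h x = 0}"
proof -
  assume "rhom h" then interpret rhom h .
  show ?thesis by unfold_locales (auto simp: homs)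
qed

definition rel_ideal :: "('g, 'r::comm_ring_1) free_alg set \<Rightarrow> ('g, 'r) free_alg set"
  where "rel_ideal rels = genideal free_algebra rels"

lemma free_algebra_simps [simp]:
  "carrier free_algebra = UNIV" "x \<otimes>\<^bsub>free_algebra\<^esub> y = x * y" "x \<oplus>\<^bsub>free_algebra\<^esub> y = x + y"
  "\<one>\<^bsub>free_algebra\<^esub> = 1" "\<zero>\<^bsub>free_algebra\<^esub> = 0" "c \<odot>\<^bsub>free_algebra\<^esub> x = scalar c * x"
  by (simp_all add: free_algebra_def ring.defs module.defs ring_of_type_algebra_def)

lemma ring_free_algebra: "ring (free_algebra :: ('r::comm_ring_1, ('g,'r) free_alg) module)"
proof -
  have "\<exists>y. x + y = 0" for x :: "('g,'r) free_alg" by (rule exI[of _ "- x"]) simp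
  moreover have "\<exists>y. y + x = 0" for x :: "('g,'r) free_alg" by (rule exI[of _ "- x"]) simp
  ultimately show ?thesis
    by unfold_locales (auto simp: algebra_simps Units_def)
qed

lemma a_inv_free_algebra [simp]: "\<ominus>\<^bsub>free_algebra\<^esub> x = - (x :: ('g,'r::comm_ring_1) free_alg)"
proof -
  interpret ring "free_algebra :: ('r, ('g,'r) free_alg) module" by (rule ring_free_algebra)
  show ?thesis by (rule minus_equality) simp_all
qed

lemma ideal_free_algebra_iff:
  "ideal J (free_algebra :: ('r::comm_ring_1, ('g,'r) free_alg) module) \<longleftrightarrow> two_sided J"
proof
  interpret R: ring "free_algebra :: ('r, ('g,'r) free_alg) module" by (rule ring_free_algebra)
  assume "ideal J (free_algebra :: ('r, ('g,'r) free_alg) module)"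
  then interpret ideal J "free_algebra :: ('r, ('g,'r) free_alg) module" .
  show "two_sided J"
    using additive_subgroup.zero_closed[OF additive_subgroup_axioms]
      additive_subgroup.a_closed[OF additive_subgroup_axioms] I_l_closed I_r_closed
    by unfold_locales auto
next
  assume "two_sided J"
  then interpret two_sided J .
  show "ideal J (free_algebra :: ('r, ('g,'r) free_alg) module)"
  proof (rule idealI[OF ring_free_algebra])
    interpret R: ring "free_algebra :: ('r, ('g,'r) free_alg) module" by (rule ring_free_algebra)
    have "a \<in> J \<Longrightarrow> inv\<^bsub>add_monoid free_algebra\<^esub> a \<in> J" for a
      using a_inv_free_algebra[of a] J_minus by (simp add: a_inv_def)
    then show "subgroup J (add_monoid (free_algebra :: ('r, ('g,'r) free_alg) module))"
      by (unfold_locales) (auto simp: J_zero J_add)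
  qed (auto simp: J_left J_right)
qed

lemma two_sided_rel_ideal: "two_sided (rel_ideal rels)"
  unfolding rel_ideal_def ideal_free_algebra_iff[symmetric]
  by (rule ring.genideal_ideal[OF ring_free_algebra]) simp

lemma rel_ideal_superset: "rels \<subseteq> rel_ideal rels"
  unfolding rel_ideal_def by (rule ring.genideal_self[OF ring_free_algebra]) simp

lemma rel_ideal_minimal: "two_sided I \<Longrightarrow> rels \<subseteq> I \<Longrightarrow> rel_ideal rels \<subseteq> I"
  unfolding rel_ideal_def ideal_free_algebra_iff[symmetric]
  by (rule ring.genideal_minimal[OF ring_free_algebra])

lemma rel_ideal_kernel:
  assumes "rhom h" "\<And>r. r \<in> rels \<Longrightarrow> h r = 0" "f \<in> rel_ideal rels"
  shows "h f = 0"
  using rel_ideal_minimal[OF two_sided_kernel[OF assms(1)], of rels] assms(2,3) by auto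

section \<open>Quotient algebras as rings of cosets\<close>

text \<open>The record consists of the cosets \<open>d f\<close> of the ideal \<open>J\<close>, and a scalar \<open>r\<close> acts as multiplication by
  \<open>s r\<close>.  All algebras of the theorem have this shape; the predicate allows one to compute with
  representatives.\<close>

definition cosets_of ::
    "('r::comm_ring_1, 'c, 'm) module_scheme \<Rightarrow> ('f::ring_1 \<Rightarrow> 'c) \<Rightarrow> 'f set \<Rightarrow> ('r \<Rightarrow> 'f) \<Rightarrow> bool"
  where "cosets_of A d J s \<longleftrightarrow> carrier A = range d \<and> (\<forall>f g. d f = d g \<longleftrightarrow> f - g \<in> J) \<and>
    (\<forall>f g. d f \<otimes>\<^bsub>A\<^esub> d g = d (f * g)) \<and> (\<forall>f g. d f \<oplus>\<^bsub>A\<^esub> d g = d (f + g)) \<and>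
    \<one>\<^bsub>A\<^esub> = d 1 \<and> \<zero>\<^bsub>A\<^esub> = d 0 \<and> (\<forall>c f. c \<odot>\<^bsub>A\<^esub> d f = d (s c * f))"

lemma cosets_ring:
  assumes "cosets_of A d J s" shows "ring A"
proof -
  have c: "carrier A = range d" and m: "\<And>f g. d f \<otimes>\<^bsub>A\<^esub> d g = d (f * g)" and
    a: "\<And>f g. d f \<oplus>\<^bsub>A\<^esub> d g = d (f + g)" and o: "\<one>\<^bsub>A\<^esub> = d 1" and z: "\<zero>\<^bsub>A\<^esub> = d 0"
    using assms unfolding cosets_of_def by auto
  show ?thesis
  proof (rule ringI)
    show "abelian_group A"
    proof (rule abelian_groupI)
      fix x assume "x \<in> carrier A"
      then obtain f where "x = d f" using c by auto
      then have "d (- f) \<in> carrier A" "d (- f) \<oplus>\<^bsub>A\<^esub> x = \<zero>\<^bsub>A\<^esub>" by (auto simp: c a z)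
      then show "\<exists>y\<in>carrier A. y \<oplus>\<^bsub>A\<^esub> x = \<zero>\<^bsub>A\<^esub>" by blast
    qed (auto simp: c a z add_ac)
    show "Group.monoid A" by (rule monoidI) (auto simp: c m o mult.assoc)
  qed (auto simp: c a m algebra_simps)
qed

text \<open>Two quotients, of possibly different rings, are isomorphic as soon as both rings map onto a third ring
  with the right kernels.  No map between the cosets has to be written down, and no inverse to be checked.\<close>

lemma cosets_algebra_isomorphic:
  assumes A: "cosets_of A d J s" and B: "cosets_of B d' J' s'"
    and h: "rhom h" "surj h" "\<And>f. h f = 0 \<longleftrightarrow> f \<in> J"
    and h': "rhom h'" "surj h'" "\<And>f. h' f = 0 \<longleftrightarrow> f \<in> J'"
    and s: "\<And>c. h (s c) = h' (s' c)"
  shows "algebra_isomorphic R A B"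
proof -
  interpret h: rhom h by fact
  interpret h': rhom h' by fact
  have cA: "carrier A = range d" and mA: "\<And>f g. d f \<otimes>\<^bsub>A\<^esub> d g = d (f * g)" and
    aA: "\<And>f g. d f \<oplus>\<^bsub>A\<^esub> d g = d (f + g)" and oA: "\<one>\<^bsub>A\<^esub> = d 1" and
    eA: "\<And>f g. d f = d g \<longleftrightarrow> f - g \<in> J" and scA: "\<And>c f. c \<odot>\<^bsub>A\<^esub> d f = d (s c * f)"
    using A unfolding cosets_of_def by auto
  have cB: "carrier B = range d'" and mB: "\<And>f g. d' f \<otimes>\<^bsub>B\<^esub> d' g = d' (f * g)" and
    aB: "\<And>f g. d' f \<oplus>\<^bsub>B\<^esub> d' g = d' (f + g)" and oB: "\<one>\<^bsub>B\<^esub> = d' 1" and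
    eB: "\<And>f g. d' f = d' g \<longleftrightarrow> f - g \<in> J'" and scB: "\<And>c f. c \<odot>\<^bsub>B\<^esub> d' f = d' (s' c * f)"
    using B unfolding cosets_of_def by auto
  have eA': "d f = d g \<longleftrightarrow> h f = h g" for f g
    unfolding eA h(3)[symmetric] by (simp add: h.homs)
  have eB': "d' f = d' g \<longleftrightarrow> h' f = h' g" for f g
    unfolding eB h'(3)[symmetric] by (simp add: h'.homs)
  define k where "k x = d' (SOME g. h' g = h (SOME f. d f = x))" for x
  have k: "k (d f) = d' g" if "h' g = h f" for f g
  proof -
    have "d (SOME f'. d f' = d f) = d f" by (rule someI[of "\<lambda>f'. d f' = d f" f]) simp
    then have 1: "h (SOME f'. d f' = d f) = h f" using eA' by blast
    have "h' (SOME g'. h' g' = h f) = h f" by (rule someI[of "\<lambda>g'. h' g' = h f" g]) (rule that)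
    then show ?thesis unfolding k_def 1 eB' using that by simp
  qed
  have ex: "\<exists>g. h' g = h f" for f using h'(2) by (metis surjD)
  have ex2: "\<exists>f. h f = h' g" for g using h(2) by (metis surjD)
  have kcl: "k x \<in> carrier B" if x: "x \<in> carrier A" for x
  proof -
    obtain f where f: "x = d f" using x[unfolded cA] by blast
    obtain g where "h' g = h f" using ex by blast
    then show ?thesis using k[of g f] f cB by simp
  qed
  have "k \<in> ring_iso A B"
  proof (rule ring_iso_memI)
    fix x assume "x \<in> carrier A"
    then show "k x \<in> carrier B" by (rule kcl)
    fix y assume "y \<in> carrier A"
    obtain f g where fg: "x = d f" "y = d g" using \<open>x \<in> carrier A\<close> \<open>y \<in> carrier A\<close> cA by auto
    obtain f' g' where fg': "h' f' = h f" "h' g' = h g" using ex by metis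
    have "k (d f) = d' f'" "k (d g) = d' g'" "k (d (f * g)) = d' (f' * g')" "k (d (f + g)) = d' (f' + g')"
      by (intro k; simp add: fg' h.homs h'.homs)+
    then show "k (x \<otimes>\<^bsub>A\<^esub> y) = k x \<otimes>\<^bsub>B\<^esub> k y" "k (x \<oplus>\<^bsub>A\<^esub> y) = k x \<oplus>\<^bsub>B\<^esub> k y"
      by (simp_all add: fg mA aA mB aB)
  next
    show "k \<one>\<^bsub>A\<^esub> = \<one>\<^bsub>B\<^esub>" unfolding oA oB by (rule k) (simp add: h.homs h'.homs)
    have "inj_on k (carrier A)"
    proof (rule inj_onI)
      fix x y assume "x \<in> carrier A" "y \<in> carrier A" and kk: "k x = k y"
      then obtain f g where fg: "x = d f" "y = d g" using cA by auto
      obtain f' g' where fg': "h' f' = h f" "h' g' = h g" using ex by metis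
      have "d' f' = d' g'" using kk k fg fg' by metis
      then show "x = y" using fg fg' eA' eB' by metis
    qed
    moreover have "k ` carrier A = carrier B"
    proof
      show "k ` carrier A \<subseteq> carrier B" by (rule image_subsetI) (rule kcl)
      show "carrier B \<subseteq> k ` carrier A"
      proof
        fix y assume "y \<in> carrier B"
        then obtain g where g: "y = d' g" using cB by auto
        obtain f where "h f = h' g" using ex2 by blast
        then have "k (d f) = y" using k[of g f] g by simp
        then show "y \<in> k ` carrier A" using cA by blast
      qed
    qed
    ultimately show "bij_betw k (carrier A) (carrier B)" by (simp add: bij_betw_def)
  qed
  moreover have "k (c \<odot>\<^bsub>A\<^esub> x) = c \<odot>\<^bsub>B\<^esub> k x" if x: "x \<in> carrier A" for c x
  proof -
    obtain f where f: "x = d f" using x unfolding cA by blast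
    obtain f' where f': "h' f' = h f" using ex by blast
    have "k (d f) = d' f'" "k (d (s c * f)) = d' (s' c * f')"
      by (intro k; simp add: f' h.homs h'.homs s)+
    then show ?thesis by (simp add: f scA scB)
  qed
  ultimately show ?thesis unfolding algebra_isomorphic_def by blast
qed

lemma a_r_coset_eq_iff:
  assumes "ideal K A" "x \<in> carrier A" "y \<in> carrier A"
  shows "K +>\<^bsub>A\<^esub> x = K +>\<^bsub>A\<^esub> y \<longleftrightarrow> x \<ominus>\<^bsub>A\<^esub> y \<in> K"
  using ring.quotient_eq_iff_same_a_r_cos[OF ideal.axioms(2)[OF assms(1)] assms] by simp

lemma cosets_quotient:
  assumes A: "cosets_of A d J s" and ts: "two_sided J" and K: "ideal K A"
    and cen: "\<And>c x. s c * x = x * s c"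
  shows "cosets_of (quotient_algebra A K) (\<lambda>f. K +>\<^bsub>A\<^esub> d f) {f. d f \<in> K} s"
proof -
  have cA: "carrier A = range d" and mA: "\<And>f g. d f \<otimes>\<^bsub>A\<^esub> d g = d (f * g)" and
    aA: "\<And>f g. d f \<oplus>\<^bsub>A\<^esub> d g = d (f + g)" and oA: "\<one>\<^bsub>A\<^esub> = d 1" and zA: "\<zero>\<^bsub>A\<^esub> = d 0" and
    eA: "\<And>f g. d f = d g \<longleftrightarrow> f - g \<in> J" and scA: "\<And>c f. c \<odot>\<^bsub>A\<^esub> d f = d (s c * f)"
    using A unfolding cosets_of_def by auto
  interpret K: ideal K A by fact
  let ?D = "\<lambda>f. K +>\<^bsub>A\<^esub> d f"
  have neg: "\<ominus>\<^bsub>A\<^esub> d g = d (- g)" for g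
    by (rule K.minus_equality) (auto simp: aA zA cA)
  have eq: "?D f = ?D g \<longleftrightarrow> d (f - g) \<in> K" for f g
    using a_r_coset_eq_iff[OF K, of "d f" "d g"] by (simp add: a_minus_def cA neg aA)
  have "rcoset_mult A K (?D f) (?D g) = ?D (f * g)" for f g
    using K.rcoset_mult_add[of "d f" "d g"] by (simp add: cA mA)
  moreover have "?D f <+>\<^bsub>A\<^esub> ?D g = ?D (f + g)" for f g
    using K.a_rcos_sum[of "d f" "d g"] by (simp add: cA aA)
  moreover have "K = ?D 0"
    using K.a_rcos_zero[OF K additive_subgroup.zero_closed[OF ideal.axioms(1)[OF K]]] zA by simp
  moreover have "(\<Union>a\<in>?D f. K +>\<^bsub>A\<^esub> (c \<odot>\<^bsub>A\<^esub> a)) = ?D (s c * f)" for c f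
  proof -
    have "K +>\<^bsub>A\<^esub> (c \<odot>\<^bsub>A\<^esub> a) = ?D (s c * f)" if a: "a \<in> ?D f" for a
    proof -
      obtain k where k: "k \<in> K" "a = k \<oplus>\<^bsub>A\<^esub> d f" using a unfolding a_r_coset_def' by blast
      obtain kf where kf: "k = d kf" using K.Icarr[OF k(1)] cA by auto
      have "d (s c) \<otimes>\<^bsub>A\<^esub> d kf \<in> K" using K.I_l_closed[of k "d (s c)"] k(1) kf cA by auto
      then show ?thesis using k kf by (simp add: aA scA eq mA algebra_simps)
    qed
    moreover have "d f \<in> ?D f"
      using abelian_subgroup.a_rcos_self[OF abelian_subgroupI3[OF ideal.axioms(1)[OF K] K.is_abelian_group], of "d f"] cA by simp
    ultimately show ?thesis by blast
  qed
  moreover have "carrier (A Quot K) = range ?D"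
    by (auto simp: FactRing_def A_RCOSETS_def' cA)
  ultimately show ?thesis
    unfolding cosets_of_def quotient_algebra_def
    by (auto simp: ring.defs module.defs FactRing_def eq oA)
qed

lemma cosets_presented:
  "cosets_of (presented_algebra rels) (\<lambda>f. rel_ideal rels +>\<^bsub>free_algebra\<^esub> f) (rel_ideal rels) scalar"
proof -
  have "cosets_of (free_algebra :: ('b, ('a,'b) free_alg) module) (\<lambda>f. f) {0} scalar"
    by (auto simp: cosets_of_def)
  moreover have "two_sided {0 :: ('a,'b) free_alg}" by unfold_locales auto
  moreover have "ideal (rel_ideal rels) (free_algebra :: ('b, ('a,'b) free_alg) module)"
    by (simp add: ideal_free_algebra_iff two_sided_rel_ideal)
  ultimately show ?thesis
    unfolding presented_algebra_def rel_ideal_def[symmetric]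
    using cosets_quotient[where d = "\<lambda>f. f"] scalar.central by fastforce
qed

section \<open>The field \<open>\<complex>(v)\<close>\<close>

instance fract :: ("{idom, ring_char_0}") ring_char_0
proof
  show "inj (of_nat :: nat \<Rightarrow> 'a fract)"
    by (rule injI) (simp add: of_nat_fract eq_fract)
qed

lemma vv_neq_0 [simp]: "vv \<noteq> 0"
  by (simp add: vv_def Zero_fract_def eq_fract)

lemma vv_diff_neq_0: "vv - inverse vv \<noteq> 0"
proof
  assume "vv - inverse vv = 0"
  then have "vv * vv = 1" by (simp add: field_simps)
  then show False by (simp add: vv_def One_fract_def eq_fract one_pCons)
qed

lemma qint_coeff: "l \<noteq> 0 \<Longrightarrow> of_int l * (vv - inverse vv) * (qint (2 * l) / of_int l) = vv powi (2 * l) - vv powi (- (2 * l))"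
  using vv_diff_neq_0 by (simp add: qint_def)

section \<open>The exponential series\<close>

definition cent :: "'a::ring_1 \<Rightarrow> bool" where "cent z \<longleftrightarrow> (\<forall>x. z * x = x * z)"

lemma cent_comm: "cent z \<Longrightarrow> x * z = z * x" by (simp add: cent_def)
lemma cent_left: "cent z \<Longrightarrow> x * (z * u) = z * (x * u)"
  unfolding cent_def by (metis mult.assoc)
lemma cent_mult: "cent a \<Longrightarrow> cent b \<Longrightarrow> cent (a * b)"
  unfolding cent_def by (metis mult.assoc)
lemma cent_one: "cent 1" by (simp add: cent_def)
lemma cent_power: "cent a \<Longrightarrow> cent (a ^ n)"
  by (induction n) (auto simp: cent_one cent_mult)
lemma cent_zpow: "cent a \<Longrightarrow> cent b \<Longrightarrow> cent (zpow a b n)"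
  by (simp add: zpow_def cent_power)
lemma cent_of_nat: "cent (of_nat n)"
  by (simp add: cent_def mult_of_nat_commute)
lemma (in central_hom) cent_iota: "cent (\<iota> a)"
  by (simp add: cent_def central)
lemma cent_add: "cent a \<Longrightarrow> cent b \<Longrightarrow> cent (a + b)"
  and cent_diff: "cent a \<Longrightarrow> cent b \<Longrightarrow> cent (a - b)"
  by (simp_all add: cent_def algebra_simps)

lemma fps_deriv_power_commuting:
  fixes b :: "'a::ring_1 fps"
  assumes "b * fps_deriv b = fps_deriv b * b"
  shows "fps_deriv (b ^ Suc i) = of_nat (Suc i) * (fps_deriv b * b ^ i)"
proof (induction i)
  case 0 then show ?case by simp
next
  case (Suc i)
  have "b * (of_nat (Suc i) * (fps_deriv b * b ^ i)) = of_nat (Suc i) * (fps_deriv b * b ^ Suc i)"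
    unfolding power_Suc by (subst cent_left[OF cent_of_nat]) (simp only: assms mult.assoc[symmetric])
  then show ?case using Suc
    by (subst power_Suc, subst fps_deriv_mult) (simp add: algebra_simps)
qed

lemma fps_power_nth_eq_0:
  fixes b :: "'a::ring_1 fps"
  assumes "b $ 0 = 0" shows "m < i \<Longrightarrow> (b ^ i) $ m = 0"
proof (induction i arbitrary: m)
  case (Suc i)
  have "b $ j * (b ^ i) $ (m - j) = 0" if "j \<in> {0..m}" for j
    using Suc that assms by (cases "j = 0") auto
  then show ?case by (simp add: fps_mult_nth)
qed simp

context central_hom begin
lemma of_nat_hom: "\<iota> (of_nat n) = of_nat n"
  by (induction n) (simp_all add: homs)
end

text \<open>The coefficients of \<open>b = q \<Sum> h\<^sub>k u\<^sup>k\<close> commute with each other, so \<open>(exp b)' = b' exp b\<close> holds over any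
  ring.  Comparison of coefficients gives a recursion that determines \<open>exp b\<close>; the exchange
  relations below are proved by induction along this recursion.\<close>

lemma exp_series_recurrence:
  fixes \<iota> :: "cv \<Rightarrow> 'a::ring_1" and h :: "nat \<Rightarrow> 'a" and q :: cv
  assumes "central_hom \<iota>" and comm: "\<And>i j. i \<ge> 1 \<Longrightarrow> j \<ge> 1 \<Longrightarrow> h i * h j = h j * h i"
  shows "exp_series \<iota> q h $ 0 = 1 \<and>
    of_nat m * exp_series \<iota> q h $ m = (\<Sum>n=1..m. \<iota> (of_nat n * q) * h n * exp_series \<iota> q h $ (m - n))"
proof -
  interpret central_hom \<iota> by fact
  define e where "e = fps_nth (exp_series \<iota> q h)"
  define b where "b = Abs_fps (\<lambda>k. if k = 0 then 0 else \<iota> q * h k)"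
  have b0: "b $ 0 = 0" by (simp add: b_def)
  have e_def': "e m = (\<Sum>i=0..m. \<iota> (1 / of_nat (fact i)) * (b ^ i) $ m)" for m
    by (simp add: e_def exp_series_def fps_compose_def b_def)
  have e0: "e 0 = 1" by (simp add: e_def' homs)
  have e_le: "e m = (\<Sum>i=0..M. \<iota> (1 / of_nat (fact i)) * (b ^ i) $ m)" if "m \<le> M" for m M
    unfolding e_def' using that by (intro sum.mono_neutral_left) (auto simp: fps_power_nth_eq_0[OF b0])
  have bb: "b $ i * b $ j = b $ j * b $ i" for i j
  proof (cases "i = 0 \<or> j = 0")
    case False
    have "\<iota> q * h i * (\<iota> q * h j) = \<iota> q * \<iota> q * (h i * h j)" for i j
      by (simp add: mult.assoc cent_left[OF cent_iota, of "h _"])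
    then show ?thesis using False comm[of i j] by (simp add: b_def)
  next
    case True
    then show ?thesis by (elim disjE) (simp_all only: b0 mult_zero_left mult_zero_right)
  qed
  have swap: "b * fps_deriv b = fps_deriv b * b"
  proof (rule fps_ext)
    fix n
    have "(b * fps_deriv b) $ n = (\<Sum>i=0..n. of_nat (n - i + 1) * (b $ i * b $ (n - i + 1)))"
      unfolding fps_mult_nth fps_deriv_nth by (intro sum.cong refl cent_left[OF cent_of_nat])
    also have "\<dots> = (\<Sum>i=0..n. of_nat (i + 1) * (b $ (n - i) * b $ (i + 1)))"
      by (rule sum.reindex_bij_witness[of _ "\<lambda>i. n - i" "\<lambda>i. n - i"]) auto
    also have "\<dots> = (fps_deriv b * b) $ n"
      unfolding fps_mult_nth fps_deriv_nth by (intro sum.cong refl) (simp add: bb mult.assoc)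
    finally show "(b * fps_deriv b) $ n = (fps_deriv b * b) $ n" .
  qed
  have rec: "of_nat m * e m = (\<Sum>n=1..m. \<iota> (of_nat n * q) * h n * e (m - n))"
  proof (cases m)
    case (Suc k)
    have term_eq: "of_nat m * (\<iota> (1 / of_nat (fact (Suc i))) * (b ^ Suc i) $ m)
        = \<iota> (1 / of_nat (fact i)) * (fps_deriv b * b ^ i) $ k" for i
    proof -
      have "of_nat m * (b ^ Suc i) $ m = fps_deriv (b ^ Suc i) $ k"
        unfolding fps_deriv_nth Suc by (simp only: Suc_eq_plus1)
      also have "\<dots> = of_nat (Suc i) * (fps_deriv b * b ^ i) $ k"
        unfolding fps_deriv_power_commuting[OF swap] by (simp add: fps_of_nat[symmetric] del: of_nat_Suc)
      finally have 1: "of_nat m * (b ^ Suc i) $ m = \<iota> (of_nat (Suc i)) * (fps_deriv b * b ^ i) $ k"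
        by (simp only: of_nat_hom)
      have "1 / of_nat (fact (Suc i)) * of_nat (Suc i) = (1 / of_nat (fact i) :: cv)"
        unfolding fact_Suc of_nat_mult of_nat_id using of_nat_neq_0[of i, where 'a = cv]
        by (simp del: of_nat_Suc of_nat_fact)
      then have "\<iota> (1 / of_nat (fact (Suc i))) * \<iota> (of_nat (Suc i)) = \<iota> (1 / of_nat (fact i))"
        by (metis hom_mult)
      then show ?thesis using 1
        by (subst cent_left[OF cent_iota]) (simp only: 1 mult.assoc[symmetric])
    qed
    have "of_nat m * e m = (\<Sum>i=0..Suc k. of_nat m * (\<iota> (1 / of_nat (fact i)) * (b ^ i) $ m))"
      unfolding e_def' Suc sum_distrib_left by (rule refl)
    also have "\<dots> = (\<Sum>i=0..k. of_nat m * (\<iota> (1 / of_nat (fact (Suc i))) * (b ^ Suc i) $ m))"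
      by (subst sum.atLeast0_atMost_Suc_shift) (simp add: Suc o_def del: power_Suc of_nat_Suc fact_Suc)
    also have "\<dots> = (\<Sum>i=0..k. \<iota> (1 / of_nat (fact i)) * (fps_deriv b * b ^ i) $ k)"
      by (simp only: term_eq)
    also have "\<dots> = (\<Sum>i=0..k. \<Sum>n=0..k. \<iota> (1 / of_nat (fact i)) * (fps_deriv b $ n * (b ^ i) $ (k - n)))"
      unfolding fps_mult_nth sum_distrib_left by (rule refl)
    also have "\<dots> = (\<Sum>n=0..k. \<Sum>i=0..k. fps_deriv b $ n * (\<iota> (1 / of_nat (fact i)) * (b ^ i) $ (k - n)))"
      by (subst sum.swap) (intro sum.cong refl cent_left[OF cent_iota, symmetric])
    also have "\<dots> = (\<Sum>n=0..k. fps_deriv b $ n * (\<Sum>i=0..k. \<iota> (1 / of_nat (fact i)) * (b ^ i) $ (k - n)))"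
      by (simp only: sum_distrib_left)
    also have "\<dots> = (\<Sum>n=0..k. fps_deriv b $ n * e (k - n))"
      by (simp only: e_le[symmetric] diff_le_self)
    also have "\<dots> = (\<Sum>n=1..m. of_nat n * b $ n * e (m - n))"
      unfolding Suc by (rule sum.reindex_bij_witness[of _ "\<lambda>n. n - 1" Suc]) auto
    also have "\<dots> = (\<Sum>n=1..m. \<iota> (of_nat n * q) * h n * e (m - n))"
      by (intro sum.cong refl) (auto simp: b_def homs of_nat_hom mult.assoc)
    finally show ?thesis .
  next
    case 0
    then show ?thesis by simp
  qed
  show ?thesis by (intro conjI e0[unfolded e_def] rec[unfolded e_def])
qed

lemma sum_triangle:
  fixes f :: "nat \<Rightarrow> nat \<Rightarrow> 'a::comm_monoid_add"
  shows "(\<Sum>n=1..m. \<Sum>s\<le>m-n. f n s) = (\<Sum>s\<le>m. \<Sum>n=1..m-s. f n s)"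
    and "(\<Sum>n=1..m. \<Sum>s\<le>m-n. f n s) = (\<Sum>t\<le>m. \<Sum>n=1..t. f n (t - n))"
proof -
  have l: "(\<Sum>n=1..m. \<Sum>s\<le>m-n. f n s) = (\<Sum>(n, s)\<in>(SIGMA n:{1..m}. {..m-n}). f n s)"
    by (rule sum.Sigma) auto
  also have "\<dots> = (\<Sum>(s, n)\<in>(SIGMA s:{..m}. {1..m-s}). f n s)"
    by (rule sum.reindex_bij_witness[of _ "\<lambda>(s,n). (n,s)" "\<lambda>(n,s). (s,n)"]) auto
  also have "\<dots> = (\<Sum>s\<le>m. \<Sum>n=1..m-s. f n s)"
    by (rule sum.Sigma[symmetric]) auto
  finally show "(\<Sum>n=1..m. \<Sum>s\<le>m-n. f n s) = (\<Sum>s\<le>m. \<Sum>n=1..m-s. f n s)" .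
  have "(\<Sum>(n, s)\<in>(SIGMA n:{1..m}. {..m-n}). f n s) = (\<Sum>(t, n)\<in>(SIGMA t:{..m}. {1..t}). f n (t - n))"
    by (rule sum.reindex_bij_witness[of _ "\<lambda>(t,n). (n,t-n)" "\<lambda>(n,s). (s+n,n)"]) auto
  also have "\<dots> = (\<Sum>t\<le>m. \<Sum>n=1..t. f n (t - n))"
    by (rule sum.Sigma[symmetric]) auto
  finally show "(\<Sum>n=1..m. \<Sum>s\<le>m-n. f n s) = (\<Sum>t\<le>m. \<Sum>n=1..t. f n (t - n))"
    using l by simp
qed

text \<open>The Taylor coefficients of \<open>(w\<^sup>2 - y) / (1 - w\<^sup>2 y)\<close> in \<open>y\<close>.\<close>

definition exch_coeff :: "cv \<Rightarrow> nat \<Rightarrow> cv"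
  where "exch_coeff w n = (if n = 0 then w\<^sup>2 else (w\<^sup>2) ^ n * (w\<^sup>2 - inverse (w\<^sup>2)))"

text \<open>The logarithmic derivative of \<open>(w\<^sup>2 - y) / (1 - w\<^sup>2 y)\<close> is
  \<open>\<Sum>\<^sub>n\<^sub>\<ge>\<^sub>1 (w\<^sup>2\<^sup>n - w\<^sup>-\<^sup>2\<^sup>n) y\<^sup>n\<^sup>-\<^sup>1\<close>; up to normalization, these differences are the structure
  constants by which the \<open>H\<^sub>n\<close> act on the currents.\<close>

lemma exch_coeff_recurrence:
  assumes "w \<noteq> 0"
  shows "of_nat s * exch_coeff w s = (\<Sum>n=1..s. ((w\<^sup>2) ^ n - inverse (w\<^sup>2) ^ n) * exch_coeff w (s - n))"
proof (cases s)
  case (Suc r)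
  define W where "W = w\<^sup>2"
  have W: "W \<noteq> 0" using assms by (simp add: W_def)
  let ?g = "exch_coeff w"
  have head: "(\<Sum>n=1..Suc s. c ^ n * ?g (Suc s - n)) = c * (?g s + (\<Sum>n=1..s. c ^ n * ?g (s - n)))" for c s
  proof -
    have "(\<Sum>n=1..Suc s. c ^ n * ?g (Suc s - n)) = (\<Sum>n=0..s. c ^ Suc n * ?g (s - n))"
      by (rule sum.reindex_bij_witness[of _ Suc "\<lambda>n. n - 1"]) auto
    also have "\<dots> = c * (\<Sum>n=0..s. c ^ n * ?g (s - n))"
      by (simp add: sum_distrib_left algebra_simps)
    also have "(\<Sum>n=0..s. c ^ n * ?g (s - n)) = ?g s + (\<Sum>n=1..s. c ^ n * ?g (s - n))"
      by (subst sum.atLeast_Suc_atMost) auto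
    finally show ?thesis .
  qed
  have gS: "?g (Suc r) = W ^ Suc r * (W - inverse W)" for r
    by (simp add: exch_coeff_def W_def)
  have A: "(\<Sum>n=1..Suc r. W ^ n * ?g (Suc r - n)) = W ^ (r + 2) + of_nat r * W ^ Suc r * (W - inverse W)" for r
  proof (induction r)
    case 0 then show ?case by (simp add: exch_coeff_def W_def power2_eq_square)
  next
    case (Suc r) show ?case
      by (subst head, subst Suc) (simp add: gS algebra_simps)
  qed
  have B: "(\<Sum>n=1..Suc r. inverse W ^ n * ?g (Suc r - n)) = W ^ r" for r
  proof (induction r)
    case 0 then show ?case using W by (simp add: exch_coeff_def W_def[symmetric])
  next
    case (Suc r) show ?case
      by (subst head, subst Suc) (use W in \<open>simp add: gS field_simps\<close>)
  qed
  have "(\<Sum>n=1..s. (W ^ n - inverse W ^ n) * ?g (s - n))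
      = W ^ (r + 2) + of_nat r * W ^ Suc r * (W - inverse W) - W ^ r"
    using A[of r] B[of r] unfolding Suc by (simp only: left_diff_distrib sum_subtractf)
  also have "\<dots> = of_nat s * ?g s"
    using W by (simp add: Suc gS field_simps)
  finally show ?thesis by (simp add: W_def)
qed simp

context
  fixes \<iota> :: "cv \<Rightarrow> 'a::ring_1" and d e :: "nat \<Rightarrow> 'a"
  assumes ch: "central_hom \<iota>"
    and rec: "\<And>m. of_nat m * e m = (\<Sum>n=1..m. d n * e (m - n))"
begin

interpretation central_hom \<iota> by (rule ch)

lemma cancel_of_nat: "m > 0 \<Longrightarrow> of_nat m * x = of_nat m * (y :: 'a) \<Longrightarrow> x = y"
proof -
  assume m: "m > 0" and eq: "of_nat m * x = of_nat m * y"
  have "\<iota> (1 / of_nat m) * (of_nat m * z) = z" for z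
    using m by (simp add: of_nat_hom[symmetric] mult.assoc[symmetric] hom_mult[symmetric] hom_one)
  then show "x = y" using eq by metis
qed

text \<open>If each \<open>d\<^sub>n\<close> moves past the family \<open>Y\<close> with a shift by \<open>n\<close>, then their exponential \<open>e\<close> moves past \<open>Y\<close>
  with a power series \<open>g\<close> in the shift, whose logarithmic derivative is given by the \<open>\<gamma>\<^sub>n\<close>.\<close>

lemma exp_exchange:
  fixes Y :: "nat \<Rightarrow> 'a"
  assumes comm: "\<And>n p. n \<ge> 1 \<Longrightarrow> d n * Y p = Y p * d n + \<iota> (\<gamma> n) * y ^ n * Y (p + n)"
    and y: "cent y"
    and e0: "\<And>p. e 0 * Y p = \<iota> (g 0) * Y p * e 0"
    and g: "\<And>s. of_nat s * g s = (\<Sum>n=1..s. \<gamma> n * g (s - n))"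
  shows "e m * Y p = (\<Sum>n\<le>m. \<iota> (g n) * y ^ n * Y (p + n) * e (m - n))"
proof (induction m arbitrary: p rule: less_induct)
  case (less m)
  show ?case
  proof (cases "m = 0")
    case True then show ?thesis by (simp add: e0)
  next
    case False
    have "of_nat m * (e m * Y p) = (\<Sum>n=1..m. d n * (e (m - n) * Y p))"
      by (simp add: mult.assoc[symmetric] rec) (simp add: sum_distrib_right)
    also have "\<dots> = (\<Sum>n=1..m. \<Sum>s\<le>m-n. d n * (\<iota> (g s) * y ^ s * Y (p + s) * e (m - n - s)))"
      by (intro sum.cong refl) (use False in \<open>simp add: less.IH sum_distrib_left\<close>)
    also have "\<dots> = (\<Sum>n=1..m. \<Sum>s\<le>m-n. \<iota> (g s) * y ^ s * Y (p + s) * (d n * e (m - s - n))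
         + \<iota> (\<gamma> n * g s) * y ^ (s + n) * Y (p + (s + n)) * e (m - (s + n)))"
    proof (intro sum.cong refl)
      fix n s assume "n \<in> {1..m}" "s \<in> {..m - n}"
      then have n: "n \<ge> 1" by auto
      have 1: "d n * (\<iota> (g s) * y ^ s * z) = \<iota> (g s) * y ^ s * (d n * z)" for z
        by (rule cent_left) (intro cent_mult cent_iota cent_power y)
      have "d n * (\<iota> (g s) * y ^ s * Y (p + s) * e (m - n - s)) = \<iota> (g s) * y ^ s * (d n * Y (p + s)) * e (m - n - s)"
        using 1[of "Y (p + s) * e (m - n - s)"] by (simp add: mult.assoc)
      also have "d n * Y (p + s) = Y (p + s) * d n + \<iota> (\<gamma> n) * y ^ n * Y (p + s + n)" using n by (rule comm)
      also have "\<iota> (g s) * y ^ s * (\<dots>) * e (m - n - s) = \<iota> (g s) * y ^ s * Y (p + s) * (d n * e (m - s - n))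
          + \<iota> (g s) * y ^ s * (\<iota> (\<gamma> n) * y ^ n * Y (p + s + n)) * e (m - n - s)"
        by (simp add: distrib_left distrib_right mult.assoc add.commute[of n s])
      also have "\<iota> (g s) * y ^ s * (\<iota> (\<gamma> n) * y ^ n * Y (p + s + n)) = \<iota> (\<gamma> n * g s) * y ^ (s + n) * Y (p + (s + n))"
      proof -
        have "\<iota> (g s) * y ^ s * (\<iota> (\<gamma> n) * y ^ n * Y (p + s + n)) = \<iota> (\<gamma> n) * \<iota> (g s) * (y ^ s * y ^ n) * Y (p + s + n)"
          by (simp add: mult.assoc cent_left[OF cent_iota, of "y ^ s"] cent_left[OF cent_iota, of "\<iota> (g s)" "\<gamma> n"])
        then show ?thesis by (simp add: hom_mult power_add add.assoc)
      qed
      finally show "d n * (\<iota> (g s) * y ^ s * Y (p + s) * e (m - n - s)) =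
         \<iota> (g s) * y ^ s * Y (p + s) * (d n * e (m - s - n)) + \<iota> (\<gamma> n * g s) * y ^ (s + n) * Y (p + (s + n)) * e (m - (s + n))"
        by (simp add: add.commute)
    qed
    also have "\<dots> = (\<Sum>s\<le>m. \<Sum>n=1..m-s. \<iota> (g s) * y ^ s * Y (p + s) * (d n * e (m - s - n)))
        + (\<Sum>t\<le>m. \<Sum>n=1..t. \<iota> (\<gamma> n * g (t - n)) * y ^ t * Y (p + t) * e (m - t))"
      unfolding sum.distrib sum_triangle(1)[of "\<lambda>n s. \<iota> (g s) * y ^ s * Y (p + s) * (d n * e (m - s - n))"]
        sum_triangle(2)[of "\<lambda>n s. \<iota> (\<gamma> n * g s) * y ^ (s + n) * Y (p + (s + n)) * e (m - (s + n))"]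
      by (intro arg_cong2[where f = "(+)"] sum.cong refl) auto
    also have "\<dots> = (\<Sum>s\<le>m. \<iota> (g s) * y ^ s * Y (p + s) * (of_nat (m - s) * e (m - s)))
        + (\<Sum>t\<le>m. \<iota> (of_nat t * g t) * y ^ t * Y (p + t) * e (m - t))"
      unfolding rec g hom_sum by (simp only: sum_distrib_left sum_distrib_right)
    also have "\<dots> = (\<Sum>s\<le>m. of_nat m * (\<iota> (g s) * y ^ s * Y (p + s) * e (m - s)))"
      unfolding sum.distrib[symmetric]
    proof (intro sum.cong refl)
      fix s assume "s \<in> {..m}"
      then have "of_nat m = (of_nat s + of_nat (m - s) :: 'a)" by (simp add: of_nat_add[symmetric])
      moreover have "x * (of_nat (m - s) * e (m - s)) = of_nat (m - s) * (x * e (m - s))" for x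
        by (rule cent_left[OF cent_of_nat])
      ultimately show "\<iota> (g s) * y ^ s * Y (p + s) * (of_nat (m - s) * e (m - s)) + \<iota> (of_nat s * g s) * y ^ s * Y (p + s) * e (m - s)
        = of_nat m * (\<iota> (g s) * y ^ s * Y (p + s) * e (m - s))"
        by (simp add: hom_mult of_nat_hom distrib_right mult.assoc add.commute)
    qed
    also have "\<dots> = of_nat m * (\<Sum>s\<le>m. \<iota> (g s) * y ^ s * Y (p + s) * e (m - s))"
      by (simp add: sum_distrib_left)
    finally show ?thesis by (rule cancel_of_nat[rotated]) (use False in simp)
  qed
qed

text \<open>Multiplication by the denominator of the power series \<^const>\<open>exch_coeff\<close> turns the previous sum into a
  relation with two terms on each side.\<close>

lemma exp_exchange_two_term:
  fixes Y :: "nat \<Rightarrow> 'a"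
  assumes w: "w \<noteq> 0"
    and comm: "\<And>n p. n \<ge> 1 \<Longrightarrow> d n * Y p = Y p * d n + \<iota> ((w\<^sup>2) ^ n - inverse (w\<^sup>2) ^ n) * y ^ n * Y (p + n)"
    and y: "cent y"
    and e0: "\<And>p. e 0 * Y p = \<iota> (w\<^sup>2) * Y p * e 0"
  shows "e (Suc m) * Y p - \<iota> (w\<^sup>2) * y * e m * Y (Suc p) = \<iota> (w\<^sup>2) * Y p * e (Suc m) - y * Y (Suc p) * e m"
proof -
  let ?g = "exch_coeff w"
  have ex: "e m * Y p = (\<Sum>n\<le>m. \<iota> (?g n) * y ^ n * Y (p + n) * e (m - n))" for m p
    by (rule exp_exchange[OF comm y]) (use e0 exch_coeff_recurrence[OF w] in \<open>auto simp: exch_coeff_def\<close>)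
  have "e (Suc m) * Y p = \<iota> (?g 0) * Y p * e (Suc m) + (\<Sum>n\<le>m. \<iota> (?g (Suc n)) * y ^ Suc n * Y (Suc p + n) * e (m - n))"
    unfolding ex by (subst sum.atMost_Suc_shift) simp
  moreover have "\<iota> (w\<^sup>2) * y * e m * Y (Suc p) = (\<Sum>n\<le>m. \<iota> (w\<^sup>2 * ?g n) * y ^ Suc n * Y (Suc p + n) * e (m - n))"
  proof -
    have "\<iota> (w\<^sup>2) * y * (\<iota> (?g n) * y ^ n * z) = \<iota> (w\<^sup>2 * ?g n) * y ^ Suc n * z" for n z
      by (simp add: hom_mult mult.assoc cent_left[OF cent_iota, of y])
    from this[of _ "Y (Suc p + _) * e _"] show ?thesis by (simp add: mult.assoc ex sum_distrib_left)
  qed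
  ultimately have "e (Suc m) * Y p - \<iota> (w\<^sup>2) * y * e m * Y (Suc p) = \<iota> (?g 0) * Y p * e (Suc m)
     + (\<Sum>n\<le>m. \<iota> (?g (Suc n) - w\<^sup>2 * ?g n) * y ^ Suc n * Y (Suc p + n) * e (m - n))"
    by (simp add: hom_diff left_diff_distrib sum_subtractf)
  also have "(\<Sum>n\<le>m. \<iota> (?g (Suc n) - w\<^sup>2 * ?g n) * y ^ Suc n * Y (Suc p + n) * e (m - n))
     = (\<Sum>n\<le>m. if n = 0 then - (y * Y (Suc p) * e m) else 0)"
  proof (intro sum.cong refl)
    fix n :: nat
    have z0: "?g (Suc 0) - w\<^sup>2 * ?g 0 = -1" using w by (simp add: exch_coeff_def field_simps)
    have 1: "?g (Suc (Suc k)) - w\<^sup>2 * ?g (Suc k) = 0" for k by (simp add: exch_coeff_def)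
    show "\<iota> (?g (Suc n) - w\<^sup>2 * ?g n) * y ^ Suc n * Y (Suc p + n) * e (m - n) = (if n = 0 then - (y * Y (Suc p) * e m) else 0)"
    proof (cases n)
      case 0 then show ?thesis by (simp only: z0 hom_minus hom_one) simp
    next
      case (Suc k) then show ?thesis by (simp only: 1 hom_zero) simp
    qed
  qed
  finally show ?thesis by (simp add: exch_coeff_def mult.assoc)
qed

text \<open>An element whose commutator with \<open>d\<^sub>l\<close> is central, and which commutes with the other \<open>d\<^sub>n\<close>, has a
  commutator with the exponential that is a central multiple of its product with \<open>u\<^sup>l\<close>.\<close>

lemma exp_heisenberg:
  assumes comm: "\<And>n. n \<ge> 1 \<Longrightarrow> H * d n = d n * H + (if n = l then of_nat l * \<zeta> else 0)"
    and z: "cent \<zeta>" and e0: "H * e 0 = e 0 * H" and l: "l \<ge> 1"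
  shows "H * e m = e m * H + (if l \<le> m then \<zeta> * e (m - l) else 0)"
proof (induction m rule: less_induct)
  case (less m)
  show ?case
  proof (cases "m = 0")
    case True then show ?thesis using l e0 by simp
  next
    case False
    have "of_nat m * (H * e m) = H * (of_nat m * e m)" by (rule cent_left[OF cent_of_nat, symmetric])
    also have "\<dots> = (\<Sum>n=1..m. (H * d n) * e (m - n))" by (simp add: rec sum_distrib_left mult.assoc)
    also have "\<dots> = (\<Sum>n=1..m. d n * e (m - n) * H + (if n \<le> m - l \<and> l \<le> m then \<zeta> * (d n * e (m - l - n)) else 0)
          + (if n = l then of_nat l * \<zeta> * e (m - l) else 0))"
    proof (intro sum.cong refl)
      fix n assume n: "n \<in> {1..m}"
      have zz: "d n * (\<zeta> * x) = \<zeta> * (d n * x)" for x by (rule cent_left[OF z])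
      have "H * d n * e (m - n) = d n * (H * e (m - n)) + (if n = l then of_nat l * \<zeta> * e (m - l) else 0)"
        using n by (subst comm) (auto simp: distrib_right mult.assoc)
      also have "H * e (m - n) = e (m - n) * H + (if l \<le> m - n then \<zeta> * e (m - n - l) else 0)"
        using n False by (intro less.IH) auto
      finally show "H * d n * e (m - n) = d n * e (m - n) * H + (if n \<le> m - l \<and> l \<le> m then \<zeta> * (d n * e (m - l - n)) else 0)
          + (if n = l then of_nat l * \<zeta> * e (m - l) else 0)"
        using n l by (auto simp: distrib_left zz mult.assoc add.commute[of n l])
    qed
    also have "\<dots> = of_nat m * e m * H + (if l \<le> m then of_nat (m - l) * (\<zeta> * e (m - l)) else 0)
         + (if l \<le> m then of_nat l * (\<zeta> * e (m - l)) else 0)"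
    proof -
      have 1: "(\<Sum>n=1..m. if n \<le> m - l \<and> l \<le> m then \<zeta> * (d n * e (m - l - n)) else 0)
          = (if l \<le> m then of_nat (m - l) * (\<zeta> * e (m - l)) else 0)"
      proof (cases "l \<le> m")
        case True
        have "(\<Sum>n=1..m. if n \<le> m - l \<and> l \<le> m then \<zeta> * (d n * e (m - l - n)) else 0) = (\<Sum>n=1..m-l. \<zeta> * (d n * e (m - l - n)))"
          using True by (intro sum.mono_neutral_cong_right) auto
        also have "\<dots> = \<zeta> * (of_nat (m - l) * e (m - l))" by (simp add: rec sum_distrib_left)
        finally show ?thesis using True by (simp only: if_True cent_left[OF cent_of_nat, where x = \<zeta>])
      qed simp
      have 2: "(\<Sum>n=1..m. if n = l then of_nat l * \<zeta> * e (m - l) else 0) = (if l \<le> m then of_nat l * (\<zeta> * e (m - l)) else 0)"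
        using l by (simp add: mult.assoc)
      show ?thesis unfolding sum.distrib 1 2 rec by (simp add: sum_distrib_right)
    qed
    also have "\<dots> = of_nat m * (e m * H + (if l \<le> m then \<zeta> * e (m - l) else 0))"
    proof (cases "l \<le> m")
      case True
      have "of_nat (m - l) * z + of_nat l * z = of_nat m * z" for z :: 'a
        using True by (simp only: distrib_right[symmetric] of_nat_add[symmetric] le_add_diff_inverse2)
      then show ?thesis using True by (simp only: if_True distrib_left mult.assoc add.assoc)
    qed (simp add: mult.assoc)
    finally show ?thesis by (rule cancel_of_nat[rotated]) (use False in simp)
  qed
qed

end

section \<open>Powers with a designated inverse\<close>

lemma zpow_0 [simp]: "zpow c d 0 = 1" and zpow_1: "zpow c d 1 = c" and zpow_m1: "zpow c d (- 1) = d"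
  by (simp_all add: zpow_def)

lemma zpow_Suc:
  assumes "c * d = 1" "d * c = 1"
  shows "zpow c d (n + 1) = c * zpow c d n"
proof (cases "n \<ge> 0")
  case True
  then show ?thesis by (simp add: zpow_def nat_add_distrib)
next
  case False
  define m where "m = nat (- n - 1)"
  have n: "n = - int m - 1" using False by (simp add: m_def)
  have "c * (d * d ^ m) = d ^ m" by (simp add: mult.assoc[symmetric] assms)
  then show ?thesis unfolding n by (simp add: zpow_def nat_add_distrib)
qed

lemma zpow_add:
  fixes c d :: "'a::ring_1"
  assumes cd: "c * d = 1" "d * c = 1"
  shows "zpow c d (m + n) = zpow c d m * zpow c d n"
proof (induction m rule: int_induct[where k = 0])
  case base then show ?case by simp
next
  case (step1 i)
  have "zpow c d (i + 1 + n) = c * zpow c d (i + n)" using zpow_Suc[OF cd, of "i + n"] by (simp add: add_ac)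
  then show ?case using step1 zpow_Suc[OF cd, of i] by (simp add: mult.assoc)
next
  case (step2 i)
  have "c * zpow c d (i - 1 + n) = zpow c d (i + n)" "c * zpow c d (i - 1) = zpow c d i"
    using zpow_Suc[OF cd, of "i - 1 + n"] zpow_Suc[OF cd, of "i - 1"] by (simp_all add: algebra_simps)
  then have "c * zpow c d (i - 1 + n) = c * (zpow c d (i - 1) * zpow c d n)" using step2 by (simp add: mult.assoc[symmetric])
  then have "d * (c * zpow c d (i - 1 + n)) = d * (c * (zpow c d (i - 1) * zpow c d n))" by simp
  then show ?case by (simp add: mult.assoc[symmetric] cd)
qed

lemma zpow_hom: "rhom h \<Longrightarrow> h (zpow c d n) = zpow (h c) (h d) n"
  by (simp add: zpow_def rhom.hom_power)

lemma zpow_one [simp]: "zpow 1 1 n = 1" by (simp add: zpow_def)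

section \<open>Modes of the generating series\<close>

text \<open>A relation that is compatible with the ring operations passes to the coefficients of the series.
  It is used for homomorphisms, for commutation with a fixed element, for stability of a submodule and
  for intertwining properties.\<close>

lemma exp_series_rel:
  assumes P: "P 0 0" "P 1 1" "\<And>a b a' b'. P a b \<Longrightarrow> P a' b' \<Longrightarrow> P (a + a') (b + b')"
      "\<And>a b a' b'. P a b \<Longrightarrow> P a' b' \<Longrightarrow> P (a * a') (b * b')" "\<And>r. P (\<iota> r) (\<iota>' r)"
    and H: "\<And>n. n \<ge> 1 \<Longrightarrow> P (h n) (h' n)"
  shows "P (exp_series \<iota> q h $ m) (exp_series \<iota>' q h' $ m)"
proof -
  have sum: "P (sum f A) (sum g A)" if "\<And>i. i \<in> A \<Longrightarrow> P (f i) (g i)" for f g and A :: "nat set"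
    using that by (induction A rule: infinite_finite_induct) (auto simp: P)
  let ?b = "Abs_fps (\<lambda>k. if k = 0 then 0 else \<iota> q * h k)" and ?b' = "Abs_fps (\<lambda>k. if k = 0 then 0 else \<iota>' q * h' k)"
  have pow: "P ((?b ^ i) $ n) ((?b' ^ i) $ n)" for i n
  proof (induction i arbitrary: n)
    case 0 then show ?case by (cases n) (auto simp: P)
  next
    case (Suc i) then show ?case
      unfolding power_Suc fps_mult_nth using H by (intro sum P(4)) (auto intro: P)
  qed
  show ?thesis unfolding exp_series_def fps_compose_nth
    by (intro sum P(4) pow) (auto intro: P)
qed

lemma plus_mode_rel:
  assumes "P 0 0" "P 1 1" "\<And>a b a' b'. P a b \<Longrightarrow> P a' b' \<Longrightarrow> P (a + a') (b + b')"
      "\<And>a b a' b'. P a b \<Longrightarrow> P a' b' \<Longrightarrow> P (a * a') (b * b')" "\<And>r. P (\<iota> r) (\<iota>' r)"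
    and "P a a'" "\<And>n. n \<noteq> 0 \<Longrightarrow> P (H n) (H' n)"
  shows "P (plus_mode \<iota> a H k) (plus_mode \<iota>' a' H' k)"
  unfolding plus_mode_def using assms exp_series_rel[of P \<iota> \<iota>' "\<lambda>j. H (int j)" "\<lambda>j. H' (int j)"] by auto

lemma minus_mode_rel:
  assumes "P 0 0" "P 1 1" "\<And>a b a' b'. P a b \<Longrightarrow> P a' b' \<Longrightarrow> P (a + a') (b + b')"
      "\<And>a b a' b'. P a b \<Longrightarrow> P a' b' \<Longrightarrow> P (a * a') (b * b')" "\<And>r. P (\<iota> r) (\<iota>' r)"
    and "P a a'" "\<And>n. n \<noteq> 0 \<Longrightarrow> P (H n) (H' n)"
  shows "P (minus_mode \<iota> a H k) (minus_mode \<iota>' a' H' k)"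
  unfolding minus_mode_def using assms exp_series_rel[of P \<iota> \<iota>' "\<lambda>j. H (- int j)" "\<lambda>j. H' (- int j)"] by auto

lemma mode_hom:
  assumes "rhom h"
  shows "h (plus_mode \<iota> a H k) = plus_mode (\<lambda>r. h (\<iota> r)) (h a) (\<lambda>n. h (H n)) k"
    "h (minus_mode \<iota> a H k) = minus_mode (\<lambda>r. h (\<iota> r)) (h a) (\<lambda>n. h (H n)) k"
proof -
  interpret rhom h by fact
  show "h (plus_mode \<iota> a H k) = plus_mode (\<lambda>r. h (\<iota> r)) (h a) (\<lambda>n. h (H n)) k"
    by (rule plus_mode_rel[where P = "\<lambda>x y. h x = y"]) (auto simp: homs)
  show "h (minus_mode \<iota> a H k) = minus_mode (\<lambda>r. h (\<iota> r)) (h a) (\<lambda>n. h (H n)) k"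
    by (rule minus_mode_rel[where P = "\<lambda>x y. h x = y"]) (auto simp: homs)
qed

lemma plus_mode_nat: "plus_mode \<iota> a H (int m - 1) = a * exp_series \<iota> (vv - inverse vv) (\<lambda>j. H (int j)) $ m"
  by (simp add: plus_mode_def)
lemma minus_mode_nat: "minus_mode \<iota> a H (1 - int m) = a * exp_series \<iota> (- (vv - inverse vv)) (\<lambda>j. H (- int j)) $ m"
  by (simp add: minus_mode_def)

definition hcoeff :: "int \<Rightarrow> cv" where "hcoeff l = qint (2 * l) / of_int l"

lemma hcoeff_minus: "hcoeff (- l) = hcoeff l"
  by (cases "l = 0") (simp_all add: hcoeff_def qint_def minus_divide_left[symmetric] minus_divide_right[symmetric] diff_divide_distrib)

lemma hcoeff_nat:
  assumes "n \<ge> 1"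
  shows "of_nat n * (vv - inverse vv) * hcoeff (int n) = (vv\<^sup>2) ^ n - inverse (vv\<^sup>2) ^ n"
proof -
  have "vv powi (2 * int n) = (vv\<^sup>2) ^ n" by (simp add: power_int_mult)
  moreover have "vv powi (- (2 * int n)) = inverse (vv\<^sup>2) ^ n"
    by (simp add: power_int_minus power_int_mult power_inverse)
  ultimately show ?thesis using qint_coeff[of "int n"] assms by (simp add: hcoeff_def)
qed

text \<open>The value that the relations prescribe for \<open>[E\<^sub>k, F\<^sub>l]\<close>.\<close>

definition EF_bracket :: "(cv \<Rightarrow> 'a::ring_1) \<Rightarrow> 'a \<Rightarrow> 'a \<Rightarrow> 'a \<Rightarrow> 'a \<Rightarrow> (int \<Rightarrow> 'a) \<Rightarrow> int \<Rightarrow> int \<Rightarrow> 'a"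
  where "EF_bracket \<iota> c ci K Ki H k l = \<iota> (1 / (vv - inverse vv))
    * (zpow c ci (k - l) * plus_mode \<iota> K H (k + l) - zpow c ci (l - k) * minus_mode \<iota> Ki H (k + l))"

lemma EF_bracket_rel:
  assumes P: "P 0 0" "P 1 1" "\<And>a b a' b'. P a b \<Longrightarrow> P a' b' \<Longrightarrow> P (a + a') (b + b')"
      "\<And>a b. P a b \<Longrightarrow> P (- a) (- b)"
      "\<And>a b a' b'. P a b \<Longrightarrow> P a' b' \<Longrightarrow> P (a * a') (b * b')" "\<And>r. P (\<iota> r) (\<iota>' r)"
    and "P c c'" "P ci ci'" "P K K'" "P Ki Ki'" "\<And>n. n \<noteq> 0 \<Longrightarrow> P (H n) (H' n)"
  shows "P (EF_bracket \<iota> c ci K Ki H k l) (EF_bracket \<iota>' c' ci' K' Ki' H' k l)"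
proof -
  have pw: "P (a ^ n) (b ^ n)" if "P a b" for a b n by (induction n) (auto simp: P that)
  have z: "P (zpow c ci n) (zpow c' ci' n)" for n by (auto simp: zpow_def intro!: pw assms)
  show ?thesis unfolding EF_bracket_def diff_conv_add_uminus
    by (intro P(3,4,5,6) z plus_mode_rel[where P = P] minus_mode_rel[where P = P] assms)
qed

text \<open>The relations among the \<open>H\<^sub>n\<close>, \<open>K\<close> and \<open>C\<close>, which govern the series \<open>\<Psi>\<close> and \<open>\<Phi>\<close> and thereby the brackets.\<close>

locale cartan_data = central_hom \<iota> for \<iota> :: "cv \<Rightarrow> 'a::ring_1" +
  fixes c ci K Ki :: 'a and H :: "int \<Rightarrow> 'a"
  assumes cci: "c * ci = 1" "ci * c = 1" and cent_c: "cent c" "cent ci"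
    and KKi: "K * Ki = 1" "Ki * K = 1" and KH: "\<And>n. n \<noteq> 0 \<Longrightarrow> K * H n = H n * K"
    and HH: "\<And>l k. l \<noteq> 0 \<Longrightarrow> k \<noteq> 0 \<Longrightarrow> H l * H k - H k * H l = (if l = - k
       then \<iota> (hcoeff l) * (\<iota> (1 / (vv - inverse vv)) * (zpow c ci (2 * l) - zpow c ci (- (2 * l)))) else 0)"
begin

abbreviation "q \<equiv> vv - inverse vv"
abbreviation "\<Psi> \<equiv> plus_mode \<iota> K H"
abbreviation "\<Phi> \<equiv> minus_mode \<iota> Ki H"
abbreviation "z \<equiv> zpow c ci"
abbreviation "G \<equiv> EF_bracket \<iota> c ci K Ki H"

lemma cent_z: "cent (z n)" by (intro cent_zpow cent_c)
lemma z_add: "z (m + n) = z m * z n" by (rule zpow_add[OF cci])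

lemma HH_pos: "l > 0 \<Longrightarrow> k > 0 \<Longrightarrow> H l * H k = H k * H l"
  and HH_neg: "l < 0 \<Longrightarrow> k < 0 \<Longrightarrow> H l * H k = H k * H l"
  using HH[of l k] by auto

lemma KiH: "n \<noteq> 0 \<Longrightarrow> Ki * H n = H n * Ki"
proof -
  assume "n \<noteq> 0"
  have "Ki * (K * H n) * Ki = Ki * (H n * K) * Ki" using KH \<open>n \<noteq> 0\<close> by simp
  then have "(Ki * K) * H n * Ki = Ki * H n * (K * Ki)" by (simp only: mult.assoc)
  then show ?thesis by (simp add: KKi)
qed

lemma mode_recurrence:
  "of_nat m * \<Psi> (int m - 1) = (\<Sum>n=1..m. (\<iota> (of_nat n * q) * H (int n)) * \<Psi> (int (m - n) - 1))"
  "of_nat m * \<Phi> (1 - int m) = (\<Sum>n=1..m. (\<iota> (of_nat n * (- q)) * H (- int n)) * \<Phi> (1 - int (m - n)))"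
proof -
  have *: "of_nat m * (k * e m) = (\<Sum>n=1..m. (\<iota> (of_nat n * r) * h n) * (k * e (m - n)))"
    if "of_nat m * e m = (\<Sum>n=1..m. \<iota> (of_nat n * r) * h n * e (m - n))" "\<And>n. n \<ge> 1 \<Longrightarrow> k * h n = h n * k"
    for k h r and e :: "nat \<Rightarrow> 'a"
  proof -
    have "of_nat m * (k * e m) = k * (of_nat m * e m)" by (rule cent_left[OF cent_of_nat, symmetric])
    also have "\<dots> = (\<Sum>n=1..m. k * (\<iota> (of_nat n * r) * (h n * e (m - n))))"
      by (simp only: that(1) sum_distrib_left mult.assoc)
    also have "\<dots> = (\<Sum>n=1..m. (\<iota> (of_nat n * r) * h n) * (k * e (m - n)))"
    proof (intro sum.cong[OF refl])
      fix n assume "n \<in> {1..m}"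
      then have "k * h n = h n * k" using that(2) by simp
      then have "k * (h n * u) = h n * (k * u)" for u by (metis mult.assoc)
      then show "k * (\<iota> (of_nat n * r) * (h n * e (m - n))) = (\<iota> (of_nat n * r) * h n) * (k * e (m - n))"
        by (simp only: cent_left[OF cent_iota, where x = k] mult.assoc)
    qed
    finally show ?thesis .
  qed
  show "of_nat m * \<Psi> (int m - 1) = (\<Sum>n=1..m. (\<iota> (of_nat n * q) * H (int n)) * \<Psi> (int (m - n) - 1))"
    unfolding plus_mode_nat
    by (rule *) (use exp_series_recurrence[OF central_hom_axioms, of "\<lambda>j. H (int j)"] HH_pos KH in auto)
  show "of_nat m * \<Phi> (1 - int m) = (\<Sum>n=1..m. (\<iota> (of_nat n * (- q)) * H (- int n)) * \<Phi> (1 - int (m - n)))"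
    unfolding minus_mode_nat
    by (rule *) (use exp_series_recurrence[OF central_hom_axioms, of "\<lambda>j. H (- int j)"] HH_neg KiH in auto)
qed

lemma mode_0: "\<Psi> (-1) = K" "\<Phi> 1 = Ki"
  using plus_mode_nat[of \<iota> K H 0] minus_mode_nat[of \<iota> Ki H 0]
    exp_series_recurrence[OF central_hom_axioms, of "\<lambda>j. H (int j)"]
    exp_series_recurrence[OF central_hom_axioms, of "\<lambda>j. H (- int j)"] HH_pos HH_neg by auto

lemma mode_outside: "j < -1 \<Longrightarrow> \<Psi> j = 0" "j > 1 \<Longrightarrow> \<Phi> j = 0"
  by (simp_all add: plus_mode_def minus_mode_def)

lemma mult_iota_H:
  assumes "H l * Y k = Y k * H l + \<iota> \<beta> * y ^ n * Y'" "r * \<beta> = \<gamma>"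
  shows "(\<iota> r * H l) * Y k = Y k * (\<iota> r * H l) + \<iota> \<gamma> * y ^ n * Y'"
proof -
  have "(\<iota> r * H l) * Y k = \<iota> r * (Y k * H l) + \<iota> r * (\<iota> \<beta> * (y ^ n * Y'))"
    using assms(1) by (simp add: mult.assoc distrib_left)
  also have "\<iota> r * (\<iota> \<beta> * (y ^ n * Y')) = \<iota> \<gamma> * y ^ n * Y'"
    by (simp add: mult.assoc[symmetric] hom_mult[symmetric] assms(2))
  also have "\<iota> r * (Y k * H l) = Y k * (\<iota> r * H l)"
    by (rule cent_left[OF cent_iota, symmetric])
  finally show ?thesis .
qed

text \<open>The relation between the series \<open>\<Psi>\<close> and a current \<open>Y\<close> on which the \<open>H\<^sub>n\<close> act by shifts.  For \<open>Y = E\<close> one has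
  \<open>w = v\<close> and \<open>y = C\<^sup>-\<^sup>1\<^sup>/\<^sup>2\<close>, for \<open>Y = F\<close> one has \<open>w = v\<^sup>-\<^sup>1\<close> and \<open>y = C\<^sup>1\<^sup>/\<^sup>2\<close>.\<close>

lemma plus_exchange:
  fixes Y :: "int \<Rightarrow> 'a"
  assumes w: "w \<noteq> 0" and y: "cent y"
    and HY: "\<And>n k. n \<ge> 1 \<Longrightarrow> H (int n) * Y k - Y k * H (int n) = \<iota> (\<beta> n) * y ^ n * Y (k + int n)"
    and \<beta>: "\<And>n. n \<ge> 1 \<Longrightarrow> of_nat n * q * \<beta> n = (w\<^sup>2) ^ n - inverse (w\<^sup>2) ^ n"
    and KY: "\<And>k. K * Y k = \<iota> (w\<^sup>2) * Y k * K"
  shows "\<Psi> j * Y k - \<iota> (w\<^sup>2) * y * \<Psi> (j - 1) * Y (k + 1) = \<iota> (w\<^sup>2) * Y k * \<Psi> j - y * Y (k + 1) * \<Psi> (j - 1)"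
proof -
  consider "j < -1" | "j = -1" | "j \<ge> 0" by linarith
  then show ?thesis
  proof cases
    case 3
    then obtain m where m: "j = int m" by (rule nonneg_int_cases)
    have "\<Psi> (int (Suc m) - 1) * Y (k + int 0) - \<iota> (w\<^sup>2) * y * \<Psi> (int m - 1) * Y (k + int (Suc 0))
      = \<iota> (w\<^sup>2) * Y (k + int 0) * \<Psi> (int (Suc m) - 1) - y * Y (k + int (Suc 0)) * \<Psi> (int m - 1)"
    proof (rule exp_exchange_two_term[OF central_hom_axioms mode_recurrence(1) w _ y, where Y = "\<lambda>p. Y (k + int p)"])
      show "\<And>n p. 1 \<le> n \<Longrightarrow> \<iota> (of_nat n * q) * H (int n) * Y (k + int p) =
           Y (k + int p) * (\<iota> (of_nat n * q) * H (int n)) +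
           \<iota> ((w\<^sup>2) ^ n - (inverse (w\<^sup>2)) ^ n) * y ^ n * Y (k + int (p + n))"
        using HY \<beta> by (intro mult_iota_H[where \<beta> = "\<beta> _"]) (auto simp: algebra_simps)
    qed (use KY in \<open>auto simp: mode_0\<close>)
    then show ?thesis by (simp add: m add.commute)
  qed (use KY in \<open>auto simp: mode_0 mode_outside\<close>)
qed

lemma minus_exchange:
  fixes Y :: "int \<Rightarrow> 'a"
  assumes w: "w \<noteq> 0" and y: "cent y"
    and HY: "\<And>n k. n \<ge> 1 \<Longrightarrow> H (- int n) * Y k - Y k * H (- int n) = \<iota> (\<beta> n) * y ^ n * Y (k - int n)"
    and \<beta>: "\<And>n. n \<ge> 1 \<Longrightarrow> of_nat n * (- q) * \<beta> n = (w\<^sup>2) ^ n - inverse (w\<^sup>2) ^ n"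
    and KY: "\<And>k. Ki * Y k = \<iota> (w\<^sup>2) * Y k * Ki"
  shows "\<Phi> j * Y k - \<iota> (w\<^sup>2) * y * \<Phi> (j + 1) * Y (k - 1) = \<iota> (w\<^sup>2) * Y k * \<Phi> j - y * Y (k - 1) * \<Phi> (j + 1)"
proof -
  consider "j > 1" | "j = 1" | "j \<le> 0" by linarith
  then show ?thesis
  proof cases
    case 3
    then obtain m where m: "j = - int m" by (rule nonpos_int_cases)
    have "\<Phi> (1 - int (Suc m)) * Y (k - int 0) - \<iota> (w\<^sup>2) * y * \<Phi> (1 - int m) * Y (k - int (Suc 0))
      = \<iota> (w\<^sup>2) * Y (k - int 0) * \<Phi> (1 - int (Suc m)) - y * Y (k - int (Suc 0)) * \<Phi> (1 - int m)"
    proof (rule exp_exchange_two_term[OF central_hom_axioms mode_recurrence(2) w _ y, where Y = "\<lambda>p. Y (k - int p)"])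
      show "\<And>n p. 1 \<le> n \<Longrightarrow> \<iota> (of_nat n * (- q)) * H (- int n) * Y (k - int p) =
           Y (k - int p) * (\<iota> (of_nat n * (- q)) * H (- int n)) +
           \<iota> ((w\<^sup>2) ^ n - (inverse (w\<^sup>2)) ^ n) * y ^ n * Y (k - int (p + n))"
        using HY \<beta> by (intro mult_iota_H[where \<beta> = "\<beta> _"]) (auto simp: algebra_simps)
    qed (use KY in \<open>auto simp: mode_0\<close>)
    then show ?thesis by (simp add: m add.commute)
  qed (use KY in \<open>auto simp: mode_0 mode_outside\<close>)
qed

lemma heisenberg_term:
  assumes "H l * H k - H k * H l = (if l = - k then \<iota> (hcoeff l) * (\<iota> (1 / q) * u) else 0)"
    "l = - k \<Longrightarrow> r = \<epsilon> * of_nat n * q"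
  shows "H l * (\<iota> r * H k) = (\<iota> r * H k) * H l + (if l = - k then of_nat n * (\<iota> (\<epsilon> * hcoeff l) * u) else 0)"
proof -
  have 1: "H l * H k = H k * H l + (if l = - k then \<iota> (hcoeff l) * (\<iota> (1 / q) * u) else 0)"
    using assms(1) by (simp only: diff_eq_eq add.commute)
  have 2: "\<iota> r * (\<iota> (hcoeff l) * (\<iota> (1 / q) * u)) = of_nat n * (\<iota> (\<epsilon> * hcoeff l) * u)" if "l = - k"
  proof -
    have "r * hcoeff l * (1 / q) = of_nat n * (\<epsilon> * hcoeff l)"
      using assms(2)[OF that] vv_diff_neq_0 by simp
    then show ?thesis by (metis hom_mult of_nat_hom mult.assoc)
  qed
  have "H l * (\<iota> r * H k) = \<iota> r * (H l * H k)" by (rule cent_left[OF cent_iota])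
  then show ?thesis unfolding 1 using 2 by (auto simp: distrib_left mult.assoc)
qed

text \<open>\<open>\<Psi>\<close> is built from the \<open>H\<^sub>n\<close> with \<open>n > 0\<close>, so that only \<open>H\<^sub>l\<close> with \<open>l < 0\<close> fails to commute with it.\<close>

lemma plus_heisenberg:
  assumes "l \<noteq> 0"
  shows "H l * \<Psi> j - \<Psi> j * H l = (if l < 0 then \<iota> (hcoeff l) * (z (2 * l) - z (- (2 * l))) * \<Psi> (j + l) else 0)"
proof (cases "j < -1")
  case True then show ?thesis by (simp add: mode_outside)
next
  case False
  define m where "m = nat (j + 1)"
  have j: "j = int m - 1" using False by (simp add: m_def)
  have e0: "H l * \<Psi> (int 0 - 1) = \<Psi> (int 0 - 1) * H l" using KH assms by (simp add: mode_0)
  show ?thesis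
  proof (cases "l < 0")
    case True
    define L where "L = nat (- l)"
    have l: "l = - int L" "L \<ge> 1" using True by (auto simp: L_def)
    let ?\<zeta> = "\<iota> (1 * hcoeff l) * (z (2 * l) - z (- (2 * l)))"
    have "H l * \<Psi> (int m - 1) = \<Psi> (int m - 1) * H l + (if L \<le> m then ?\<zeta> * \<Psi> (int (m - L) - 1) else 0)"
    proof (rule exp_heisenberg[OF central_hom_axioms mode_recurrence(1) _ _ e0 l(2)])
      fix n :: nat assume "1 \<le> n"
      then show "H l * (\<iota> (of_nat n * q) * H (int n)) = \<iota> (of_nat n * q) * H (int n) * H l + (if n = L then of_nat L * ?\<zeta> else 0)"
        using heisenberg_term[OF HH[OF assms], of "int n" "of_nat n * q" 1 n] by (auto simp: l)
    qed (intro cent_mult cent_iota cent_diff cent_z)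
    moreover have "(if L \<le> m then ?\<zeta> * \<Psi> (int (m - L) - 1) else 0) = ?\<zeta> * \<Psi> (j + l)"
      by (auto simp: j l(1) mode_outside of_nat_diff algebra_simps)
    ultimately show ?thesis using True by (simp add: j)
  next
    case pos: False
    have "H l * \<Psi> (int m - 1) = \<Psi> (int m - 1) * H l + (if 1 \<le> m then 0 * \<Psi> (int (m - 1) - 1) else 0)"
    proof (rule exp_heisenberg[OF central_hom_axioms mode_recurrence(1) _ _ e0])
      fix n :: nat assume "1 \<le> n"
      then show "H l * (\<iota> (of_nat n * q) * H (int n)) = \<iota> (of_nat n * q) * H (int n) * H l + (if n = 1 then of_nat 1 * 0 else 0)"
        using heisenberg_term[OF HH[OF assms], of "int n" "of_nat n * q" 1 n] pos by auto
    qed (auto simp: cent_def)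
    then show ?thesis using pos by (simp add: j)
  qed
qed

lemma minus_heisenberg:
  assumes "l \<noteq> 0"
  shows "H l * \<Phi> j - \<Phi> j * H l = (if l > 0 then - (\<iota> (hcoeff l) * (z (2 * l) - z (- (2 * l))) * \<Phi> (j + l)) else 0)"
proof (cases "j > 1")
  case True then show ?thesis by (simp add: mode_outside)
next
  case False
  define m where "m = nat (1 - j)"
  have j: "j = 1 - int m" using False by (simp add: m_def)
  have e0: "H l * \<Phi> (1 - int 0) = \<Phi> (1 - int 0) * H l" using KiH assms by (simp add: mode_0)
  show ?thesis
  proof (cases "l > 0")
    case True
    define L where "L = nat l"
    have l: "l = int L" "L \<ge> 1" using True by (auto simp: L_def)
    let ?\<zeta> = "\<iota> (- 1 * hcoeff l) * (z (2 * l) - z (- (2 * l)))"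
    have "H l * \<Phi> (1 - int m) = \<Phi> (1 - int m) * H l + (if L \<le> m then ?\<zeta> * \<Phi> (1 - int (m - L)) else 0)"
    proof (rule exp_heisenberg[OF central_hom_axioms mode_recurrence(2) _ _ e0 l(2)])
      fix n :: nat assume "1 \<le> n"
      note n = this
      show "H l * (\<iota> (of_nat n * (- q)) * H (- int n)) = \<iota> (of_nat n * (- q)) * H (- int n) * H l + (if n = L then of_nat L * ?\<zeta> else 0)"
      proof -
        have eq: "of_nat n * (- q) = - 1 * of_nat n * q"
          by (simp only: mult_minus_left mult_minus_right mult_1_left)
        have "(if l = - (- int n) then of_nat n * ?\<zeta> else 0) = (if n = L then of_nat L * ?\<zeta> else 0)"
          by (auto simp: l)
        moreover have "- int n \<noteq> 0" using n by simp
        ultimately show ?thesis using heisenberg_term[OF HH[OF assms], of "- int n" "of_nat n * (- q)" "-1" n, OF _ eq]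
          by (simp only: simp_thms)
      qed
    qed (intro cent_mult cent_iota cent_diff cent_z)
    moreover have "(if L \<le> m then ?\<zeta> * \<Phi> (1 - int (m - L)) else 0) = ?\<zeta> * \<Phi> (j + l)"
      by (auto simp: j l(1) mode_outside of_nat_diff algebra_simps)
    ultimately show ?thesis using True by (simp add: j hom_minus)
  next
    case neg: False
    have "H l * \<Phi> (1 - int m) = \<Phi> (1 - int m) * H l + (if 1 \<le> m then 0 * \<Phi> (1 - int (m - 1)) else 0)"
    proof (rule exp_heisenberg[OF central_hom_axioms mode_recurrence(2) _ _ e0])
      fix n :: nat assume "1 \<le> n"
      then show "H l * (\<iota> (of_nat n * (- q)) * H (- int n)) = \<iota> (of_nat n * (- q)) * H (- int n) * H l + (if n = 1 then of_nat 1 * 0 else 0)"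
        using heisenberg_term[OF HH[OF assms], of "- int n" "of_nat n * (- q)" "-1" n] neg by auto
    qed (auto simp: cent_def)
    then show ?thesis using neg by (simp add: j)
  qed
qed

lemma z_mult: "z m * (z n * u) = z (m + n) * u"
  by (simp add: z_add mult.assoc)

text \<open>The Jacobi identity for \<open>H\<^sub>l\<close>, \<open>E\<^sub>k\<close> and \<open>F\<^sub>m\<close>, as an identity between the prescribed values of the
  commutators.  It makes the operators \<open>E\<^sub>k\<close> constructed below compatible with the \<open>H\<^sub>l\<close>.\<close>

lemma H_bracket:
  assumes l: "l \<noteq> 0"
  shows "H l * G k m - G k m * H l = \<iota> (hcoeff l) * (z (- \<bar>l\<bar>) * G (k + l) m - z \<bar>l\<bar> * G k (m + l))"
proof -
  let ?A = "\<lambda>k m. z (k - m) * \<Psi> (k + m) - z (m - k) * \<Phi> (k + m)"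
  let ?j = "k + m"
  have "H l * ?A k m - ?A k m * H l = z (k - m) * (H l * \<Psi> ?j - \<Psi> ?j * H l) - z (m - k) * (H l * \<Phi> ?j - \<Phi> ?j * H l)"
    by (simp add: right_diff_distrib left_diff_distrib mult.assoc cent_left[OF cent_z, where x = "H l"])
  also have "\<dots> = \<iota> (hcoeff l) * (z (- \<bar>l\<bar>) * ?A (k + l) m - z \<bar>l\<bar> * ?A k (m + l))"
  proof (cases "l < 0")
    case True
    have 1: "z (k - m) * (\<iota> (hcoeff l) * (z (2 * l) - z (- (2 * l))) * \<Psi> (?j + l))
       = \<iota> (hcoeff l) * (z (k - m + 2 * l) * \<Psi> (?j + l) - z (k - m - 2 * l) * \<Psi> (?j + l))"
      by (simp add: mult.assoc cent_left[OF cent_iota, where x = "z _"] left_diff_distrib right_diff_distrib z_mult)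
    show ?thesis unfolding plus_heisenberg[OF l] minus_heisenberg[OF l]
      using True by (simp add: 1) (simp add: right_diff_distrib z_mult algebra_simps)
  next
    case False
    have 1: "z (m - k) * (\<iota> (hcoeff l) * (z (2 * l) - z (- (2 * l))) * \<Phi> (?j + l))
       = \<iota> (hcoeff l) * (z (m - k + 2 * l) * \<Phi> (?j + l) - z (m - k - 2 * l) * \<Phi> (?j + l))"
      by (simp add: mult.assoc cent_left[OF cent_iota, where x = "z _"] left_diff_distrib right_diff_distrib z_mult)
    show ?thesis unfolding plus_heisenberg[OF l] minus_heisenberg[OF l]
      using False l by (simp add: 1) (simp add: right_diff_distrib z_mult algebra_simps)
  qed
  finally have A: "H l * ?A k m - ?A k m * H l = \<iota> (hcoeff l) * (z (- \<bar>l\<bar>) * ?A (k + l) m - z \<bar>l\<bar> * ?A k (m + l))" .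
  have "H l * G k m - G k m * H l = \<iota> (1 / q) * (H l * ?A k m - ?A k m * H l)"
    unfolding EF_bracket_def
    by (simp only: mult.assoc cent_left[OF cent_iota, where x = "H l"] right_diff_distrib[of "\<iota> (1 / q)" "_ * _" "_ * _", symmetric])
  also have "\<dots> = \<iota> (hcoeff l) * (z (- \<bar>l\<bar>) * G (k + l) m - z \<bar>l\<bar> * G k (m + l))"
    unfolding A EF_bracket_def
    by (simp only: cent_left[OF cent_iota, where x = "z _"] cent_left[OF cent_iota, where x = "\<iota> (1 / q)"]
        right_diff_distrib[symmetric])
  finally show ?thesis .
qed

lemma bracket_commutes:
  assumes "S * K = K * S" "S * Ki = Ki * S" "\<And>n. n \<noteq> 0 \<Longrightarrow> S * H n = H n * S"
  shows "S * G k m = G k m * S"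
proof (rule EF_bracket_rel[where P = "\<lambda>a b. S * a = a * S \<and> b = a", THEN conjunct1])
  show "S * (a * a') = a * a' * S \<and> b * b' = a * a'"
    if "S * a = a * S \<and> b = a" "S * a' = a' * S \<and> b' = a'" for a b a' b'
    using that by (metis mult.assoc)
qed (use assms cent_comm[OF cent_c(1)] cent_comm[OF cent_c(2)] in \<open>auto simp: algebra_simps central\<close>)

lemma z_c: "z n * c = z (n + 1)" and z_ci: "z n * ci = z (n - 1)"
  using z_add[of n 1] z_add[of n "-1"] by (simp_all add: zpow_1 zpow_m1)

text \<open>The exchange relations of \<open>\<Psi>\<close> and of \<open>\<Phi>\<close> with a current \<open>Y\<close>, with opposite structure constants, add up
  to a relation between \<open>Y\<close> and the bracket.  The central elements \<open>a, a', b, b'\<close> stand for the powers of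
  \<open>C\<close> in the bracket.\<close>

lemma bracket_exchange:
  fixes Y :: "int \<Rightarrow> 'a"
  assumes E: "\<And>j k. \<Psi> j * Y k - \<iota> (w\<^sup>2) * y * \<Psi> (j - 1) * Y (k + 1) = \<iota> (w\<^sup>2) * Y k * \<Psi> j - y * Y (k + 1) * \<Psi> (j - 1)"
    and F: "\<And>j k. \<Phi> j * Y k - \<iota> (inverse (w\<^sup>2)) * y * \<Phi> (j + 1) * Y (k - 1) = \<iota> (inverse (w\<^sup>2)) * Y k * \<Phi> j - y * Y (k - 1) * \<Phi> (j + 1)"
    and w: "w \<noteq> 0" and y: "cent y"
    and a: "cent a" "cent a'" "cent b" "cent b'" "a * y = a'" "b' * y = b"
  shows "Y (k + 1) * (a' * \<Psi> (j - 1) - b' * \<Phi> (j - 1)) - \<iota> (w\<^sup>2) * (a' * \<Psi> (j - 1) - b' * \<Phi> (j - 1)) * Y (k + 1)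
    - \<iota> (w\<^sup>2) * Y k * (a * \<Psi> j - b * \<Phi> j) + (a * \<Psi> j - b * \<Phi> j) * Y k = 0"
proof -
  have ay: "a * (y * u) = a' * u" "b' * (y * u) = b * u" for u using a by (simp_all add: mult.assoc[symmetric])
  have awy: "a * (\<iota> r * u) = \<iota> r * (a * u)" "b' * (\<iota> r * u) = \<iota> r * (b' * u)" for r u
    by (rule cent_left[OF cent_iota])+
  have 1: "a * (\<Psi> j * Y k) - \<iota> (w\<^sup>2) * (a' * (\<Psi> (j - 1) * Y (k + 1))) = \<iota> (w\<^sup>2) * (a * (Y k * \<Psi> j)) - a' * (Y (k + 1) * \<Psi> (j - 1))"
    using arg_cong[OF E[of j k], of "\<lambda>u. a * u"] by (simp only: right_diff_distrib mult.assoc ay awy)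
  have 3: "b' * (\<Phi> (j - 1) * Y (k + 1)) - \<iota> (inverse (w\<^sup>2)) * (b * (\<Phi> j * Y k))
      = \<iota> (inverse (w\<^sup>2)) * (b' * (Y (k + 1) * \<Phi> (j - 1))) - b * (Y k * \<Phi> j)"
    using arg_cong[OF F[of "j - 1" "k + 1"], of "\<lambda>u. b' * u"]
    by (simp only: right_diff_distrib mult.assoc ay awy add_diff_cancel_right' diff_add_cancel)
  have 2: "\<iota> (w\<^sup>2) * (b' * (\<Phi> (j - 1) * Y (k + 1))) - b * (\<Phi> j * Y k)
      = b' * (Y (k + 1) * \<Phi> (j - 1)) - \<iota> (w\<^sup>2) * (b * (Y k * \<Phi> j))"
  proof -
    have "\<iota> (w\<^sup>2) * (\<iota> (inverse (w\<^sup>2)) * u) = u" for u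
      using w by (simp add: mult.assoc[symmetric] hom_mult[symmetric] hom_one)
    then show ?thesis using arg_cong[OF 3, of "\<lambda>u. \<iota> (w\<^sup>2) * u"] by (simp only: right_diff_distrib)
  qed
  have "Y (k + 1) * (a' * \<Psi> (j - 1) - b' * \<Phi> (j - 1)) - \<iota> (w\<^sup>2) * (a' * \<Psi> (j - 1) - b' * \<Phi> (j - 1)) * Y (k + 1)
    - \<iota> (w\<^sup>2) * Y k * (a * \<Psi> j - b * \<Phi> j) + (a * \<Psi> j - b * \<Phi> j) * Y k
    = ((a * (\<Psi> j * Y k) - \<iota> (w\<^sup>2) * (a' * (\<Psi> (j - 1) * Y (k + 1)))) - (\<iota> (w\<^sup>2) * (a * (Y k * \<Psi> j)) - a' * (Y (k + 1) * \<Psi> (j - 1))))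
      + ((\<iota> (w\<^sup>2) * (b' * (\<Phi> (j - 1) * Y (k + 1))) - b * (\<Phi> j * Y k)) - (b' * (Y (k + 1) * \<Phi> (j - 1)) - \<iota> (w\<^sup>2) * (b * (Y k * \<Phi> j))))"
    by (simp only: right_diff_distrib left_diff_distrib mult.assoc cent_left[OF a(1), where x = "Y _"] cent_left[OF a(2), where x = "Y _"]
        cent_left[OF a(3), where x = "Y _"] cent_left[OF a(4), where x = "Y _"]) (simp add: algebra_simps)
  then show ?thesis unfolding 1 2 by simp
qed

text \<open>Moving the quadratic relation for \<open>E\<^sub>k\<^sub>+\<^sub>1 E\<^sub>l\<close> past \<open>F\<^sub>m\<close> produces this expression and the one with \<open>k\<close> and
  \<open>l\<close> interchanged.\<close>

lemma bracket_E:
  fixes E :: "int \<Rightarrow> 'a"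
  assumes HE: "\<And>l k. l \<noteq> 0 \<Longrightarrow> H l * E k - E k * H l = \<iota> (hcoeff l) * z (- \<bar>l\<bar>) * E (k + l)"
    and KE: "\<And>k. K * E k = \<iota> (vv\<^sup>2) * E k * K" and KiE: "\<And>k. Ki * E k = \<iota> (inverse (vv\<^sup>2)) * E k * Ki"
  shows "E (k + 1) * G l m - \<iota> (vv\<^sup>2) * G l m * E (k + 1) - \<iota> (vv\<^sup>2) * E k * G (l + 1) m + G (l + 1) m * E k = 0"
proof -
  have zn: "z (- int n) = ci ^ n" for n by (cases "n = 0") (simp_all add: zpow_def)
  have 1: "\<Psi> j * E k - \<iota> (vv\<^sup>2) * ci * \<Psi> (j - 1) * E (k + 1) = \<iota> (vv\<^sup>2) * E k * \<Psi> j - ci * E (k + 1) * \<Psi> (j - 1)" for j k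
    by (rule plus_exchange[OF vv_neq_0 cent_c(2), where \<beta> = "\<lambda>n. hcoeff (int n)"])
      (use HE hcoeff_nat KE in \<open>auto simp: zn\<close>)
  have 2: "\<Phi> j * E k - \<iota> ((inverse vv)\<^sup>2) * ci * \<Phi> (j + 1) * E (k - 1) = \<iota> ((inverse vv)\<^sup>2) * E k * \<Phi> j - ci * E (k - 1) * \<Phi> (j + 1)" for j k
  proof (rule minus_exchange[OF _ cent_c(2), where \<beta> = "\<lambda>n. hcoeff (- int n)"])
    fix n :: nat and k assume "n \<ge> 1"
    then show "H (- int n) * E k - E k * H (- int n) = \<iota> (hcoeff (- int n)) * ci ^ n * E (k - int n)"
      using HE[of "- int n" k] by (simp add: zn)
  next
    fix n :: nat assume "n \<ge> 1"
    then have "- (of_nat n * q * hcoeff (int n)) = inverse (vv\<^sup>2) ^ n - (vv\<^sup>2) ^ n"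
      using hcoeff_nat[of n] by simp
    then show "of_nat n * (- q) * hcoeff (- int n) = ((inverse vv)\<^sup>2) ^ n - inverse ((inverse vv)\<^sup>2) ^ n"
      by (simp only: hcoeff_minus mult_minus_right mult_minus_left power_inverse inverse_inverse_eq)
  qed (use KiE in \<open>auto simp: power_inverse\<close>)
  let ?A = "\<lambda>k m. z (k - m) * \<Psi> (k + m) - z (m - k) * \<Phi> (k + m)"
  have "E (k + 1) * (z (l - m) * \<Psi> (l + m + 1 - 1) - z (m - l) * \<Phi> (l + m + 1 - 1))
    - \<iota> (vv\<^sup>2) * (z (l - m) * \<Psi> (l + m + 1 - 1) - z (m - l) * \<Phi> (l + m + 1 - 1)) * E (k + 1)
    - \<iota> (vv\<^sup>2) * E k * (z (l + 1 - m) * \<Psi> (l + m + 1) - z (m - (l + 1)) * \<Phi> (l + m + 1))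
    + (z (l + 1 - m) * \<Psi> (l + m + 1) - z (m - (l + 1)) * \<Phi> (l + m + 1)) * E k = 0"
    by (rule bracket_exchange[OF 1 2[unfolded power_inverse] vv_neq_0 cent_c(2) cent_z cent_z cent_z cent_z])
      (simp_all add: z_ci diff_diff_eq)
  then have A: "E (k + 1) * ?A l m - \<iota> (vv\<^sup>2) * (?A l m * E (k + 1)) - \<iota> (vv\<^sup>2) * (E k * ?A (l + 1) m) + ?A (l + 1) m * E k = 0"
    by (simp add: mult.assoc add_ac)
  have "E (k + 1) * G l m - \<iota> (vv\<^sup>2) * G l m * E (k + 1) - \<iota> (vv\<^sup>2) * E k * G (l + 1) m + G (l + 1) m * E k
    = \<iota> (1 / q) * (E (k + 1) * ?A l m - \<iota> (vv\<^sup>2) * (?A l m * E (k + 1)) - \<iota> (vv\<^sup>2) * (E k * ?A (l + 1) m) + ?A (l + 1) m * E k)"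
    unfolding EF_bracket_def
    by (simp only: mult.assoc cent_left[OF cent_iota, where x = "E _"] cent_left[OF cent_iota, where x = "\<iota> (vv\<^sup>2)"]
        distrib_left[symmetric] right_diff_distrib[symmetric])
  then show ?thesis unfolding A by simp
qed

lemma bracket_F:
  fixes F :: "int \<Rightarrow> 'a"
  assumes HF: "\<And>l k. l \<noteq> 0 \<Longrightarrow> H l * F k - F k * H l = - (\<iota> (hcoeff l) * z \<bar>l\<bar> * F (k + l))"
    and KF: "\<And>k. K * F k = \<iota> (inverse (vv\<^sup>2)) * F k * K" and KiF: "\<And>k. Ki * F k = \<iota> (vv\<^sup>2) * F k * Ki"
  shows "F (l + 1) * G k m - \<iota> (inverse (vv\<^sup>2)) * G k m * F (l + 1) - \<iota> (inverse (vv\<^sup>2)) * F l * G k (m + 1) + G k (m + 1) * F l = 0"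
proof -
  have zn: "z (int n) = c ^ n" for n by (simp add: zpow_def)
  have 1: "\<Psi> j * F k - \<iota> ((inverse vv)\<^sup>2) * c * \<Psi> (j - 1) * F (k + 1) = \<iota> ((inverse vv)\<^sup>2) * F k * \<Psi> j - c * F (k + 1) * \<Psi> (j - 1)" for j k
    by (rule plus_exchange[OF _ cent_c(1), where \<beta> = "\<lambda>n. - hcoeff (int n)"])
      (use HF hcoeff_nat KF in \<open>auto simp: zn power_inverse hom_minus\<close>)
  have 2: "\<Phi> j * F k - \<iota> (vv\<^sup>2) * c * \<Phi> (j + 1) * F (k - 1) = \<iota> (vv\<^sup>2) * F k * \<Phi> j - c * F (k - 1) * \<Phi> (j + 1)" for j k
  proof (rule minus_exchange[OF vv_neq_0 cent_c(1), where \<beta> = "\<lambda>n. - hcoeff (- int n)"])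
    fix n :: nat and k assume "n \<ge> 1"
    then show "H (- int n) * F k - F k * H (- int n) = \<iota> (- hcoeff (- int n)) * c ^ n * F (k - int n)"
      using HF[of "- int n" k] by (simp add: zn hom_minus)
  next
    fix n :: nat assume "n \<ge> 1"
    then show "of_nat n * (- q) * - hcoeff (- int n) = (vv\<^sup>2) ^ n - inverse (vv\<^sup>2) ^ n"
      using hcoeff_nat[of n] by (simp only: hcoeff_minus mult_minus_right mult_minus_left minus_minus)
  qed (rule KiF)
  have phi2: "\<Phi> j * F k - \<iota> (inverse ((inverse vv)\<^sup>2)) * c * \<Phi> (j + 1) * F (k - 1)
      = \<iota> (inverse ((inverse vv)\<^sup>2)) * F k * \<Phi> j - c * F (k - 1) * \<Phi> (j + 1)" for j k
    by (simp only: power_inverse inverse_inverse_eq 2)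
  let ?A = "\<lambda>k m. z (k - m) * \<Psi> (k + m) - z (m - k) * \<Phi> (k + m)"
  have "F (l + 1) * (z (k - m) * \<Psi> (k + m + 1 - 1) - z (m - k) * \<Phi> (k + m + 1 - 1))
    - \<iota> ((inverse vv)\<^sup>2) * (z (k - m) * \<Psi> (k + m + 1 - 1) - z (m - k) * \<Phi> (k + m + 1 - 1)) * F (l + 1)
    - \<iota> ((inverse vv)\<^sup>2) * F l * (z (k - (m + 1)) * \<Psi> (k + m + 1) - z (m + 1 - k) * \<Phi> (k + m + 1))
    + (z (k - (m + 1)) * \<Psi> (k + m + 1) - z (m + 1 - k) * \<Phi> (k + m + 1)) * F l = 0"
    by (rule bracket_exchange[OF 1 phi2 _ cent_c(1) cent_z cent_z cent_z cent_z])
      (simp_all add: z_c algebra_simps)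
  then have A: "F (l + 1) * ?A k m - \<iota> (inverse (vv\<^sup>2)) * (?A k m * F (l + 1)) - \<iota> (inverse (vv\<^sup>2)) * (F l * ?A k (m + 1)) + ?A k (m + 1) * F l = 0"
    by (simp add: mult.assoc add_ac power_inverse)
  have "F (l + 1) * G k m - \<iota> (inverse (vv\<^sup>2)) * G k m * F (l + 1) - \<iota> (inverse (vv\<^sup>2)) * F l * G k (m + 1) + G k (m + 1) * F l
    = \<iota> (1 / q) * (F (l + 1) * ?A k m - \<iota> (inverse (vv\<^sup>2)) * (?A k m * F (l + 1)) - \<iota> (inverse (vv\<^sup>2)) * (F l * ?A k (m + 1)) + ?A k (m + 1) * F l)"
    unfolding EF_bracket_def
    by (simp only: mult.assoc cent_left[OF cent_iota, where x = "F _"] cent_left[OF cent_iota, where x = "\<iota> (inverse (vv\<^sup>2))"]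
        distrib_left[symmetric] right_diff_distrib[symmetric])
  then show ?thesis unfolding A by simp
qed

end

section \<open>Linear endomorphisms of a free module\<close>

definition smul :: "'r::comm_ring_1 \<Rightarrow> ('b \<Rightarrow>\<^sub>0 'r) \<Rightarrow> ('b \<Rightarrow>\<^sub>0 'r)"
  where "smul r = Poly_Mapping.map ((*) r)"

lemma lookup_smul [simp]: "Poly_Mapping.lookup (smul r m) b = r * Poly_Mapping.lookup m b"
  by (simp add: smul_def map.rep_eq when_def)

lemma smul_simps:
  "smul r (m + n) = smul r m + smul r n" "smul (r + s) m = smul r m + smul s m"
  "smul r (smul s m) = smul (r * s) m" "smul 1 m = m" "smul 0 m = 0" "smul r 0 = 0"
  "smul r (m - n) = smul r m - smul r n" "smul (r - s) m = smul r m - smul s m"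
  "smul r (- m) = - smul r m" "smul (- r) m = - smul r m"
  by (rule poly_mapping_eqI; simp add: lookup_add lookup_minus algebra_simps lookup_single when_def)+

lemma smul_single: "smul r (Poly_Mapping.single b s) = Poly_Mapping.single b (r * s)"
  by (rule poly_mapping_eqI) (simp add: lookup_single when_def)

text \<open>Endomorphisms as a type in \<^class>\<open>ring_1\<close>: the relations are formulated for such rings and can be
  evaluated on operators directly.\<close>

typedef (overloaded) ('b, 'r::comm_ring_1) endo =
  "{f :: ('b \<Rightarrow>\<^sub>0 'r) \<Rightarrow> ('b \<Rightarrow>\<^sub>0 'r). (\<forall>m n. f (m + n) = f m + f n) \<and> (\<forall>r m. f (smul r m) = smul r (f m))}"
  morphisms ap Abs_endo
  by (rule exI[of _ "\<lambda>m. m"]) simp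

setup_lifting type_definition_endo

lemma ap_add: "ap f (m + n) = ap f m + ap f n" and ap_smul: "ap f (smul r m) = smul r (ap f m)"
  using ap[of f] by auto

lemma ap_zero: "ap f 0 = 0" using ap_add[of f 0 0] by simp
lemma ap_uminus: "ap f (- m) = - ap f m"
  using ap_smul[of f "-1" m] by (simp add: smul_simps)
lemma ap_diff: "ap f (m - n) = ap f m - ap f n"
  using ap_add[of f m "- n"] by (simp add: ap_uminus)

instantiation endo :: (type, comm_ring_1) ring_1
begin
lift_definition zero_endo :: "('a,'b) endo" is "\<lambda>m. 0" by (simp add: smul_simps)
lift_definition one_endo :: "('a,'b) endo" is "\<lambda>m. m" by simp
lift_definition plus_endo :: "('a,'b) endo \<Rightarrow> ('a,'b) endo \<Rightarrow> ('a,'b) endo" is "\<lambda>f g m. f m + g m"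
  by (auto simp: smul_simps)
lift_definition minus_endo :: "('a,'b) endo \<Rightarrow> ('a,'b) endo \<Rightarrow> ('a,'b) endo" is "\<lambda>f g m. f m - g m"
  by (auto simp: smul_simps)
lift_definition uminus_endo :: "('a,'b) endo \<Rightarrow> ('a,'b) endo" is "\<lambda>f m. - f m"
  by (auto simp: smul_simps)
lift_definition times_endo :: "('a,'b) endo \<Rightarrow> ('a,'b) endo \<Rightarrow> ('a,'b) endo" is "\<lambda>f g m. f (g m)"
  by auto
instance
proof
  show "(0::('a,'b) endo) \<noteq> 1"
  proof
    assume "(0::('a,'b) endo) = 1"
    then have "ap (0::('a,'b) endo) (Poly_Mapping.single undefined 1) = ap 1 (Poly_Mapping.single undefined 1)" by simp
    then have "(0 :: 'a \<Rightarrow>\<^sub>0 'b) = Poly_Mapping.single undefined 1" by (simp add: zero_endo.rep_eq one_endo.rep_eq)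
    then show False by (metis lookup_single_eq lookup_zero one_neq_zero)
  qed
qed (transfer; auto simp: fun_eq_iff)+
end

lift_definition scal :: "'r::comm_ring_1 \<Rightarrow> ('b,'r) endo" is smul
  by (auto simp: smul_simps mult.commute)

lift_definition lop :: "('b \<Rightarrow> ('b \<Rightarrow>\<^sub>0 'r)) \<Rightarrow> ('b, 'r::comm_ring_1) endo"
  is "\<lambda>\<phi>. lin_ext (\<lambda>b r. smul r (\<phi> b))"
proof (intro conjI allI)
  fix \<phi> :: "'b \<Rightarrow> ('b \<Rightarrow>\<^sub>0 'r)"
  let ?L = "lin_ext (\<lambda>b r. smul r (\<phi> b))"
  show add: "?L (m + n) = ?L m + ?L n" for m n by (rule lin_ext_add) (simp_all add: smul_simps)
  show "?L (smul r m) = smul r (?L m)" for r m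
    by (induction m rule: poly_mapping_linear_induct) (simp_all add: smul_simps add smul_single)
qed

lemma ap_lop_single: "ap (lop \<phi>) (Poly_Mapping.single b r) = smul r (\<phi> b)"
  by (simp add: lop.rep_eq smul_simps)

lemma ap_ring_simps:
  "ap (f + g) m = ap f m + ap g m" "ap (f - g) m = ap f m - ap g m" "ap (- f) m = - ap f m"
  "ap (f * g) m = ap f (ap g m)" "ap 0 m = 0" "ap 1 m = m" "ap (scal r) m = smul r m"
  by (simp_all add: plus_endo.rep_eq minus_endo.rep_eq uminus_endo.rep_eq times_endo.rep_eq
      zero_endo.rep_eq one_endo.rep_eq scal.rep_eq)

lemmas ap_simps = ap_ring_simps ap_add ap_smul ap_zero ap_uminus ap_diff

lemma endo_eqI: "(\<And>m. ap f m = ap g m) \<Longrightarrow> f = g"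
  by (simp add: ap_inject[symmetric] fun_eq_iff)

lemma single_eq_smul: "Poly_Mapping.single b r = smul r (Poly_Mapping.single b 1)"
  by (simp add: smul_single)

lemma endo_eq_basisI:
  assumes "\<And>b. ap f (Poly_Mapping.single b 1) = ap g (Poly_Mapping.single b 1)"
  shows "f = g"
proof (rule endo_eqI)
  fix m show "ap f m = ap g m"
  proof (induction m rule: poly_mapping_linear_induct)
    case (single b r) show ?case using assms[of b] by (subst (1 2) single_eq_smul) (simp add: ap_smul)
  qed (simp_all add: ap_add ap_zero)
qed

lemma central_hom_scal: "rhom j \<Longrightarrow> central_hom (\<lambda>a. scal (j a))"
proof -
  assume "rhom j" then interpret rhom j .
  show ?thesis
    by unfold_locales (auto intro!: endo_eqI simp: ap_simps smul_simps homs mult.commute)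
qed

lemma cent_scal: "cent (scal r)"
  unfolding cent_def by (auto intro!: endo_eqI simp: ap_simps smul_simps mult.commute)

lemma scal_mult: "scal r * scal s = scal (r * s)" and scal_one: "scal 1 = 1"
  by (auto intro!: endo_eqI simp: ap_simps smul_simps mult.commute)

lemma scal_mult_left: "scal r * (scal s * T) = scal (r * s) * T"
  by (simp add: mult.assoc[symmetric] scal_mult)

lemma scal_ring: "scal r + scal s = scal (r + s)" "scal r - scal s = scal (r - s)" "scal r ^ n = scal (r ^ n)"
  "zpow (scal r) (scal s) k = scal (zpow r s k)"
proof -
  show p: "scal r ^ n = scal (r ^ n)" for r :: 'b and n by (induction n) (simp_all add: scal_mult scal_one)
  show "zpow (scal r) (scal s) k = scal (zpow r s k)" by (simp add: zpow_def p)
qed (auto intro!: endo_eqI simp: ap_simps smul_simps)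

section \<open>The Fock-type module\<close>

text \<open>The tuple \<open>(w, u, \<mu>, i)\<close> stands for the monomial \<open>F\<^sub>w E\<^sub>u H\<^sub>\<mu> S\<^sup>i\<close>, in which the \<open>H\<^sub>n\<close> are multiplied in
  increasing order of \<open>n\<close>.  Words are not identified by the quadratic relations, so that the module is
  free.\<close>

type_synonym fock = "int list \<times> int list \<times> int multiset \<times> int"

abbreviation bv :: "int list \<Rightarrow> int list \<Rightarrow> int multiset \<Rightarrow> int \<Rightarrow> (fock \<Rightarrow>\<^sub>0 'r::comm_ring_1)"
  where "bv w u \<mu> i \<equiv> Poly_Mapping.single (w, u, \<mu>, i) 1"

text \<open>\<open>F\<^sub>l\<close> acts by multiplication from the left.  \<open>E\<^sub>k\<close> does so only on monomials without \<open>F\<close>; this is the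
  operator \<open>E0op\<close>.\<close>

definition Fop :: "int \<Rightarrow> (fock, 'r::comm_ring_1) endo"
  where "Fop l = lop (\<lambda>(w, u, \<mu>, i). bv (l # w) u \<mu> i)"
definition E0op :: "int \<Rightarrow> (fock, 'r::comm_ring_1) endo"
  where "E0op k = lop (\<lambda>(w, u, \<mu>, i). bv w (k # u) \<mu> i)"

lemma ap_bv: "ap (Fop l) (bv w u \<mu> i) = bv (l # w) u \<mu> i" "ap (E0op k) (bv w u \<mu> i) = bv w (k # u) \<mu> i"
  by (simp_all add: Fop_def E0op_def ap_lop_single smul_simps)

lemma E0F: "E0op k * Fop l = Fop l * E0op k"
  by (rule endo_eq_basisI) (auto simp: ap_simps ap_bv)

text \<open>An identity between operators that commute with the \<open>F\<^sub>l\<close> up to a scalar has to be checked on monomials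
  without \<open>F\<close> only.\<close>

lemma endo_zero_F:
  assumes "\<And>l. T * Fop l = scal r * Fop l * T" "\<And>u \<mu> i. ap T (bv [] u \<mu> i) = 0"
  shows "T = 0"
proof (rule endo_eq_basisI)
  have "ap T (bv w u \<mu> i) = 0" for w u \<mu> i
  proof (induction w)
    case (Cons l w)
    have "ap (T * Fop l) (bv w u \<mu> i) = ap (scal r * Fop l * T) (bv w u \<mu> i)" using assms(1) by simp
    then show ?case using Cons by (simp add: ap_simps ap_bv smul_simps)
  qed (simp add: assms)
  then show "ap T (Poly_Mapping.single b 1) = ap 0 (Poly_Mapping.single b 1)" for b
    by (cases b) (simp add: ap_simps)
qed

lemma endo_zero_FE:
  assumes "\<And>l. T * Fop l = scal r * Fop l * T" "\<And>k. T * E0op k = scal s * E0op k * T"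
    "\<And>\<mu> i. ap T (bv [] [] \<mu> i) = 0"
  shows "T = 0"
proof (rule endo_zero_F[OF assms(1)])
  show "ap T (bv [] u \<mu> i) = 0" for u \<mu> i
  proof (induction u)
    case (Cons k u)
    have "ap (T * E0op k) (bv [] u \<mu> i) = ap (scal s * E0op k * T) (bv [] u \<mu> i)" using assms(2) by simp
    then show ?case using Cons by (simp add: ap_simps ap_bv smul_simps)
  qed (simp add: assms)
qed

locale fock_rep = rhom j for j :: "cv \<Rightarrow> 'r::comm_ring_1" +
  fixes c ci :: 'r
  assumes cci: "c * ci = 1"
begin

lemma cic: "ci * c = 1" using cci by (simp add: mult.commute)

abbreviation io :: "cv \<Rightarrow> (fock, 'r) endo" where "io a \<equiv> scal (j a)"

sublocale io: central_hom io by (rule central_hom_scal) (rule rhom_axioms)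

text \<open>The value of \<open>[H\<^sub>n, H\<^sub>-\<^sub>n]\<close>.\<close>

definition kap :: "int \<Rightarrow> 'r"
  where "kap n = j (hcoeff n) * (j (1 / (vv - inverse vv)) * (zpow c ci (2 * n) - zpow c ci (- (2 * n))))"

definition hE :: "int \<Rightarrow> 'r" where "hE n = j (hcoeff n) * zpow c ci (- \<bar>n\<bar>)"
definition hF :: "int \<Rightarrow> 'r" where "hF n = j (hcoeff n) * zpow c ci \<bar>n\<bar>"

text \<open>\<open>H\<^sub>n\<close> moves to the right through the letters \<open>F\<close> and \<open>E\<close>, and then to its place in the ordered product of the
  \<open>H\<close>: a positive mode passes the negative ones and picks up a contraction for each factor \<open>H\<^sub>-\<^sub>n\<close>.\<close>

fun hfun :: "int \<Rightarrow> int list \<Rightarrow> int list \<Rightarrow> int multiset \<Rightarrow> int \<Rightarrow> (fock \<Rightarrow>\<^sub>0 'r)" where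
  "hfun n (l # w) u \<mu> i = ap (Fop l) (hfun n w u \<mu> i) - smul (hF n) (bv ((l + n) # w) u \<mu> i)"
| "hfun n [] (k # u) \<mu> i = ap (E0op k) (hfun n [] u \<mu> i) + smul (hE n) (bv [] ((k + n) # u) \<mu> i)"
| "hfun n [] [] \<mu> i = bv [] [] (add_mset n \<mu>) i
     + (if n > 0 then smul (of_nat (count \<mu> (- n)) * kap n) (bv [] [] (\<mu> - {#- n#}) i) else 0)"

definition Hop :: "int \<Rightarrow> (fock, 'r) endo" where "Hop n = lop (\<lambda>(w, u, \<mu>, i). hfun n w u \<mu> i)"

lemma ap_Hop: "ap (Hop n) (bv w u \<mu> i) = hfun n w u \<mu> i"
  by (simp add: Hop_def ap_lop_single smul_simps)

lemma HF: "Hop n * Fop l - Fop l * Hop n = - (scal (hF n) * Fop (l + n))"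
  by (rule endo_eq_basisI) (auto simp: ap_simps ap_bv ap_Hop)

lemma HF': "Hop n * Fop l = Fop l * Hop n - scal (hF n) * Fop (l + n)"
  using HF[of n l] by (simp add: algebra_simps)

lemma HF_left: "Hop n * (Fop l * T) = Fop l * (Hop n * T) - scal (hF n) * (Fop (l + n) * T)"
  by (simp add: mult.assoc[symmetric] HF') (simp add: mult.assoc left_diff_distrib)

lemma scal_left: "T * (scal r * U) = scal r * (T * U)" by (rule cent_left[OF cent_scal])

lemma F_left: "E0op k * (Fop l * T) = Fop l * (E0op k * T)"
  by (simp add: mult.assoc[symmetric] E0F)

lemma HE0: "Hop n * E0op k - E0op k * Hop n = scal (hE n) * E0op (k + n)"
proof -
  have "Hop n * E0op k - E0op k * Hop n - scal (hE n) * E0op (k + n) = 0" (is "?T = 0")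
  proof (rule endo_zero_F[where r = 1])
    fix l
    have "Hop n * E0op k * Fop l = Fop l * (Hop n * E0op k) - scal (hF n) * (Fop (l + n) * E0op k)"
      by (simp add: mult.assoc E0F) (simp add: mult.assoc[symmetric] HF' left_diff_distrib)
    moreover have "E0op k * Hop n * Fop l = Fop l * (E0op k * Hop n) - scal (hF n) * (Fop (l + n) * E0op k)"
      by (simp add: mult.assoc HF' right_diff_distrib F_left scal_left[of "E0op _"] E0F)
    moreover have "scal (hE n) * E0op (k + n) * Fop l = Fop l * (scal (hE n) * E0op (k + n))"
      by (simp add: mult.assoc E0F scal_left[of "Fop _"])
    ultimately show "?T * Fop l = scal 1 * Fop l * ?T"
      by (simp add: left_diff_distrib right_diff_distrib scal_one)
  qed (auto simp: ap_simps ap_bv ap_Hop)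
  then show ?thesis by simp
qed

lemma HE0': "Hop n * E0op k = E0op k * Hop n + scal (hE n) * E0op (k + n)"
  using HE0[of n k] by (simp add: algebra_simps)

lemma HE0_left: "Hop n * (E0op k * T) = E0op k * (Hop n * T) + scal (hE n) * (E0op (k + n) * T)"
  by (simp add: mult.assoc[symmetric] HE0') (simp add: mult.assoc distrib_right)

lemma kap_minus: "kap (- n) = - kap n"
  by (simp add: kap_def hcoeff_minus algebra_simps)

lemma HH:
  assumes "l \<noteq> 0" "k \<noteq> 0"
  shows "Hop l * Hop k - Hop k * Hop l = (if l = - k then scal (kap l) else 0)"
proof -
  let ?C = "Hop l * Hop k - Hop k * Hop l"
  let ?z = "if l = - k then scal (kap l) else 0 :: (fock, 'r) endo"
  have z: "cent ?z" by (auto simp: cent_scal) (simp add: cent_def)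
  have "?C - ?z = 0"
  proof (rule endo_zero_FE[where r = 1 and s = 1])
    fix p
    have HHF: "Hop a * Hop b * Fop p = Fop p * (Hop a * Hop b) - scal (hF a) * (Fop (p + a) * Hop b)
        - scal (hF b) * (Fop (p + b) * Hop a) + scal (hF b * hF a) * Fop (p + b + a)" for a b
      by (simp add: mult.assoc HF' HF_left right_diff_distrib scal_left[of "Hop _"] scal_mult_left)
    have "?C * Fop p = Fop p * ?C"
      unfolding left_diff_distrib right_diff_distrib HHF by (simp add: algebra_simps mult.commute)
    then show "(?C - ?z) * Fop p = scal 1 * Fop p * (?C - ?z)"
      unfolding left_diff_distrib[of ?C] right_diff_distrib[of _ ?C] scal_one mult_1_left cent_comm[OF z] by simp
  next
    fix p
    have HHE: "Hop a * Hop b * E0op p = E0op p * (Hop a * Hop b) + scal (hE a) * (E0op (p + a) * Hop b)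
        + scal (hE b) * (E0op (p + b) * Hop a) + scal (hE b * hE a) * E0op (p + b + a)" for a b
      by (simp add: mult.assoc HE0' HE0_left distrib_left scal_left[of "Hop _"] scal_mult_left add_ac)
    have "?C * E0op p = E0op p * ?C"
      unfolding left_diff_distrib right_diff_distrib HHE by (simp add: algebra_simps mult.commute)
    then show "(?C - ?z) * E0op p = scal 1 * E0op p * (?C - ?z)"
      unfolding left_diff_distrib[of ?C] right_diff_distrib[of _ ?C] scal_one mult_1_left cent_comm[OF z] by simp
  next
    fix \<mu> i
    have HHv: "ap (Hop a) (ap (Hop b) (bv [] [] \<mu> i)) = bv [] [] (add_mset a (add_mset b \<mu>)) i
       + (if a > 0 then smul (of_nat (count (add_mset b \<mu>) (- a)) * kap a) (bv [] [] (add_mset b \<mu> - {#- a#}) i) else 0)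
       + (if b > 0 then smul (of_nat (count \<mu> (- b)) * kap b) (bv [] [] (add_mset a (\<mu> - {#- b#})) i
         + (if a > 0 then smul (of_nat (count (\<mu> - {#- b#}) (- a)) * kap a) (bv [] [] (\<mu> - {#- b#} - {#- a#}) i) else 0)) else 0)" for a b
      by (simp add: ap_Hop ap_add ap_smul ap_zero)
    have pos_neg: "ap (Hop a) (ap (Hop b) (bv [] [] \<mu> i)) - ap (Hop b) (ap (Hop a) (bv [] [] \<mu> i))
        = (if a = - b then smul (kap a) (bv [] [] \<mu> i) else 0)" if "a > 0" "b < 0" for a b
    proof (cases "a = - b")
      case True
      have 1: "smul (of_nat (count \<mu> b) * kap a) (bv [] [] (add_mset b (\<mu> - {#b#})) i) = smul (of_nat (count \<mu> b) * kap a) (bv [] [] \<mu> i)"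
      proof (cases "b \<in># \<mu>")
        case False then show ?thesis by (simp add: not_in_iff smul_simps)
      qed simp
      show ?thesis unfolding HHv using that True
        by (simp add: add_mset_commute[of "- b" b] 1[simplified True] distrib_right smul_simps)
    next
      case False
      then have "add_mset b \<mu> - {#- a#} = add_mset b (\<mu> - {#- a#})" by (intro diff_add_mset_swap) auto
      then show ?thesis unfolding HHv using that False by (simp add: add_mset_commute[of a b])
    qed
    have same: "ap (Hop a) (ap (Hop b) (bv [] [] \<mu> i)) = ap (Hop b) (ap (Hop a) (bv [] [] \<mu> i))" if "a > 0 \<and> b > 0 \<or> a < 0 \<and> b < 0" for a b
    proof (cases "a > 0")
      case True
      have s: "add_mset b \<mu> - {#- a#} = add_mset b (\<mu> - {#- a#})" "add_mset a \<mu> - {#- b#} = add_mset a (\<mu> - {#- b#})"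
        using that True by (auto intro!: diff_add_mset_swap)
      show ?thesis
      proof (cases "a = b")
        case False
        show ?thesis unfolding HHv using that True False
          by (simp add: s smul_simps add_mset_commute[of a b] diff_right_commute[of \<mu> "{#- a#}"] algebra_simps)
      qed simp
    next
      case False then show ?thesis unfolding HHv using that by (simp add: add_mset_commute[of a b])
    qed
    show "ap (?C - ?z) (bv [] [] \<mu> i) = 0"
    proof (cases "l > 0"; cases "k > 0")
      assume "l > 0" "k > 0" then show ?thesis using same[of l k] by (simp add: ap_simps)
    next
      assume "l > 0" "\<not> k > 0" then show ?thesis using pos_neg[of l k] assms by (auto simp: ap_simps)
    next
      assume "\<not> l > 0" "k > 0"
      then have "ap (Hop l) (ap (Hop k) (bv [] [] \<mu> i)) - ap (Hop k) (ap (Hop l) (bv [] [] \<mu> i))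
         = - (if k = - l then smul (kap k) (bv [] [] \<mu> i) else 0)"
        using pos_neg[of k l] assms by (simp add: algebra_simps split: if_splits)
      then show ?thesis using kap_minus[of k] by (auto simp: ap_simps smul_simps)
    next
      assume "\<not> l > 0" "\<not> k > 0" then show ?thesis using same[of l k] assms by (simp add: ap_simps)
    qed
  qed
  then show ?thesis by simp
qed

definition Sop :: "(fock, 'r) endo"
  where "Sop = lop (\<lambda>(w, u, \<mu>, i). smul (j (vv powi (int (length u) - int (length w)))) (bv w u \<mu> (i + 1)))"
definition Siop :: "(fock, 'r) endo"
  where "Siop = lop (\<lambda>(w, u, \<mu>, i). smul (j (vv powi (int (length w) - int (length u)))) (bv w u \<mu> (i - 1)))"

lemma ap_Sop: "ap Sop (bv w u \<mu> i) = smul (j (vv powi (int (length u) - int (length w)))) (bv w u \<mu> (i + 1))"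
  and ap_Siop: "ap Siop (bv w u \<mu> i) = smul (j (vv powi (int (length w) - int (length u)))) (bv w u \<mu> (i - 1))"
  by (simp_all add: Sop_def Siop_def ap_lop_single smul_simps)

lemma SSi: "Sop * Siop = 1" "Siop * Sop = 1"
proof -
  have "vv powi (a - b) * vv powi (b - a) = 1" for a b by (simp flip: power_int_add)
  then have "j (vv powi (a - b)) * j (vv powi (b - a)) = 1" for a b by (metis hom_mult hom_one)
  then show "Sop * Siop = 1" "Siop * Sop = 1"
    by (auto intro!: endo_eq_basisI simp: ap_simps ap_Sop ap_Siop smul_simps)
qed

lemma SF: "Sop * Fop l = io (inverse vv) * Fop l * Sop"
proof -
  have "vv powi (a - (1 + b)) = inverse vv * vv powi (a - b)" for a b
    by (simp add: power_int_diff power_int_add field_simps)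
  then show ?thesis
    by (intro endo_eq_basisI) (auto simp: ap_simps ap_Sop ap_bv smul_simps hom_mult)
qed

lemma SE0: "Sop * E0op l = io vv * E0op l * Sop"
proof -
  have "vv powi (1 + b - a) = vv * vv powi (b - a)" for a b
    by (simp add: power_int_diff power_int_add field_simps)
  then show ?thesis
    by (intro endo_eq_basisI) (auto simp: ap_simps ap_Sop ap_bv smul_simps hom_mult)
qed

lemma SH: "Sop * Hop n = Hop n * Sop"
proof -
  have "Sop * Hop n - Hop n * Sop = 0"
  proof (rule endo_zero_FE[where r = "j (inverse vv)" and s = "j vv"])
    fix l
    have "Sop * Hop n * Fop l = io (inverse vv) * (Fop l * (Sop * Hop n)) - scal (hF n) * (io (inverse vv) * (Fop (l + n) * Sop))"
    proof -
      have "Sop * Hop n * Fop l = Sop * Fop l * Hop n - scal (hF n) * (Sop * Fop (l + n))"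
        by (simp add: mult.assoc HF' right_diff_distrib scal_left[of Sop])
      then show ?thesis by (simp add: SF mult.assoc)
    qed
    moreover have "Hop n * Sop * Fop l = io (inverse vv) * (Fop l * (Hop n * Sop)) - scal (hF n) * (io (inverse vv) * (Fop (l + n) * Sop))"
    proof -
      have "Hop n * Sop * Fop l = io (inverse vv) * (Hop n * Fop l * Sop)"
        by (simp add: mult.assoc SF scal_left[of "Hop n"])
      then show ?thesis by (simp add: HF' left_diff_distrib right_diff_distrib mult.assoc scal_left[of "io _"])
    qed
    ultimately show "(Sop * Hop n - Hop n * Sop) * Fop l = io (inverse vv) * Fop l * (Sop * Hop n - Hop n * Sop)"
      by (simp add: left_diff_distrib right_diff_distrib mult.assoc)
  next
    fix l
    have "Sop * Hop n * E0op l = io vv * (E0op l * (Sop * Hop n)) + scal (hE n) * (io vv * (E0op (l + n) * Sop))"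
    proof -
      have "Sop * Hop n * E0op l = Sop * E0op l * Hop n + scal (hE n) * (Sop * E0op (l + n))"
        by (simp add: mult.assoc HE0' distrib_left scal_left[of Sop])
      then show ?thesis by (simp add: SE0 mult.assoc)
    qed
    moreover have "Hop n * Sop * E0op l = io vv * (E0op l * (Hop n * Sop)) + scal (hE n) * (io vv * (E0op (l + n) * Sop))"
    proof -
      have "Hop n * Sop * E0op l = io vv * (Hop n * E0op l * Sop)"
        by (simp add: mult.assoc SE0 scal_left[of "Hop n"])
      then show ?thesis by (simp add: HE0' distrib_left distrib_right mult.assoc scal_left[of "io _"])
    qed
    ultimately show "(Sop * Hop n - Hop n * Sop) * E0op l = io vv * E0op l * (Sop * Hop n - Hop n * Sop)"
      by (simp add: left_diff_distrib right_diff_distrib mult.assoc)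
  next
    show "ap (Sop * Hop n - Hop n * Sop) (bv [] [] \<mu> i) = 0" for \<mu> i
      by (simp add: ap_simps ap_Hop ap_Sop smul_simps homs)
  qed
  then show ?thesis by simp
qed

abbreviation "cop \<equiv> scal c :: (fock, 'r) endo"
abbreviation "ciop \<equiv> scal ci :: (fock, 'r) endo"
definition Kop :: "(fock, 'r) endo" where "Kop = Sop * Sop * ciop"
definition Kiop :: "(fock, 'r) endo" where "Kiop = Siop * Siop * cop"

lemma SiT: assumes "Sop * T = io r * T' * Sop" shows "T * Siop = io r * (Siop * T')"
proof -
  have "Siop * (Sop * T) * Siop = Siop * (io r * (T' * Sop)) * Siop" using assms by (simp add: mult.assoc)
  then have "(Siop * Sop) * (T * Siop) = Siop * (io r * (T' * (Sop * Siop)))" by (simp only: mult.assoc)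
  then show ?thesis by (simp add: SSi scal_left[of Siop])
qed

lemma Si_conj:
  assumes "Sop * T = io r * T * Sop" "r \<noteq> 0"
  shows "Siop * T = io (inverse r) * T * Siop"
proof -
  have "io (inverse r) * (T * Siop) = io (inverse r) * (io r * (Siop * T))" using SiT[OF assms(1)] by simp
  also have "\<dots> = Siop * T" using assms(2) by (simp add: scal_mult_left hom_mult[symmetric] hom_one scal_one)
  finally show ?thesis by (simp add: mult.assoc)
qed

lemma K_conj:
  assumes "Sop * T = io r * T * Sop" "r \<noteq> 0"
  shows "Kop * T = io (r\<^sup>2) * T * Kop" "Kiop * T = io (inverse (r\<^sup>2)) * T * Kiop"
proof -
  have *: "U * U * scal d * T = io (s\<^sup>2) * T * (U * U * scal d)" if "U * T = io s * T * U" for U s d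
  proof -
    have left: "U * (T * V) = io s * (T * (U * V))" for V by (simp add: mult.assoc[symmetric] that)
    have "U * U * scal d * T = scal d * (io s * (io s * (T * (U * U))))"
      by (simp add: mult.assoc scal_left[of U] cent_comm[OF cent_scal, where x = U] that left)
    also have "\<dots> = scal (j (s\<^sup>2) * d) * (T * (U * U))"
      by (simp add: scal_mult_left hom_mult power2_eq_square mult_ac)
    also have "\<dots> = io (s\<^sup>2) * T * (U * U * scal d)"
      by (simp add: mult.assoc cent_comm[OF cent_scal, where x = U] scal_left[of U] scal_left[of T] scal_mult_left)
    finally show ?thesis .
  qed
  show "Kop * T = io (r\<^sup>2) * T * Kop" unfolding Kop_def by (rule *[OF assms(1)])
  show "Kiop * T = io (inverse (r\<^sup>2)) * T * Kiop" unfolding Kiop_def using *[OF Si_conj[OF assms]] by (simp add: power_inverse)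
qed

lemma SK: "Sop * Kop = Kop * Sop" "Sop * Kiop = Kiop * Sop"
proof -
  show "Sop * Kop = Kop * Sop" by (simp add: Kop_def mult.assoc cent_comm[OF cent_scal, where x = Sop] scal_left[of Sop])
  have "Sop * Kiop = Sop * Siop * Siop * cop" by (simp add: Kiop_def mult.assoc)
  moreover have "Kiop * Sop = Siop * (Siop * Sop) * cop" by (simp add: Kiop_def mult.assoc cent_comm[OF cent_scal, where x = Sop] scal_left[of Siop] cent_comm[OF cent_scal, where x = Siop])
  ultimately show "Sop * Kiop = Kiop * Sop" by (simp add: SSi)
qed

lemma KK: "Kop * Kiop = 1" "Kiop * Kop = 1" "Sop * Sop = Kop * cop"
proof -
  have "Kop * Kiop = scal (ci * c) * (Sop * (Sop * Siop) * Siop)"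
    by (simp add: Kop_def Kiop_def mult.assoc cent_comm[OF cent_scal, where x = Sop] cent_comm[OF cent_scal, where x = Siop] scal_left[of Sop] scal_left[of Siop] scal_mult_left)
  then show "Kop * Kiop = 1" by (simp add: SSi cic scal_one)
  have "Kiop * Kop = scal (c * ci) * (Siop * (Siop * Sop) * Sop)"
    by (simp add: Kop_def Kiop_def mult.assoc cent_comm[OF cent_scal, where x = Sop] cent_comm[OF cent_scal, where x = Siop] scal_left[of Sop] scal_left[of Siop] scal_mult_left)
  then show "Kiop * Kop = 1" by (simp add: SSi cci scal_one)
  show "Sop * Sop = Kop * cop" by (simp add: Kop_def mult.assoc scal_mult cic scal_one)
qed

sublocale cd: cartan_data io cop ciop Kop Kiop Hop
proof
  show "Kop * Hop n = Hop n * Kop" for n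
    using K_conj(1)[of "Hop n" 1] SH by (simp add: hom_one scal_one)
  fix l k :: int assume "l \<noteq> 0" "k \<noteq> 0"
  then show "Hop l * Hop k - Hop k * Hop l = (if l = - k
       then io (hcoeff l) * (io (1 / (vv - inverse vv)) * (zpow cop ciop (2 * l) - zpow cop ciop (- (2 * l)))) else 0)"
    by (simp add: HH kap_def scal_ring scal_mult)
qed (simp_all add: KK cent_scal scal_mult cci cic scal_one)

abbreviation "Gop \<equiv> cd.G"

text \<open>\<open>E\<^sub>k\<close> moves to the right through the letters \<open>F\<close>; each passage adds a bracket, which consists of operators
  that are already defined.\<close>

fun efun :: "int \<Rightarrow> int list \<Rightarrow> int list \<Rightarrow> int multiset \<Rightarrow> int \<Rightarrow> (fock \<Rightarrow>\<^sub>0 'r)" where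
  "efun k [] u \<mu> i = bv [] (k # u) \<mu> i"
| "efun k (l # w) u \<mu> i = ap (Fop l) (efun k w u \<mu> i) + ap (Gop k l) (bv w u \<mu> i)"

definition Eop :: "int \<Rightarrow> (fock, 'r) endo" where "Eop k = lop (\<lambda>(w, u, \<mu>, i). efun k w u \<mu> i)"

lemma ap_Eop: "ap (Eop k) (bv w u \<mu> i) = efun k w u \<mu> i"
  by (simp add: Eop_def ap_lop_single smul_simps)

lemma EF: "Eop k * Fop l = Fop l * Eop k + Gop k l"
  by (rule endo_eq_basisI) (auto simp: ap_simps ap_bv ap_Eop)

lemma EF_left: "Eop k * (Fop l * T) = Fop l * (Eop k * T) + Gop k l * T"
  by (simp add: mult.assoc[symmetric] EF) (simp add: mult.assoc distrib_right)

text \<open>Vectors without \<open>F\<close>, on which \<open>E0op\<close> is the action of \<open>E\<close>.\<close>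

definition based :: "(fock \<Rightarrow>\<^sub>0 'r) set" where "based = {m. fst ` Poly_Mapping.keys m \<subseteq> {[]}}"

lemma based_induct [consumes 1, case_names zero bv add]:
  assumes "m \<in> based" "P 0" "\<And>u \<mu> i r. P (smul r (bv [] u \<mu> i))"
    "\<And>m n. m \<in> based \<Longrightarrow> n \<in> based \<Longrightarrow> P m \<Longrightarrow> P n \<Longrightarrow> P (m + n)"
  shows "P m"
proof -
  have eq: "m = (\<Sum>b\<in>Poly_Mapping.keys m. smul (Poly_Mapping.lookup m b) (Poly_Mapping.single b 1))"
    by (rule poly_mapping_eqI)
      (simp add: lookup_sum lookup_single when_def in_keys_iff if_distrib[where f = "\<lambda>x. _ * x"] sum.delta cong: if_cong)
  have PB: "P (\<Sum>b\<in>B. smul (Poly_Mapping.lookup m b) (Poly_Mapping.single b 1))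
      \<and> (\<Sum>b\<in>B. smul (Poly_Mapping.lookup m b) (Poly_Mapping.single b 1)) \<in> based" if "finite B" "B \<subseteq> Poly_Mapping.keys m" for B
    using that
  proof (induction B)
    case empty then show ?case using assms(2) by (simp add: based_def)
  next
    case (insert b B)
    obtain u \<mu> i where b: "b = ([], u, \<mu>, i)" using insert.prems assms(1) unfolding based_def by (cases b) force
    have "smul (Poly_Mapping.lookup m b) (bv [] u \<mu> i) \<in> based" by (auto simp: based_def smul_single)
    moreover have "x + y \<in> based" if "x \<in> based" "y \<in> based" for x y
      using that keys_add[of x y] unfolding based_def by blast
    ultimately show ?case using insert assms(3,4) b by simp
  qed
  show ?thesis by (rule subst[OF eq[symmetric], of P]) (rule conjunct1[OF PB[OF finite_keys order_refl]])
qed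

lemma based_bv: "smul r (bv [] u \<mu> i) \<in> based" by (auto simp: based_def smul_single)
lemma based_zero: "0 \<in> based" by (simp add: based_def)
lemma based_add: "x \<in> based \<Longrightarrow> y \<in> based \<Longrightarrow> x + y \<in> based"
  using keys_add[of x y] unfolding based_def by blast
lemma based_smul: "x \<in> based \<Longrightarrow> smul r x \<in> based"
  unfolding based_def by (auto simp: in_keys_iff image_subset_iff)
lemma based_diff: "x \<in> based \<Longrightarrow> y \<in> based \<Longrightarrow> x - y \<in> based"
  using based_add[of x "smul (-1) y"] based_smul[of y "-1"] by (simp add: smul_simps)

lemma E_based: "m \<in> based \<Longrightarrow> ap (Eop k) m = ap (E0op k) m"
  by (induction rule: based_induct) (simp_all add: ap_simps ap_Eop ap_bv)

lemma based_E0: "m \<in> based \<Longrightarrow> ap (E0op k) m \<in> based"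
  by (induction rule: based_induct) (simp_all add: ap_simps ap_bv based_bv based_zero based_add)

lemma based_H: "m \<in> based \<Longrightarrow> ap (Hop n) m \<in> based"
proof (induction rule: based_induct)
  case (bv u \<mu> i r)
  have "hfun n [] u \<mu> i \<in> based"
  proof (induction u)
    case Nil
    have "smul s (bv [] [] \<mu> i) \<in> based" "bv [] [] \<mu> i \<in> based" for s \<mu> i
      using based_bv[of 1 "[]" \<mu> i] by (auto intro: based_bv simp: smul_simps)
    then show ?case by (auto intro!: based_add based_zero)
  next
    case (Cons k u) then show ?case by (auto intro!: based_add based_bv based_E0)
  qed
  then show ?case by (simp add: ap_simps ap_Hop based_smul)
qed (simp_all add: ap_simps based_zero based_add)

lemma based_S: "m \<in> based \<Longrightarrow> ap Sop m \<in> based" "m \<in> based \<Longrightarrow> ap Siop m \<in> based"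
  by (induction rule: based_induct; simp add: ap_simps based_zero based_add ap_Sop ap_Siop smul_simps based_bv)+

lemma endo_zero_based:
  assumes "\<And>l. T * Fop l = scal r * Fop l * T" "\<And>m. m \<in> based \<Longrightarrow> ap T m = 0"
  shows "T = 0"
  by (rule endo_zero_F[OF assms(1)]) (use assms(2)[OF based_bv[of 1]] in \<open>simp_all add: smul_simps\<close>)

lemma HE:
  assumes "n \<noteq> 0"
  shows "Hop n * Eop k = Eop k * Hop n + scal (hE n) * Eop (k + n)"
proof -
  have "Hop n * Eop k - Eop k * Hop n - scal (hE n) * Eop (k + n) = 0" (is "?T = 0")
  proof (rule endo_zero_based[where r = 1])
    fix l
    have HG: "Hop n * Gop k l = Gop k l * Hop n + (scal (hE n) * Gop (k + n) l - scal (hF n) * Gop k (l + n))"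
      using cd.H_bracket[OF assms, of k l]
      by (simp add: hE_def hF_def scal_ring right_diff_distrib scal_mult_left diff_eq_eq add.commute)
    have 1: "Hop n * Eop k * Fop l = Fop l * (Hop n * Eop k) - scal (hF n) * (Fop (l + n) * Eop k)
        + Gop k l * Hop n + (scal (hE n) * Gop (k + n) l - scal (hF n) * Gop k (l + n))"
      by (simp only: mult.assoc EF distrib_left HF_left HG add.assoc)
    have 2: "Eop k * Hop n * Fop l = Fop l * (Eop k * Hop n) + Gop k l * Hop n
        - (scal (hF n) * (Fop (l + n) * Eop k) + scal (hF n) * Gop k (l + n))"
      by (simp only: mult.assoc HF' right_diff_distrib EF_left scal_left[of "Eop _"] EF distrib_left)
    have 3: "scal (hE n) * Eop (k + n) * Fop l = Fop l * (scal (hE n) * Eop (k + n)) + scal (hE n) * Gop (k + n) l"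
      by (simp only: mult.assoc EF distrib_left scal_left[of "Fop _"])
    show "?T * Fop l = scal 1 * Fop l * ?T"
      unfolding left_diff_distrib right_diff_distrib scal_one mult_1_left 1 2 3 by simp
  next
    fix m :: "fock \<Rightarrow>\<^sub>0 'r" assume m: "m \<in> based"
    have "ap (Hop n * E0op k) m = ap (E0op k * Hop n + scal (hE n) * E0op (k + n)) m" by (simp add: HE0')
    then show "ap ?T m = 0" using m by (simp add: ap_simps E_based based_H)
  qed
  then show ?thesis by (simp add: algebra_simps)
qed

lemma SG: "Sop * Gop k l = Gop k l * Sop"
  by (rule cd.bracket_commutes) (simp_all add: SK SH)

lemma SE: "Sop * Eop k = io vv * Eop k * Sop"
proof -
  have "Sop * Eop k - io vv * Eop k * Sop = 0" (is "?T = 0")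
  proof (rule endo_zero_based[where r = "j (inverse vv)"])
    fix l
    have "io vv * (io (inverse vv) * T) = T" for T
      by (simp add: scal_mult_left hom_mult[symmetric] hom_one scal_one)
    moreover have SFl: "Sop * (Fop l * T) = io (inverse vv) * (Fop l * (Sop * T))" for T
      by (simp add: mult.assoc[symmetric] SF)
    ultimately have 1: "io vv * Eop k * Sop * Fop l = Fop l * (Eop k * Sop) + Gop k l * Sop"
      by (simp only: mult.assoc SF EF_left scal_left[of "Eop _"] distrib_left)
    have 2: "Sop * Eop k * Fop l = io (inverse vv) * (Fop l * (Sop * Eop k)) + Gop k l * Sop"
      by (simp only: mult.assoc EF distrib_left SFl SG)
    have "io (inverse vv) * Fop l * (io vv * Eop k * Sop) = Fop l * (Eop k * Sop)"
      by (simp only: mult.assoc scal_left[of "Fop _"] scal_mult_left hom_mult[symmetric])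
        (simp add: hom_one scal_one)
    then show "?T * Fop l = io (inverse vv) * Fop l * ?T"
      by (simp only: left_diff_distrib right_diff_distrib 1 2) (simp add: mult.assoc)
  next
    fix m :: "fock \<Rightarrow>\<^sub>0 'r" assume m: "m \<in> based"
    have "ap (Sop * E0op k) m = ap (io vv * E0op k * Sop) m" by (simp add: SE0)
    then show "ap ?T m = 0" using m by (simp add: ap_simps E_based based_S)
  qed
  then show ?thesis by simp
qed

text \<open>The differences of the two sides of the quadratic relations, as operators.  The argument \<open>E\<close> of \<open>qE\<close> is
  either \<open>E0op\<close> or the full operator.\<close>

definition qE :: "(int \<Rightarrow> (fock, 'r) endo) \<Rightarrow> int \<Rightarrow> int \<Rightarrow> (fock, 'r) endo"
  where "qE E k l = (E (k + 1) * E l - io (vv ^ 2) * E l * E (k + 1)) - (io (vv ^ 2) * E k * E (l + 1) - E (l + 1) * E k)"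
definition qF :: "int \<Rightarrow> int \<Rightarrow> (fock, 'r) endo"
  where "qF k l = (Fop (k + 1) * Fop l - io (inverse (vv ^ 2)) * Fop l * Fop (k + 1)) - (io (inverse (vv ^ 2)) * Fop k * Fop (l + 1) - Fop (l + 1) * Fop k)"

lemma HE_cd: "l \<noteq> 0 \<Longrightarrow> Hop l * Eop k - Eop k * Hop l = io (hcoeff l) * cd.z (- \<bar>l\<bar>) * Eop (k + l)"
  by (simp add: HE hE_def scal_ring scal_mult)
lemma HF_cd: "Hop l * Fop k - Fop k * Hop l = - (io (hcoeff l) * cd.z \<bar>l\<bar> * Fop (k + l))"
  by (simp add: HF' hF_def scal_ring scal_mult)

text \<open>The two terms that arise when the quadratic relation of \<open>E\<close> moves past \<open>F\<^sub>m\<close> both vanish by \<open>bracket_E\<close>.  So the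
  values of this relation on monomials with \<open>F\<close> are determined by those on monomials without \<open>F\<close>.\<close>

lemma qE_F: "qE Eop k l * Fop m = Fop m * qE Eop k l"
proof -
  have b: "Eop (k + 1) * Gop l m - io (vv\<^sup>2) * Gop l m * Eop (k + 1) - io (vv\<^sup>2) * Eop k * Gop (l + 1) m + Gop (l + 1) m * Eop k = 0" for k l
    by (rule cd.bracket_E[OF HE_cd K_conj(1)[OF SE vv_neq_0] K_conj(2)[OF SE vv_neq_0]])
  have "qE Eop k l * Fop m = Fop m * qE Eop k l + ((Eop (k + 1) * Gop l m - io (vv\<^sup>2) * Gop l m * Eop (k + 1) - io (vv\<^sup>2) * Eop k * Gop (l + 1) m + Gop (l + 1) m * Eop k)
     + (Eop (l + 1) * Gop k m - io (vv\<^sup>2) * Gop k m * Eop (l + 1) - io (vv\<^sup>2) * Eop l * Gop (k + 1) m + Gop (k + 1) m * Eop l))"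
    unfolding qE_def
    by (simp only: left_diff_distrib right_diff_distrib distrib_left distrib_right mult.assoc EF EF_left scal_left[of "Eop _"] scal_left[of "Fop _"]
        diff_conv_add_uminus minus_add_distrib minus_minus mult_minus_left mult_minus_right add_ac)
  then show ?thesis using b[of k l] b[of l k] by simp
qed

lemma E_qF: "Eop k * qF l m = qF l m * Eop k"
proof -
  have b: "Fop (l + 1) * Gop k m - io (inverse (vv\<^sup>2)) * Gop k m * Fop (l + 1) - io (inverse (vv\<^sup>2)) * Fop l * Gop k (m + 1) + Gop k (m + 1) * Fop l = 0" for l m
    by (rule cd.bracket_F[OF HF_cd K_conj(1)[OF SF, unfolded power_inverse] K_conj(2)[OF SF, unfolded power_inverse inverse_inverse_eq]]) simp_all
  have "Eop k * qF l m = qF l m * Eop k + ((Fop (l + 1) * Gop k m - io (inverse (vv\<^sup>2)) * Gop k m * Fop (l + 1) - io (inverse (vv\<^sup>2)) * Fop l * Gop k (m + 1) + Gop k (m + 1) * Fop l)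
     + (Fop (m + 1) * Gop k l - io (inverse (vv\<^sup>2)) * Gop k l * Fop (m + 1) - io (inverse (vv\<^sup>2)) * Fop m * Gop k (l + 1) + Gop k (l + 1) * Fop m))"
    unfolding qF_def
    by (simp only: left_diff_distrib right_diff_distrib distrib_left distrib_right mult.assoc EF EF_left scal_left[of "Eop _"] scal_left[of "Fop _"]
        diff_conv_add_uminus minus_add_distrib minus_minus mult_minus_left mult_minus_right add_ac)
  then show ?thesis using b[of l m] b[of m l] by simp
qed

end

section \<open>The submodule of quadratic relations\<close>

context fock_rep begin

text \<open>The vectors that vanish when the words in \<open>E\<close>, respectively in both \<open>E\<close> and \<open>F\<close>, are taken modulo the
  quadratic relations.  Only \<open>Fop\<close> and \<open>E0op\<close> enter the definition, so it is given by formulas with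
  coefficients in \<open>\<complex>(v)\<close>.\<close>

inductive_set N0 :: "(fock \<Rightarrow>\<^sub>0 'r) set" where
  N0_zero: "0 \<in> N0"
| N0_add: "x \<in> N0 \<Longrightarrow> y \<in> N0 \<Longrightarrow> x + y \<in> N0"
| N0_q: "b \<in> based \<Longrightarrow> ap (qE E0op k l) b \<in> N0"
| N0_E: "x \<in> N0 \<Longrightarrow> ap (E0op k) x \<in> N0"

inductive_set N :: "(fock \<Rightarrow>\<^sub>0 'r) set" where
  N_base: "x \<in> N0 \<Longrightarrow> x \<in> N"
| N_add: "x \<in> N \<Longrightarrow> y \<in> N \<Longrightarrow> x + y \<in> N"
| N_q: "ap (qF k l) m \<in> N"
| N_F: "x \<in> N \<Longrightarrow> ap (Fop l) x \<in> N"

lemma N_zero: "0 \<in> N" by (intro N_base N0_zero)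

lemma based_qE: "b \<in> based \<Longrightarrow> ap (qE E0op k l) b \<in> based"
  by (auto simp: qE_def ap_simps intro!: based_diff based_smul based_E0)

lemma N0_based: "x \<in> N0 \<Longrightarrow> x \<in> based"
  by (induction rule: N0.induct) (auto intro: based_zero based_add based_E0 based_qE)

lemma N0_smul: "x \<in> N0 \<Longrightarrow> smul r x \<in> N0"
proof (induction rule: N0.induct)
  case (N0_q b k l)
  then show ?case using N0.N0_q[OF based_smul[of b r], of k l] by (simp add: ap_smul)
qed (auto simp: smul_simps ap_smul[symmetric] intro: N0.intros)

lemma N_smul: "x \<in> N \<Longrightarrow> smul r x \<in> N"
proof (induction rule: N.induct)
  case (N_q k l m) then show ?case using N.N_q[of k l "smul r m"] by (simp add: ap_smul)
qed (auto simp: smul_simps ap_smul[symmetric] intro: N.intros N0_smul)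

lemma N_diff: "x \<in> N \<Longrightarrow> y \<in> N \<Longrightarrow> x - y \<in> N"
  using N_add[of x "smul (-1) y"] N_smul[of y "-1"] by (simp add: smul_simps)
definition stable :: "(fock, 'r) endo \<Rightarrow> bool"
  where "stable T \<longleftrightarrow> (\<forall>x\<in>N0. ap T x \<in> N0) \<and> (\<forall>x\<in>N. ap T x \<in> N)"

lemma stable_scal: "stable (scal r)" by (simp add: stable_def ap_simps N0_smul N_smul)
lemma stable_add: "stable T \<Longrightarrow> stable U \<Longrightarrow> stable (T + U)"
  by (simp add: stable_def ap_simps N0_add N_add)
lemma stable_mult: "stable T \<Longrightarrow> stable U \<Longrightarrow> stable (T * U)"
  by (simp add: stable_def ap_simps)
lemma stable_uminus: "stable T \<Longrightarrow> stable (- T)"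
  using stable_mult[OF stable_scal[of "-1"], of T] by (simp add: stable_def ap_simps smul_simps)

lemma stable_H: "stable (Hop n)"
proof -
  have HqE: "Hop n * qE E0op k l = qE E0op k l * Hop n + (scal (hE n) * qE E0op (k + n) l + scal (hE n) * qE E0op k (l + n))" for k l
    unfolding qE_def
    by (simp only: left_diff_distrib right_diff_distrib distrib_left distrib_right mult.assoc HE0' HE0_left scal_left[of "Hop _"] scal_left[of "E0op _"]
        scal_left[of "io _" "hE n"] diff_conv_add_uminus minus_add_distrib minus_minus mult_minus_left mult_minus_right add_ac)
  have HqF: "Hop n * qF k l = qF k l * Hop n + (- (scal (hF n) * qF (k + n) l) + - (scal (hF n) * qF k (l + n)))" for k l
    unfolding qF_def
    by (simp only: left_diff_distrib right_diff_distrib distrib_left distrib_right mult.assoc HF' HF_left scal_left[of "Hop _"] scal_left[of "Fop _"]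
        scal_left[of "io _" "hF n"] diff_conv_add_uminus minus_add_distrib minus_minus mult_minus_left mult_minus_right add_ac)
  have 0: "ap (Hop n) x \<in> N0" if "x \<in> N0" for x using that
  proof (induction rule: N0.induct)
    case (N0_q b k l)
    have "ap (Hop n) (ap (qE E0op k l) b) = ap (qE E0op k l) (ap (Hop n) b)
        + (smul (hE n) (ap (qE E0op (k + n) l) b) + smul (hE n) (ap (qE E0op k (l + n)) b))"
      using arg_cong[OF HqE[of k l], of "\<lambda>T. ap T b"] by (simp add: ap_ring_simps)
    then show ?case using N0_q by (auto intro!: N0_add N0_smul N0.N0_q based_H)
  next
    case (N0_E x k)
    have "ap (Hop n) (ap (E0op k) x) = ap (E0op k) (ap (Hop n) x) + smul (hE n) (ap (E0op (k + n)) x)"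
      using arg_cong[OF HE0'[of n k], of "\<lambda>T. ap T x"] by (simp add: ap_ring_simps)
    then show ?case using N0_E by (auto intro!: N0_add N0_smul N0.N0_E)
  qed (auto simp: ap_simps intro: N0.intros)
  have "ap (Hop n) x \<in> N" if "x \<in> N" for x using that
  proof (induction rule: N.induct)
    case (N_q k l m)
    have "ap (Hop n) (ap (qF k l) m) = ap (qF k l) (ap (Hop n) m) - smul (hF n) (ap (qF (k + n) l) m) - smul (hF n) (ap (qF k (l + n)) m)"
      using arg_cong[OF HqF[of k l], of "\<lambda>T. ap T m"] by (simp add: ap_ring_simps)
    then show ?case by (auto intro!: N_diff N_smul N.N_q)
  next
    case (N_F x l)
    have "ap (Hop n) (ap (Fop l) x) = ap (Fop l) (ap (Hop n) x) - smul (hF n) (ap (Fop (l + n)) x)"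
      using arg_cong[OF HF'[of n l], of "\<lambda>T. ap T x"] by (simp add: ap_ring_simps)
    then show ?case using N_F by (auto intro!: N_diff N_smul N.N_F)
  qed (auto simp: ap_simps 0 intro: N.intros)
  then show ?thesis using 0 by (simp add: stable_def)
qed

lemma stable_weighted:
  assumes F: "\<And>l. T * Fop l = io (inverse r) * Fop l * T" and E: "\<And>l. T * E0op l = io r * E0op l * T"
    and r: "r \<noteq> 0" and based: "\<And>b. b \<in> based \<Longrightarrow> ap T b \<in> based"
  shows "stable T"
proof -
  have FT: "T * (Fop l * U) = io (inverse r) * (Fop l * (T * U))" for l U by (simp add: mult.assoc[symmetric] F)
  have ET: "T * (E0op l * U) = io r * (E0op l * (T * U))" for l U by (simp add: mult.assoc[symmetric] E)
  have s: "io a * (io b * U) = io (a * b) * U" for a b and U :: "(fock, 'r) endo" by (simp add: scal_mult_left hom_mult)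
  have TqE: "T * qE E0op k l = io (r * r) * (qE E0op k l * T)" for k l
    unfolding qE_def
    by (simp only: left_diff_distrib right_diff_distrib mult.assoc E ET scal_left[of T] scal_left[of "E0op _"] s) (simp add: mult_ac)
  have TqF: "T * qF k l = io (inverse r * inverse r) * (qF k l * T)" for k l
    unfolding qF_def
    by (simp only: left_diff_distrib right_diff_distrib mult.assoc F FT scal_left[of T] scal_left[of "Fop _"] s) (simp add: mult_ac)
  have 0: "ap T x \<in> N0" if "x \<in> N0" for x using that
  proof (induction rule: N0.induct)
    case (N0_q b k l)
    then show ?case using arg_cong[OF TqE[of k l], of "\<lambda>T. ap T b"] based[of b]
      by (auto simp: ap_ring_simps intro!: N0_smul N0.N0_q)
  next
    case (N0_E x k)
    then show ?case using arg_cong[OF E[of k], of "\<lambda>T. ap T x"] by (auto simp: ap_ring_simps intro!: N0_smul N0.N0_E)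
  qed (auto simp: ap_simps intro: N0.intros)
  have "ap T x \<in> N" if "x \<in> N" for x using that
  proof (induction rule: N.induct)
    case (N_q k l m)
    show ?case using arg_cong[OF TqF[of k l], of "\<lambda>T. ap T m"] by (auto simp: ap_ring_simps intro!: N_smul N.N_q)
  next
    case (N_F x l)
    then show ?case using arg_cong[OF F[of l], of "\<lambda>T. ap T x"] by (auto simp: ap_ring_simps intro!: N_smul N.N_F)
  qed (auto simp: ap_simps 0 intro: N.intros)
  then show ?thesis using 0 by (simp add: stable_def)
qed

lemma stable_S: "stable Sop" "stable Siop"
proof -
  show "stable Sop" by (rule stable_weighted[of _ vv]) (use SF SE0 based_S in auto)
  show "stable Siop"
    by (rule stable_weighted[of _ "inverse vv"])
      (use Si_conj[OF SF] Si_conj[OF SE0] based_S in auto)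
qed

lemma stable_K: "stable Kop" "stable Kiop"
  by (auto simp: Kop_def Kiop_def intro!: stable_mult stable_S stable_scal)

lemma stable_G: "stable (Gop k l)"
proof (rule EF_bracket_rel[where P = "\<lambda>a b. stable a"])
  show "stable 0" "stable 1" using stable_scal[of 0] stable_scal[of 1]
    by (simp_all add: stable_def ap_simps N0_zero N_zero)
qed (auto intro: stable_add stable_mult stable_uminus stable_scal stable_K stable_H)

text \<open>\<open>E\<^sub>k\<close> commutes with the quadratic relations of \<open>F\<close>, and its commutators with the \<open>F\<^sub>l\<close> are built from
  operators that preserve \<open>N\<close>.\<close>

lemma N_E: "x \<in> N \<Longrightarrow> ap (Eop k) x \<in> N"
proof (induction rule: N.induct)
  case (N_base x) then show ?case using E_based[OF N0_based] by (auto intro: N.N_base N0_E)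
next
  case (N_q l m x)
  show ?case using arg_cong[OF E_qF[of k l m], of "\<lambda>T. ap T x"] by (auto simp: ap_ring_simps intro!: N.N_q)
next
  case (N_F x l)
  then show ?case using arg_cong[OF EF[of k l], of "\<lambda>T. ap T x"] stable_G[of k l]
    by (auto simp: ap_ring_simps stable_def intro!: N_add N.N_F)
qed (auto simp: ap_simps intro: N_add)

text \<open>Since \<open>qE\<close> commutes with the \<open>F\<^sub>l\<close>, only vectors without \<open>F\<close> need to be considered; there the claim is
  part of the definition of \<open>N0\<close>.\<close>

lemma N_qE: "ap (qE Eop k l) m \<in> N"
proof (induction m rule: poly_mapping_linear_induct)
  case (single b r)
  have "ap (qE Eop k l) (bv w u \<mu> i) \<in> N" for w u \<mu> i
  proof (induction w)
    case Nil
    have b: "bv [] u \<mu> i \<in> based" using based_bv[of 1] by (simp add: smul_simps)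
    then have "ap (qE Eop k l) (bv [] u \<mu> i) = ap (qE E0op k l) (bv [] u \<mu> i)"
      using based_E0[OF b] by (simp add: qE_def ap_simps E_based)
    then show ?case using b by (auto intro: N_base N0_q)
  next
    case (Cons p w)
    then show ?case using arg_cong[OF qE_F[of k l p], of "\<lambda>T. ap T (bv w u \<mu> i)"]
      by (auto simp: ap_ring_simps ap_bv intro: N_F)
  qed
  then show ?case by (cases b) (subst single_eq_smul, simp add: ap_smul N_smul)
qed (auto simp: ap_simps N_zero N_add)

end

section \<open>The submodule of quadratic relations is saturated\<close>

interpretation smul_vs: vector_space "smul :: 'k::field \<Rightarrow> ('b \<Rightarrow>\<^sub>0 'k) \<Rightarrow> _"
  by unfold_locales (simp_all add: smul_simps)

text \<open>\<open>N\<close> involves \<open>Fop\<close> and \<open>E0op\<close> alone, so the module over \<open>\<complex>(v)\<close> with \<open>C = 1\<close> provides a \<open>\<complex>(v)\<close>-form of \<open>N\<close>.\<close>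

interpretation cv_rep: fock_rep "\<lambda>a::cv. a" 1 1
  by unfold_locales auto

context fock_rep begin

definition emb :: "(fock \<Rightarrow>\<^sub>0 cv) \<Rightarrow> (fock \<Rightarrow>\<^sub>0 'r)"
  where "emb = lin_ext (\<lambda>b a. Poly_Mapping.single b (j a))"

lemma emb_single: "emb (Poly_Mapping.single b a) = Poly_Mapping.single b (j a)"
  by (simp add: emb_def hom_zero)
lemma emb_zero: "emb 0 = 0" by (simp add: emb_def)
lemma emb_add: "emb (m + n) = emb m + emb n"
  unfolding emb_def by (rule lin_ext_add) (simp_all add: homs single_add)
lemma emb_smul: "emb (smul a m) = smul (j a) (emb m)"
  by (induction m rule: poly_mapping_linear_induct) (simp_all add: emb_single emb_add emb_zero smul_simps smul_single hom_mult)
lemma emb_diff: "emb (m - n) = emb m - emb n"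
  using emb_add[of "m - n" n] by (simp add: algebra_simps)

lemma emb_F: "emb (ap (Fop l) m) = ap (Fop l) (emb m)" and emb_E0: "emb (ap (E0op l) m) = ap (E0op l) (emb m)"
proof -
  have "emb (ap (Fop l) m) = ap (Fop l) (emb m) \<and> emb (ap (E0op l) m) = ap (E0op l) (emb m)"
  proof (induction m rule: poly_mapping_linear_induct)
    case (single b a)
    have "j 1 = 1" by (rule hom_one)
    then show ?case
      by (cases b) (simp add: single_eq_smul[of _ a] emb_smul emb_single ap_smul ap_bv)
  qed (simp_all add: emb_zero emb_add ap_zero ap_add)
  then show "emb (ap (Fop l) m) = ap (Fop l) (emb m)" "emb (ap (E0op l) m) = ap (E0op l) (emb m)" by auto
qed

lemma emb_qE: "emb (ap (cv_rep.qE E0op k l) m) = ap (qE E0op k l) (emb m)"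
  and emb_qF: "emb (ap (cv_rep.qF k l) m) = ap (qF k l) (emb m)"
  by (simp_all add: qE_def qF_def cv_rep.qE_def cv_rep.qF_def ap_ring_simps emb_diff emb_F emb_E0 emb_smul)

lemma emb_based: "m \<in> cv_rep.based \<Longrightarrow> emb m \<in> based"
  by (induction rule: cv_rep.based_induct)
    (simp_all add: emb_zero emb_add based_zero based_add emb_smul emb_single hom_one based_bv)

lemma emb_N0: "m \<in> cv_rep.N0 \<Longrightarrow> emb m \<in> N0"
  by (induction rule: cv_rep.N0.induct) (auto simp: emb_zero emb_add emb_qE emb_E0 intro: N0.intros emb_based)
lemma emb_N: "m \<in> cv_rep.N \<Longrightarrow> emb m \<in> N"
  by (induction rule: cv_rep.N.induct) (auto simp: emb_add emb_qF emb_F intro: N.intros emb_N0)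

inductive_set rspan :: "(fock \<Rightarrow>\<^sub>0 cv) set \<Rightarrow> (fock \<Rightarrow>\<^sub>0 'r) set" for D where
  rspan_zero: "0 \<in> rspan D"
| rspan_emb: "d \<in> D \<Longrightarrow> smul r (emb d) \<in> rspan D"
| rspan_add: "x \<in> rspan D \<Longrightarrow> y \<in> rspan D \<Longrightarrow> x + y \<in> rspan D"

lemma rspan_map:
  assumes "x \<in> rspan D" "\<And>d. d \<in> D \<Longrightarrow> f d \<in> D'" "\<And>d. emb (f d) = ap T (emb d)"
  shows "ap T x \<in> rspan D'"
  using assms(1)
proof (induction rule: rspan.induct)
  case (rspan_emb d r)
  then show ?case using rspan.rspan_emb[OF assms(2), of d r] by (simp add: ap_smul assms(3))
qed (auto simp: ap_zero ap_add intro: rspan.intros)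

lemma rspan_based: "b \<in> based \<Longrightarrow> b \<in> rspan cv_rep.based"
proof (induction rule: based_induct)
  case (bv u \<mu> i r)
  have "smul r (emb (bv [] u \<mu> i)) \<in> rspan cv_rep.based"
    using cv_rep.based_bv[of 1 u \<mu> i] by (intro rspan_emb) (simp add: smul_simps)
  then show ?case by (simp add: emb_single hom_one)
qed (auto intro: rspan.intros)

lemma rspan_UNIV: "m \<in> rspan UNIV"
proof (induction m rule: poly_mapping_linear_induct)
  case (single b r)
  have "smul r (emb (Poly_Mapping.single b 1)) \<in> rspan UNIV" by (rule rspan_emb) simp
  then show ?case by (simp add: emb_single hom_one smul_single)
qed (auto intro: rspan.intros)

lemma rspan_N0: "x \<in> N0 \<Longrightarrow> x \<in> rspan cv_rep.N0"
proof (induction rule: N0.induct)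
  case (N0_q b k l)
  show ?case by (rule rspan_map[OF rspan_based[OF N0_q]]) (auto intro: cv_rep.N0_q simp: emb_qE)
next
  case (N0_E x k)
  show ?case by (rule rspan_map[OF N0_E(2), where f = "ap (E0op k)"]) (auto intro: cv_rep.N0_E simp: emb_E0)
qed (auto intro: rspan.intros)

lemma rspan_mono: "x \<in> rspan D \<Longrightarrow> D \<subseteq> D' \<Longrightarrow> x \<in> rspan D'"
  by (induction rule: rspan.induct) (auto intro: rspan.intros)

lemma rspan_N: "x \<in> N \<Longrightarrow> x \<in> rspan cv_rep.N"
proof (induction rule: N.induct)
  case (N_base x)
  then show ?case using rspan_mono[OF rspan_N0, of x] cv_rep.N_base by blast
next
  case (N_q k l m)
  show ?case by (rule rspan_map[OF rspan_UNIV]) (auto intro: cv_rep.N_q simp: emb_qF)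
next
  case (N_F x l)
  show ?case by (rule rspan_map[OF N_F(2), where f = "ap (Fop l)"]) (auto intro: cv_rep.N_F simp: emb_F)
qed (auto intro: rspan.intros)

text \<open>Over the field \<open>\<complex>(v)\<close> there is a linear projection onto the \<open>\<complex>(v)\<close>-form of \<open>N\<close>.  Its extension to the coefficient
  ring is a projection onto \<open>N\<close>, so the quotient by \<open>N\<close> embeds into a free module and an element that is not a
  zero divisor acts on it injectively.\<close>

lemma N_saturated:
  assumes r: "\<And>s. r * s = 0 \<Longrightarrow> s = 0" and m: "smul r m \<in> N"
  shows "m \<in> N"
proof -
  have sub: "smul_vs.subspace cv_rep.N"
    unfolding smul_vs.subspace_def by (auto intro: cv_rep.N_zero cv_rep.N_add cv_rep.N_smul)
  interpret vp: vector_space_pair "smul :: cv \<Rightarrow> (fock \<Rightarrow>\<^sub>0 cv) \<Rightarrow> _" "smul :: cv \<Rightarrow> (fock \<Rightarrow>\<^sub>0 cv) \<Rightarrow> _" ..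
  have lid: "Vector_Spaces.linear smul smul (\<lambda>x::fock \<Rightarrow>\<^sub>0 cv. x)" by unfold_locales simp_all
  \<comment> \<open>\<open>g\<close> is the projection over \<open>\<complex>(v)\<close>, \<open>\<gamma>\<close> below its extension of scalars.\<close>
  obtain g where g: "range g \<subseteq> cv_rep.N" "Vector_Spaces.linear smul smul g" "\<And>d. d \<in> cv_rep.N \<Longrightarrow> g d = d"
    using vp.linear_exists_left_inverse_on[OF lid sub] by (auto simp: inj_on_def)
  have g_add: "g (x + y) = g x + g y" and g_smul: "g (smul a x) = smul a (g x)" for x y a
    using vp.linear_add[OF g(2)] vp.linear_scale[OF g(2)] by auto
  have g0: "g 0 = 0" using g_add[of 0 0] by simp
  define \<gamma> where "\<gamma> = lin_ext (\<lambda>b s. smul s (emb (g (Poly_Mapping.single b 1))))"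
  have \<gamma>_add: "\<gamma> (x + y) = \<gamma> x + \<gamma> y" for x y
    unfolding \<gamma>_def by (rule lin_ext_add) (simp_all add: smul_simps)
  have \<gamma>_single: "\<gamma> (Poly_Mapping.single b s) = smul s (emb (g (Poly_Mapping.single b 1)))" for b s
    by (simp add: \<gamma>_def smul_simps)
  have \<gamma>_smul: "\<gamma> (smul s x) = smul s (\<gamma> x)" for s x
    by (induction x rule: poly_mapping_linear_induct)
      (simp_all add: \<gamma>_def[of, THEN fun_cong, of 0] \<gamma>_add \<gamma>_single smul_simps smul_single)
  have \<gamma>_emb: "\<gamma> (emb d) = emb (g d)" for d
  proof (induction d rule: poly_mapping_linear_induct)
    case zero then show ?case by (simp add: emb_zero g0 \<gamma>_def)
  next
    case (single b a)
    have "g (Poly_Mapping.single b a) = smul a (g (Poly_Mapping.single b 1))"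
      by (subst single_eq_smul) (rule g_smul)
    then show ?case by (simp only: emb_single \<gamma>_single emb_smul)
  qed (simp add: emb_add \<gamma>_add g_add)
  have fix_N: "\<gamma> x = x" if "x \<in> rspan cv_rep.N" for x using that
    by (induction rule: rspan.induct) (simp_all add: \<gamma>_add \<gamma>_smul \<gamma>_emb g(3), simp add: \<gamma>_def)
  have "smul r (\<gamma> m) = smul r m" using fix_N[OF rspan_N[OF m]] by (simp add: \<gamma>_smul)
  then have "smul r (\<gamma> m - m) = 0" by (simp add: smul_simps)
  then have "r * Poly_Mapping.lookup (\<gamma> m - m) b = 0" for b by (metis lookup_smul lookup_zero)
  then have "\<gamma> m - m = 0" using r by (intro poly_mapping_eqI) simp
  moreover have "\<gamma> m \<in> N"
    by (induction m rule: poly_mapping_linear_induct)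
      (use g(1) in \<open>auto simp: \<gamma>_add \<gamma>_single intro!: N_add N_smul emb_N\<close>, simp add: \<gamma>_def N_zero)
  ultimately show "m \<in> N" by simp
qed

end

section \<open>The defining relations\<close>

lemma ball_compr:
  "(\<forall>r\<in>{f k |k. P k}. Q r) \<longleftrightarrow> (\<forall>k. P k \<longrightarrow> Q (f k))"
  "(\<forall>r\<in>{g k l |k l. R k l}. Q r) \<longleftrightarrow> (\<forall>k l. R k l \<longrightarrow> Q (g k l))"
  by blast+

text \<open>The set of relations, split into families.  With a predicate \<open>Q\<close> in place of \<open>r = 0\<close> the lemma serves for relations
  that hold, for relations that hold modulo an ideal, and for operators with values in \<open>N\<close>.\<close>

lemma ball_drinfeld_rels:
  "(\<forall>r\<in>drinfeld_rels \<iota> x. Q r) \<longleftrightarrow>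
   (let E = (\<lambda>l. x (GenE l)); F = (\<lambda>l. x (GenF l)); H = (\<lambda>n. x (GenH (Abs_nonzero_int n)));
        S = x GenS; Si = x GenSi; K = x GenK; Ki = x GenKi; c = x GenC; ci = x GenCi
    in Q (S * Si - 1) \<and> Q (Si * S - 1) \<and> Q (K * Ki - 1) \<and> Q (Ki * K - 1) \<and> Q (c * ci - 1) \<and> Q (ci * c - 1)
     \<and> Q (S * S - K * c)
     \<and> (\<forall>k. Q (S * E k * Si - \<iota> vv * E k)) \<and> (\<forall>k. Q (S * F k * Si - \<iota> (inverse vv) * F k))
     \<and> (\<forall>n. n \<noteq> 0 \<longrightarrow> Q (S * H n * Si - H n))
     \<and> (\<forall>k l. Q ((E (k + 1) * E l - \<iota> (vv ^ 2) * E l * E (k + 1)) - (\<iota> (vv ^ 2) * E k * E (l + 1) - E (l + 1) * E k)))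
     \<and> (\<forall>k l. Q ((F (k + 1) * F l - \<iota> (inverse (vv ^ 2)) * F l * F (k + 1)) - (\<iota> (inverse (vv ^ 2)) * F k * F (l + 1) - F (l + 1) * F k)))
     \<and> (\<forall>k l. Q (commutator (E k) (F l) - EF_bracket \<iota> c ci K Ki H k l))
     \<and> (\<forall>k l. l \<noteq> 0 \<longrightarrow> Q (commutator (H l) (E k) - \<iota> (hcoeff l) * zpow c ci (- \<bar>l\<bar>) * E (k + l)))
     \<and> (\<forall>k l. l \<noteq> 0 \<longrightarrow> Q (commutator (H l) (F k) + \<iota> (hcoeff l) * zpow c ci \<bar>l\<bar> * F (k + l)))
     \<and> (\<forall>k l. k \<noteq> 0 \<and> l \<noteq> 0 \<longrightarrow> Q (commutator (H l) (H k) - (if l = - k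
           then \<iota> (hcoeff l) * (\<iota> (1 / (vv - inverse vv)) * (zpow c ci (2 * l) - zpow c ci (- (2 * l)))) else 0))))"
proof -
  have v: "vv powi (- 2) = inverse (vv ^ 2)" by (simp add: power_int_minus)
  show ?thesis
    unfolding drinfeld_rels_def Let_def v EF_bracket_def hcoeff_def ball_Un ball_compr
    by (simp only: ball_simps simp_thms conj_assoc)
qed

lemma ball_ft_rels:
  "(\<forall>r\<in>ft_rels \<iota> x. Q r) \<longleftrightarrow>
   (let e = (\<lambda>l. x (Gen_e l)); f = (\<lambda>l. x (Gen_f l)); h = (\<lambda>n. x (Gen_h (Abs_nonzero_int n)));
        p = x Gen_phip; pinv = x Gen_phip_i; m = x Gen_phim; minv = x Gen_phim_i
    in Q (p * pinv - 1) \<and> Q (pinv * p - 1) \<and> Q (m * minv - 1) \<and> Q (minv * m - 1) \<and> Q (p * m - m * p)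
     \<and> (\<forall>k. Q (p * e k * pinv - \<iota> vv * e k)) \<and> (\<forall>k. Q (m * e k * minv - \<iota> (inverse vv) * e k))
     \<and> (\<forall>k. Q (p * f k * pinv - \<iota> (inverse vv) * f k)) \<and> (\<forall>k. Q (m * f k * minv - \<iota> vv * f k))
     \<and> (\<forall>n. n \<noteq> 0 \<longrightarrow> Q (p * h n * pinv - h n)) \<and> (\<forall>n. n \<noteq> 0 \<longrightarrow> Q (m * h n * minv - h n))
     \<and> (\<forall>k l. Q ((e (k + 1) * e l - \<iota> (vv ^ 2) * e l * e (k + 1)) - (\<iota> (vv ^ 2) * e k * e (l + 1) - e (l + 1) * e k)))
     \<and> (\<forall>k l. Q ((f (k + 1) * f l - \<iota> (inverse (vv ^ 2)) * f l * f (k + 1)) - (\<iota> (inverse (vv ^ 2)) * f k * f (l + 1) - f (l + 1) * f k)))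
     \<and> (\<forall>k l. Q (commutator (e k) (f l) - \<iota> (1 / (vv - inverse vv)) * (plus_mode \<iota> (p ^ 2) h (k + l) - minus_mode \<iota> (m ^ 2) h (k + l))))
     \<and> (\<forall>k l. l \<noteq> 0 \<longrightarrow> Q (commutator (h l) (e k) - \<iota> (hcoeff l) * e (k + l)))
     \<and> (\<forall>k l. l \<noteq> 0 \<longrightarrow> Q (commutator (h l) (f k) + \<iota> (hcoeff l) * f (k + l)))
     \<and> (\<forall>k l. k \<noteq> 0 \<and> l \<noteq> 0 \<longrightarrow> Q (commutator (h l) (h k))))"
proof -
  have v: "vv powi (- 2) = inverse (vv ^ 2)" by (simp add: power_int_minus)
  show ?thesis
    unfolding ft_rels_def Let_def v hcoeff_def ball_Un ball_compr
    by (simp only: ball_simps simp_thms conj_assoc)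
qed

lemma EF_bracket_hom:
  assumes "rhom h"
  shows "h (EF_bracket \<iota> c ci K Ki H k l) = EF_bracket (\<lambda>r. h (\<iota> r)) (h c) (h ci) (h K) (h Ki) (\<lambda>n. h (H n)) k l"
proof -
  interpret rhom h by fact
  show ?thesis by (rule EF_bracket_rel[where P = "\<lambda>x y. h x = y"]) (auto simp: homs)
qed

lemma drinfeld_rels_hom:
  assumes "rhom h"
  shows "(\<forall>r\<in>drinfeld_rels \<iota> x. Q (h r)) \<longleftrightarrow> (\<forall>r\<in>drinfeld_rels (\<lambda>a. h (\<iota> a)) (\<lambda>g. h (x g)). Q r)"
proof -
  interpret rhom h by fact
  show ?thesis
    unfolding ball_drinfeld_rels Let_def commutator_def
    by (simp only: homs EF_bracket_hom[OF assms] zpow_hom[OF assms] if_distrib[of h] cong: if_cong)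
qed

lemma ft_rels_hom:
  assumes "rhom h"
  shows "(\<forall>r\<in>ft_rels \<iota> x. Q (h r)) \<longleftrightarrow> (\<forall>r\<in>ft_rels (\<lambda>a. h (\<iota> a)) (\<lambda>g. h (x g)). Q r)"
proof -
  interpret rhom h by fact
  show ?thesis
    unfolding ball_ft_rels Let_def commutator_def
    by (simp only: homs mode_hom[OF assms])
qed

text \<open>The relations of the family, for elements of an arbitrary ring.\<close>

definition At_rels :: "(cv poly \<Rightarrow> 'a::ring_1) \<Rightarrow> (At_gen \<Rightarrow> 'a) \<Rightarrow> 'a set" where
  "At_rels \<iota> x = drinfeld_rels (\<lambda>a. \<iota> [:a:]) (\<lambda>g. x (Base g)) \<union>
     {x TildeC * x TildeCi - 1, x TildeCi * x TildeC - 1} \<union>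
     central_rels (x TildeC) \<union>
     {(x (Base GenC) - 1) - \<iota> [:0, 1:] * (x TildeC - 1)}"

lemma At_eq: "At = presented_algebra (At_rels scalar gen)"
  by (simp add: At_def At_rels_def)

lemma At_rels_hom:
  assumes "rhom h" "surj h"
  shows "(\<forall>r\<in>At_rels \<iota> x. Q (h r)) \<longleftrightarrow> (\<forall>r\<in>At_rels (\<lambda>a. h (\<iota> a)) (\<lambda>g. h (x g)). Q r)"
proof -
  interpret rhom h by fact
  have cr: "(\<forall>r\<in>central_rels z. P r) \<longleftrightarrow> (\<forall>y. P (z * y - y * z))" for z :: "'z::ring_1" and P
    unfolding central_rels_def commutator_def by blast
  have c: "(\<forall>r\<in>central_rels z. Q (h r)) \<longleftrightarrow> (\<forall>r\<in>central_rels (h z). Q r)" for z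
    unfolding cr homs
  proof (intro iffI allI)
    fix y assume a: "\<forall>y. Q (h z * h y - h y * h z)"
    obtain u where "y = h u" using assms(2) by (rule surjE)
    then show "Q (h z * y - y * h z)" using a by simp
  qed simp
  show ?thesis
    unfolding At_rels_def ball_Un drinfeld_rels_hom[OF assms(1)] c by (simp only: ball_simps homs)
qed

section \<open>The Fock-type module modulo the quadratic relations\<close>

definition fock_gen :: "(cv \<Rightarrow> 'r::comm_ring_1) \<Rightarrow> 'r \<Rightarrow> 'r \<Rightarrow> drinfeld_gen \<Rightarrow> (fock, 'r) endo" where
  "fock_gen j c ci g = (case g of GenE k \<Rightarrow> fock_rep.Eop j c ci k | GenF k \<Rightarrow> Fop k
     | GenH n \<Rightarrow> fock_rep.Hop j c ci (Rep_nonzero_int n) | GenS \<Rightarrow> fock_rep.Sop j | GenSi \<Rightarrow> fock_rep.Siop j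
     | GenK \<Rightarrow> fock_rep.Kop j ci | GenKi \<Rightarrow> fock_rep.Kiop j c | GenC \<Rightarrow> scal c | GenCi \<Rightarrow> scal ci)"

context fock_rep begin

definition Nzero :: "(fock, 'r) endo \<Rightarrow> bool" where "Nzero T \<longleftrightarrow> (\<forall>m. ap T m \<in> N)"

lemma Nzero_0: "T = 0 \<Longrightarrow> Nzero T" by (simp add: Nzero_def ap_simps N_zero)

lemma S_conj: "Sop * T = io r * T * Sop \<Longrightarrow> Sop * T * Siop - io r * T = 0"
  by (simp add: mult.assoc SSi)

lemma Abs_inv: "n \<noteq> 0 \<Longrightarrow> Rep_nonzero_int (Abs_nonzero_int n) = n"
  by (rule Abs_nonzero_int_inverse) simp

lemma bracket_eq: "EF_bracket io cop ciop Kop Kiop (\<lambda>n. Hop (Rep_nonzero_int (Abs_nonzero_int n))) k l = Gop k l"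
  by (rule EF_bracket_rel[where P = "(=)"]) (auto simp: Abs_inv)

lemma fock_drinfeld: "\<forall>r\<in>drinfeld_rels io (fock_gen j c ci). Nzero r"
  unfolding ball_drinfeld_rels Let_def fock_gen_def drinfeld_gen.case commutator_def bracket_eq
proof (intro conjI allI impI, goal_cases)
  case (8 k) show ?case by (rule Nzero_0) (rule S_conj[OF SE])
next
  case (9 k) show ?case by (rule Nzero_0) (rule S_conj[OF SF])
next
  case (10 n) then show ?case by (intro Nzero_0) (simp add: Abs_inv SH mult.assoc SSi)
next
  case (11 k l) show ?case using N_qE[of k l] by (simp add: Nzero_def qE_def)
next
  case (12 k l) show ?case using N_q[of k l] by (simp add: Nzero_def qF_def)
next
  case (13 k l) show ?case by (rule Nzero_0) (simp add: EF)
next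
  case (14 k l) then show ?case by (intro Nzero_0) (simp add: Abs_inv HE_cd)
next
  case (15 k l) then show ?case by (intro Nzero_0) (simp add: Abs_inv HF_cd)
next
  case (16 k l)
  then show ?case
    using HH[of l k] by (intro Nzero_0) (auto simp: Abs_inv kap_def scal_ring scal_mult)
qed (rule Nzero_0; simp add: SSi KK scal_mult cci cic scal_one)+

definition Nstable :: "(fock, 'r) endo \<Rightarrow> bool" where "Nstable T \<longleftrightarrow> (\<forall>x\<in>N. ap T x \<in> N)"

lemma Nstable_gen: "Nstable (fock_gen j c ci g)"
  using stable_H stable_S stable_K stable_scal
  by (cases g) (auto simp: fock_gen_def Nstable_def stable_def intro: N_E N_F)

lemma Nstable_scal: "Nstable (scal r)" using stable_scal by (simp add: Nstable_def stable_def)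

text \<open>The elements that map the whole module into \<open>N\<close> form a two-sided ideal because the operators preserve \<open>N\<close>.\<close>

lemma rel_ideal_annihilates:
  fixes \<iota>' :: "'s::comm_ring_1 \<Rightarrow> (fock, 'r) endo"
  assumes ch: "central_hom \<iota>'" and st: "\<And>r. Nstable (\<iota>' r)" "\<And>g. Nstable (x g)"
    and rels: "\<And>r. r \<in> rels \<Longrightarrow> Nzero (ev \<iota>' x r)" and f: "f \<in> rel_ideal rels"
  shows "Nzero (ev \<iota>' x f)"
proof -
  interpret ch: central_hom \<iota>' by fact
  have ns: "Nstable (ev \<iota>' x f)" for f
    by (induction f rule: free_alg_induct)
      (use st in \<open>auto simp: ch.ev_scalar ch.ev_gen ch.ev_add ch.ev_mult Nstable_def ap_simps N_add\<close>)
  have "two_sided {f. Nzero (ev \<iota>' x f)}"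
    using ns by unfold_locales (auto simp: Nzero_def Nstable_def ch.ev_add ch.ev_mult ap_simps N_add rhom.hom_zero[OF ch.rhom_ev] N_zero)
  then show ?thesis using rel_ideal_minimal[of "{f. Nzero (ev \<iota>' x f)}" rels] rels f by auto
qed

lemma lookup_vacuum:
  "Poly_Mapping.lookup (ap (Fop l) m) ([], u, \<mu>, i) = 0" "Poly_Mapping.lookup (ap (E0op l) m) (w, [], \<mu>, i) = 0"
proof -
  have "Poly_Mapping.lookup (ap (Fop l) m) ([], u, \<mu>, i) = 0 \<and> Poly_Mapping.lookup (ap (E0op l) m) (w, [], \<mu>, i) = 0"
  proof (induction m rule: poly_mapping_linear_induct)
    case (single b r)
    show ?case
    proof (cases b)
      case (fields w' u' \<mu>' i')
      show ?thesis unfolding fields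
        by (subst (1 2) single_eq_smul) (simp add: ap_smul ap_bv lookup_single when_def)
    qed
  qed (simp_all add: ap_zero ap_add lookup_add)
  then show "Poly_Mapping.lookup (ap (Fop l) m) ([], u, \<mu>, i) = 0" "Poly_Mapping.lookup (ap (E0op l) m) (w, [], \<mu>, i) = 0" by auto
qed

text \<open>The generators of \<open>N\<close> involve words of length at least two, so \<open>N\<close> does not contain the vacuum.\<close>

lemma N_vacuum: "x \<in> N \<Longrightarrow> Poly_Mapping.lookup x ([], [], \<mu>, i) = 0"
proof (induction rule: N.induct)
  case (N_base x)
  then show ?case
    by (induction rule: N0.induct) (simp_all add: lookup_add lookup_minus qE_def ap_simps lookup_vacuum)
qed (simp_all add: lookup_add lookup_minus qF_def ap_simps lookup_vacuum)

lemma Nzero_1: "\<not> Nzero 1"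
proof
  assume "Nzero 1"
  then have "bv [] [] {#} 0 \<in> N" by (simp add: Nzero_def ap_simps)
  from N_vacuum[OF this, of "{#}" 0] show False by simp
qed

text \<open>The presented algebra does not collapse, as it acts on the non-zero quotient by \<open>N\<close>.  This is what makes its
  type an instance of \<^class>\<open>ring_1\<close>, which includes \<open>0 \<noteq> 1\<close>.\<close>

lemma one_notin_rel_ideal:
  fixes \<iota>' :: "'s::comm_ring_1 \<Rightarrow> (fock, 'r) endo"
  assumes ch: "central_hom \<iota>'" and st: "\<And>r. Nstable (\<iota>' r)" "\<And>g. Nstable (x g)"
    and rels: "\<And>r. r \<in> rels \<Longrightarrow> Nzero (ev \<iota>' x r)"
  shows "0 - 1 \<notin> rel_ideal rels"
proof
  assume "0 - 1 \<in> rel_ideal rels"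
  then have "1 \<in> rel_ideal rels" using two_sided.J_minus[OF two_sided_rel_ideal] by force
  from rel_ideal_annihilates[OF assms this] show False
    using Nzero_1 rhom.hom_one[OF central_hom.rhom_ev[OF ch, of x]] by simp
qed

end

definition At_fock_gen :: "(cv \<Rightarrow> 'r::comm_ring_1) \<Rightarrow> 'r \<Rightarrow> 'r \<Rightarrow> 'r \<Rightarrow> 'r \<Rightarrow> At_gen \<Rightarrow> (fock, 'r) endo" where
  "At_fock_gen j c ci y yi g = (case g of Base b \<Rightarrow> fock_gen j c ci b | TildeC \<Rightarrow> scal y | TildeCi \<Rightarrow> scal yi)"

text \<open>The family acts through any specialization \<open>jt\<close> of its coefficients together with a choice of \<open>c\<close> and \<open>y\<close> that
  satisfies the last defining relation.\<close>

lemma fock_At: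
  fixes jt :: "cv poly \<Rightarrow> 'r::comm_ring_1"
  assumes jt: "rhom jt" and cci: "c * ci = 1" and y: "y * yi = 1" and c: "c - 1 = jt [:0, 1:] * (y - 1)"
  defines "j \<equiv> \<lambda>a. jt [:a:]"
  shows "fock_rep j c ci" "central_hom (\<lambda>p. scal (jt p) :: (fock, 'r) endo)"
    "fock_rep.Nstable j (At_fock_gen j c ci y yi g)"
    "\<And>r. r \<in> At_rels scalar gen \<Longrightarrow> fock_rep.Nzero j (ev (\<lambda>p. scal (jt p)) (At_fock_gen j c ci y yi) r)"
proof -
  interpret jt: rhom jt by fact
  interpret fr: fock_rep j c ci
    by unfold_locales (auto simp: j_def jt.hom_add[symmetric] jt.hom_mult[symmetric] cci pCons_one jt.hom_one mult.commute)
  show "fock_rep j c ci" ..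
  show ch: "central_hom (\<lambda>p. scal (jt p) :: (fock, 'r) endo)" by (rule central_hom_scal[OF jt])
  interpret ch: central_hom "\<lambda>p. scal (jt p) :: (fock, 'r) endo" by (rule ch)
  show "fock_rep.Nstable j (At_fock_gen j c ci y yi g)"
    by (cases g) (auto simp: At_fock_gen_def fr.Nstable_gen fr.Nstable_scal)
  let ?e = "ev (\<lambda>p. scal (jt p)) (At_fock_gen j c ci y yi)"
  have yi: "yi * y = 1" using y by (simp add: mult.commute)
  have "\<forall>r\<in>drinfeld_rels (\<lambda>a. scalar [:a:]) (\<lambda>g. gen (Base g)). fr.Nzero (?e r)"
    using fr.fock_drinfeld
    unfolding drinfeld_rels_hom[OF ch.rhom_ev] by (simp add: ch.ev_scalar ch.ev_gen At_fock_gen_def j_def)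
  moreover have "\<forall>r\<in>central_rels (gen TildeC). fr.Nzero (?e r)"
    unfolding central_rels_def commutator_def
    by (auto intro!: fr.Nzero_0 simp: rhom.homs[OF ch.rhom_ev] ch.ev_gen At_fock_gen_def cent_comm[OF cent_scal])
  moreover have "fr.Nzero (?e (gen TildeC * gen TildeCi - 1))" "fr.Nzero (?e (gen TildeCi * gen TildeC - 1))"
    by (auto intro!: fr.Nzero_0 simp: rhom.homs[OF ch.rhom_ev] ch.ev_gen At_fock_gen_def scal_mult y yi scal_one)
  moreover have "fr.Nzero (?e ((gen (Base GenC) - 1) - scalar [:0, 1:] * (gen TildeC - 1)))"
  proof (rule fr.Nzero_0)
    have "?e ((gen (Base GenC) - 1) - scalar [:0, 1:] * (gen TildeC - 1)) = scal ((c - 1) - jt [:0, 1:] * (y - 1))"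
      by (simp add: rhom.homs[OF ch.rhom_ev] ch.ev_gen ch.ev_scalar At_fock_gen_def fock_gen_def
         scal_one[symmetric] scal_ring scal_mult)
    then show "?e ((gen (Base GenC) - 1) - scalar [:0, 1:] * (gen TildeC - 1)) = 0"
      by (simp add: c) (auto intro!: endo_eqI simp: ap_simps smul_simps)
  qed
  ultimately show "fr.Nzero (?e r)" if "r \<in> At_rels scalar gen" for r
    using that unfolding At_rels_def by auto
qed

section \<open>The family as a type\<close>

quotient_type at_alg = "(At_gen, cv poly) free_alg" / "\<lambda>x y. x - y \<in> rel_ideal (At_rels scalar gen)"
  by (rule two_sided.J_equivp) (rule two_sided_rel_ideal)

instantiation at_alg :: ring_1
begin
interpretation two_sided "rel_ideal (At_rels scalar gen)" by (rule two_sided_rel_ideal)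
lift_definition zero_at_alg :: at_alg is 0 .
lift_definition one_at_alg :: at_alg is 1 .
lift_definition plus_at_alg :: "at_alg \<Rightarrow> at_alg \<Rightarrow> at_alg" is "(+)" by (rule J_cong_add)
lift_definition minus_at_alg :: "at_alg \<Rightarrow> at_alg \<Rightarrow> at_alg" is "(-)" by (rule J_cong_diff)
lift_definition uminus_at_alg :: "at_alg \<Rightarrow> at_alg" is "uminus" by (rule J_cong_minus)
lift_definition times_at_alg :: "at_alg \<Rightarrow> at_alg \<Rightarrow> at_alg" is "(*)" by (rule J_cong_mult)
instance
proof
  have ev: "rhom (\<lambda>p::cv poly. coeff p 0)" by unfold_locales (simp_all add: mult_poly_0_left coeff_mult)
  show "(0::at_alg) \<noteq> 1"
    by transfer
      (rule fock_rep.one_notin_rel_ideal[OF fock_At(1,2)[OF ev, of 1 1 1 1] _ fock_At(3,4)[OF ev, of 1 1 1 1]];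
       simp add: fock_rep.Nstable_scal[OF fock_At(1)[OF ev, of 1 1 1 1, simplified]])
qed (transfer; simp add: algebra_simps J_zero)+
end

lemma rhom_at: "rhom abs_at_alg"
  by unfold_locales (transfer; simp add: two_sided.J_zero[OF two_sided_rel_ideal])+
lemma surj_at: "surj abs_at_alg"
  by (metis surjI Quotient_abs_rep[OF Quotient_at_alg])
lemma at_eq_0_iff: "abs_at_alg f = 0 \<longleftrightarrow> f \<in> rel_ideal (At_rels scalar gen)"
  by (transfer) simp

section \<open>From formal monomials to an algebra\<close>

lemma cent_inverse:
  assumes "cent a" "a * b = 1" "b * a = 1" shows "cent b"
  unfolding cent_def
proof
  fix z
  have "b * (a * z) * b = b * (z * a) * b" using assms(1) by (simp add: cent_def)
  then have "(b * a) * z * b = b * z * (a * b)" by (simp only: mult.assoc)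
  then show "b * z = z * b" by (simp add: assms)
qed

text \<open>Moving \<open>f n\<close> to its place in an increasing product: it commutes with all factors except \<open>f (-n)\<close>, and those
  lie to the left of its place only if \<open>n > 0\<close>.\<close>

lemma sorted_insort_product:
  fixes f :: "int \<Rightarrow> 'a::ring_1" and kap :: "int \<Rightarrow> 'a"
  assumes comm: "\<And>k. f n * f k = f k * f n + (if n = - k then kap n else 0)" and kap: "cent (kap n)"
    and n: "n \<noteq> 0"
  shows "sorted xs \<Longrightarrow> f n * prod_list (map f xs) = prod_list (map f (insort n xs))
    + (if n > 0 then of_nat (count (mset xs) (- n)) * kap n * prod_list (map f (remove1 (- n) xs)) else 0)"
proof (induction xs)
  case (Cons k xs)
  let ?P = "\<lambda>xs. prod_list (map f xs)"
  show ?case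
  proof (cases "n \<le> k")
    case True
    have "n > 0 \<Longrightarrow> - n \<notin># mset (k # xs)" using True Cons.prems by auto
    then have "n > 0 \<Longrightarrow> count (mset (k # xs)) (- n) = 0" by (simp only: not_in_iff)
    then have "(if n > 0 then of_nat (count (mset (k # xs)) (- n)) * kap n * ?P (remove1 (- n) (k # xs)) else 0) = 0"
      by (cases "n > 0") (simp_all only: of_nat_0 mult_zero_left if_True if_False simp_thms)
    then show ?thesis using True by (simp only: insort_key.simps) simp
  next
    case False
    have s: "sorted xs" using Cons.prems by simp
    have cl: "of_nat a * kap n * (f k * u) = f k * (of_nat a * kap n * u)" for a u
      by (rule cent_left[symmetric]) (intro cent_mult cent_of_nat kap)
    have "f n * ?P (k # xs) = f k * (f n * ?P xs) + (if n = - k then kap n else 0) * ?P xs"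
      by (simp add: mult.assoc[symmetric] comm) (simp add: distrib_right mult.assoc)
    also have "\<dots> = ?P (insort n (k # xs)) + ((if n > 0 then of_nat (count (mset xs) (- n)) * kap n * (f k * ?P (remove1 (- n) xs)) else 0)
        + (if n = - k then kap n else 0) * ?P xs)"
      unfolding Cons.IH[OF s] using False by (auto simp: distrib_left cl)
    also have "(if n > 0 then of_nat (count (mset xs) (- n)) * kap n * (f k * ?P (remove1 (- n) xs)) else 0) + (if n = - k then kap n else 0) * ?P xs
      = (if n > 0 then of_nat (count (mset (k # xs)) (- n)) * kap n * ?P (remove1 (- n) (k # xs)) else 0)"
    proof (cases "n = - k")
      case True
      then have k: "k = - n" and pos: "n > 0" using False n by auto
      have "of_nat (count (mset xs) (- n)) * kap n * (f k * ?P (remove1 (- n) xs)) = of_nat (count (mset xs) (- n)) * kap n * ?P xs"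
      proof (cases "k \<in> set xs")
        case True
        then obtain z zs where xs: "xs = z # zs" by (cases xs) auto
        then have "z = k" using Cons.prems True by force
        then show ?thesis by (simp add: xs k)
      next
        case False
        then have "count (mset xs) (- n) = 0" using k by (simp add: count_eq_zero_iff)
        then show ?thesis by (simp only: of_nat_0 mult_zero_left)
      qed
      then show ?thesis using pos by (simp add: k distrib_right)
    next
      case False
      then have "k \<noteq> - n" by auto
      then show ?thesis using False by simp
    qed
    finally show ?thesis .
  qed
qed simp

lemma sorted_list_of_multiset_remove: "sorted_list_of_multiset (M - {#x#}) = remove1 x (sorted_list_of_multiset M)"
proof -
  have "sorted_list_of_multiset (M - {#x#}) = sorted_list_of_multiset (mset (remove1 x (sorted_list_of_multiset M)))"
    by simp
  also have "\<dots> = sort (remove1 x (sorted_list_of_multiset M))" by (rule sorted_list_of_multiset_mset)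
  also have "\<dots> = remove1 x (sorted_list_of_multiset M)"
    by (intro sorted_sort_id sorted_remove1) (rule sorted_sorted_list_of_multiset)
  finally show ?thesis .
qed

text \<open>An algebra that satisfies the relations and whose scalars extend to the coefficient ring of the module.\<close>

locale fock_symbol = fock_rep j c ci + th: central_hom \<theta>
  for j :: "cv \<Rightarrow> 'r::comm_ring_1" and c ci and \<theta> :: "'r \<Rightarrow> 'a::ring_1" +
  fixes x :: "drinfeld_gen \<Rightarrow> 'a"
  assumes rels: "\<forall>r\<in>drinfeld_rels (\<lambda>a. \<theta> (j a)) x. r = 0"
    and th_c: "\<theta> c = x GenC" "\<theta> ci = x GenCi"
begin

abbreviation "E k \<equiv> x (GenE k)"
abbreviation "F k \<equiv> x (GenF k)"
abbreviation "H k \<equiv> x (GenH (Abs_nonzero_int k))"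
abbreviation "S \<equiv> x GenS"
abbreviation "Si \<equiv> x GenSi"
abbreviation "K \<equiv> x GenK"
abbreviation "Ki \<equiv> x GenKi"

lemmas R = rels[unfolded ball_drinfeld_rels Let_def commutator_def right_minus_eq]

lemma inv: "S * Si = 1" "Si * S = 1" "K * Ki = 1" "Ki * K = 1" "S * S = K * x GenC"
  using R by auto

lemma SE: "S * E k = \<theta> (j vv) * (E k * S)" and SF: "S * F k = \<theta> (j (inverse vv)) * (F k * S)"
  and SH: "n \<noteq> 0 \<Longrightarrow> S * H n = H n * S"
proof -
  have "S * E k * Si * S = \<theta> (j vv) * E k * S" using R by simp
  then show "S * E k = \<theta> (j vv) * (E k * S)" by (simp add: mult.assoc inv)
  have "S * F k * Si * S = \<theta> (j (inverse vv)) * F k * S" using R by simp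
  then show "S * F k = \<theta> (j (inverse vv)) * (F k * S)" by (simp add: mult.assoc inv)
  assume "n \<noteq> 0"
  then have "S * H n * Si * S = H n * S" using R by simp
  then show "S * H n = H n * S" by (simp add: mult.assoc inv)
qed

lemma th_zpow: "\<theta> (zpow c ci k) = zpow (x GenC) (x GenCi) k"
  by (simp add: zpow_hom[OF th.rhom_axioms] th_c)

lemma HE_sym: "n \<noteq> 0 \<Longrightarrow> H n * E k = E k * H n + \<theta> (hE n) * E (k + n)"
  and HF_sym: "n \<noteq> 0 \<Longrightarrow> H n * F k = F k * H n - \<theta> (hF n) * F (k + n)"
proof -
  assume n: "n \<noteq> 0"
  have "H n * E k - E k * H n = \<theta> (j (hcoeff n)) * zpow (x GenC) (x GenCi) (- \<bar>n\<bar>) * E (k + n)" using R n by blast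
  then show "H n * E k = E k * H n + \<theta> (hE n) * E (k + n)"
    by (simp add: hE_def th.hom_mult th_zpow diff_eq_eq add.commute)
  have "H n * F k - F k * H n + \<theta> (j (hcoeff n)) * zpow (x GenC) (x GenCi) \<bar>n\<bar> * F (k + n) = 0" using R n by blast
  then show "H n * F k = F k * H n - \<theta> (hF n) * F (k + n)"
    by (simp add: hF_def th.hom_mult th_zpow add_eq_0_iff algebra_simps)
qed

text \<open>There is no generator \<open>H\<^sub>0\<close>; the value \<open>0\<close> makes the commutation relations hold for all indices \<open>k\<close>.\<close>

definition H' :: "int \<Rightarrow> 'a" where "H' n = (if n = 0 then 0 else H n)"

lemma H'_comm:
  assumes "n \<noteq> 0" shows "H' n * H' k = H' k * H' n + (if n = - k then \<theta> (kap n) else 0)"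
proof (cases "k = 0")
  case False
  have "H n * H k - H k * H n = (if n = - k
           then \<theta> (j (hcoeff n)) * (\<theta> (j (1 / (vv - inverse vv))) * (zpow (x GenC) (x GenCi) (2 * n) - zpow (x GenC) (x GenCi) (- (2 * n)))) else 0)"
    using R assms False by blast
  then show ?thesis using assms False
    by (auto simp: H'_def kap_def th.hom_mult th.hom_diff th_zpow diff_eq_eq add.commute)
qed (use assms in \<open>auto simp: H'_def\<close>)

definition HP :: "int multiset \<Rightarrow> 'a" where "HP \<mu> = prod_list (map H' (sorted_list_of_multiset \<mu>))"

lemma H_HP:
  assumes "n \<noteq> 0"
  shows "H n * HP \<mu> = HP (add_mset n \<mu>) + (if n > 0 then \<theta> (of_nat (count \<mu> (- n)) * kap n) * HP (\<mu> - {#- n#}) else 0)"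
proof -
  have h: "H n = H' n" using assms by (simp add: H'_def)
  show ?thesis
    unfolding h HP_def
    using sorted_insort_product[of H' n "\<lambda>n. \<theta> (kap n)" "sorted_list_of_multiset \<mu>", OF H'_comm[OF assms] th.cent_iota assms sorted_sorted_list_of_multiset]
    by (simp add: sorted_list_of_multiset_remove th.hom_mult th.of_nat_hom)
qed

definition mono :: "int list \<Rightarrow> int list \<Rightarrow> int multiset \<Rightarrow> int \<Rightarrow> 'a"
  where "mono w u \<mu> i = prod_list (map F w) * (prod_list (map E u) * (HP \<mu> * zpow S Si i))"

definition \<sigma> :: "(fock \<Rightarrow>\<^sub>0 'r) \<Rightarrow> 'a"
  where "\<sigma> = lin_ext (\<lambda>(w, u, \<mu>, i) r. \<theta> r * mono w u \<mu> i)"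

lemma \<sigma>_zero: "\<sigma> 0 = 0" by (simp add: \<sigma>_def)
lemma \<sigma>_add: "\<sigma> (m + n) = \<sigma> m + \<sigma> n"
  unfolding \<sigma>_def by (rule lin_ext_add) (auto simp: th.homs distrib_right)
lemma \<sigma>_single: "\<sigma> (Poly_Mapping.single (w, u, \<mu>, i) r) = \<theta> r * mono w u \<mu> i"
  by (simp add: \<sigma>_def th.homs)
lemma \<sigma>_bv: "\<sigma> (bv w u \<mu> i) = mono w u \<mu> i" by (simp add: \<sigma>_single th.hom_one)
lemma \<sigma>_smul: "\<sigma> (smul r m) = \<theta> r * \<sigma> m"
proof (induction m rule: poly_mapping_linear_induct)
  case (single b s) then show ?case by (cases b) (simp add: smul_single \<sigma>_single th.hom_mult mult.assoc)
qed (simp_all add: \<sigma>_zero \<sigma>_add smul_simps distrib_left)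
lemma \<sigma>_diff: "\<sigma> (m - n) = \<sigma> m - \<sigma> n"
  using \<sigma>_add[of "m - n" n] by (simp add: algebra_simps)
lemma \<sigma>_uminus: "\<sigma> (- m) = - \<sigma> m"
  using \<sigma>_diff[of 0 m] by (simp add: \<sigma>_zero)

lemma \<sigma>_ap:
  assumes "\<And>w u \<mu> i. \<sigma> (ap T (bv w u \<mu> i)) = a * mono w u \<mu> i"
  shows "\<sigma> (ap T m) = a * \<sigma> m"
proof (induction m rule: poly_mapping_linear_induct)
  case (single b r)
  obtain w u \<mu> i where b: "b = (w, u, \<mu>, i)" by (cases b)
  show ?case unfolding b
    by (subst single_eq_smul) (simp add: ap_smul \<sigma>_smul assms \<sigma>_single cent_left[OF th.cent_iota])
qed (simp_all add: ap_zero \<sigma>_zero ap_add \<sigma>_add distrib_left)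

lemma \<sigma>_F: "\<sigma> (ap (Fop l) m) = F l * \<sigma> m"
  by (rule \<sigma>_ap) (simp add: ap_bv \<sigma>_bv mono_def mult.assoc)

lemma \<sigma>_E0: "b \<in> based \<Longrightarrow> \<sigma> (ap (E0op k) b) = E k * \<sigma> b"
  by (induction rule: based_induct)
    (simp_all add: ap_zero \<sigma>_zero ap_add \<sigma>_add distrib_left ap_smul \<sigma>_smul ap_bv \<sigma>_bv mono_def mult.assoc cent_left[OF th.cent_iota])

lemma \<sigma>_H: assumes n: "n \<noteq> 0" shows "\<sigma> (ap (Hop n) m) = H n * \<sigma> m"
proof (rule \<sigma>_ap)
  fix w u \<mu> i
  have base: "\<sigma> (hfun n [] u \<mu> i) = H n * mono [] u \<mu> i"
  proof (induction u)
    case Nil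
    have "\<sigma> (if P then smul r m else 0) = (if P then \<theta> r * \<sigma> m else 0)" for P r m by (simp add: \<sigma>_smul \<sigma>_zero)
    then show ?case
      by (simp add: \<sigma>_add \<sigma>_bv mono_def mult.assoc[symmetric] H_HP[OF n]) (simp add: distrib_right mult.assoc)
  next
    case (Cons k u)
    have "hfun n [] u \<mu> i \<in> based" using based_H[of "bv [] u \<mu> i" n] based_bv[of 1 u \<mu> i] by (simp add: ap_Hop smul_simps)
    then have "\<sigma> (hfun n [] (k # u) \<mu> i) = (E k * H n + \<theta> (hE n) * E (k + n)) * mono [] u \<mu> i"
      by (simp add: \<sigma>_add \<sigma>_smul \<sigma>_E0 Cons \<sigma>_bv distrib_right mult.assoc) (simp add: mono_def mult.assoc)
    then show ?case unfolding HE_sym[OF n, symmetric] by (simp add: mono_def mult.assoc)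
  qed
  show "\<sigma> (ap (Hop n) (bv w u \<mu> i)) = H n * mono w u \<mu> i"
    unfolding ap_Hop
  proof (induction w)
    case (Cons l w)
    have "\<sigma> (hfun n (l # w) u \<mu> i) = (F l * H n - \<theta> (hF n) * F (l + n)) * mono w u \<mu> i"
      by (simp add: \<sigma>_diff \<sigma>_smul \<sigma>_F Cons \<sigma>_bv left_diff_distrib mult.assoc) (simp add: mono_def mult.assoc)
    then show ?case unfolding HF_sym[OF n, symmetric] by (simp add: mono_def mult.assoc)
  qed (rule base)
qed

lemma \<sigma>_S: "\<sigma> (ap Sop m) = S * \<sigma> m"
proof (rule \<sigma>_ap)
  fix w u \<mu> i
  have p: "vv powi (- 1 - a) = inverse vv * vv powi (- a)" "vv powi (1 + a) = vv * vv powi a" for a :: int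
    by (simp_all add: power_int_add power_int_diff field_simps power_int_minus)
  have pa: "vv powi (b - a) = vv powi (- a) * vv powi b" for a b :: int
    by (simp add: power_int_add[symmetric])
  have w: "S * (prod_list (map F w) * z) = \<theta> (j (vv powi (- int (length w)))) * (prod_list (map F w) * (S * z))" for z
  proof (induction w)
    case (Cons l w)
    have "S * (F l * u) = \<theta> (j (inverse vv)) * (F l * (S * u))" for u by (simp only: mult.assoc[symmetric] SF)
    then show ?case by (simp add: mult.assoc Cons p hom_mult th.hom_mult cent_left[OF th.cent_iota, where x = "F _"])
  qed (simp add: hom_one th.hom_one)
  have u: "S * (prod_list (map E u) * z) = \<theta> (j (vv powi (int (length u)))) * (prod_list (map E u) * (S * z))" for z
  proof (induction u)
    case (Cons l u)
    have "S * (E l * t) = \<theta> (j vv) * (E l * (S * t))" for t by (simp only: mult.assoc[symmetric] SE)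
    then show ?case by (simp add: mult.assoc Cons p hom_mult th.hom_mult cent_left[OF th.cent_iota, where x = "E _"])
  qed (simp add: hom_one th.hom_one)
  have SH': "S * H' n = H' n * S" for n by (simp add: H'_def SH)
  have "S * prod_list (map H' ns) = prod_list (map H' ns) * S" for ns
  proof (induction ns)
    case (Cons n ns)
    have "S * (H' n * prod_list (map H' ns)) = H' n * (S * prod_list (map H' ns))" by (simp only: mult.assoc[symmetric] SH')
    then show ?case by (simp add: Cons mult.assoc)
  qed simp
  then have h: "S * (HP \<mu> * zpow S Si i) = HP \<mu> * zpow S Si (i + 1)"
    by (simp add: HP_def zpow_Suc inv mult.assoc[symmetric])
  have "j (vv powi (int (length u) - int (length w))) = j (vv powi (- int (length w))) * j (vv powi int (length u))"
    by (simp only: hom_mult[symmetric] pa)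
  then show "\<sigma> (ap Sop (bv w u \<mu> i)) = S * mono w u \<mu> i"
    by (simp add: ap_Sop \<sigma>_smul \<sigma>_bv mono_def w u h th.hom_mult cent_left[OF th.cent_iota, where x = "prod_list _"] mult.assoc)
qed

lemma \<sigma>_Si: "\<sigma> (ap Siop m) = Si * \<sigma> m"
proof -
  have "\<sigma> (ap Siop m) = Si * (S * \<sigma> (ap Siop m))" by (simp add: mult.assoc[symmetric] inv)
  also have "S * \<sigma> (ap Siop m) = \<sigma> (ap (Sop * Siop) m)" by (simp add: \<sigma>_S ap_simps)
  finally show ?thesis by (simp add: SSi ap_simps)
qed

text \<open>\<open>\<sigma>\<close> turns the operator \<open>T\<close> into left multiplication by \<open>a\<close>.\<close>

definition sym :: "(fock, 'r) endo \<Rightarrow> 'a \<Rightarrow> bool" where "sym T a \<longleftrightarrow> (\<forall>m. \<sigma> (ap T m) = a * \<sigma> m)"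

lemma sym_ops: "sym T a \<Longrightarrow> sym U b \<Longrightarrow> sym (T + U) (a + b)" "sym T a \<Longrightarrow> sym U b \<Longrightarrow> sym (T * U) (a * b)"
  "sym T a \<Longrightarrow> sym (- T) (- a)" "sym (scal r) (\<theta> r)" "sym 0 0" "sym 1 1"
  by (simp_all add: sym_def ap_simps \<sigma>_add \<sigma>_smul \<sigma>_uminus \<sigma>_zero distrib_right mult.assoc)

lemma th_cent: "cent (x GenC)" "cent (x GenCi)"
  using th.cent_iota[of c] th.cent_iota[of ci] by (simp_all add: th_c)

lemma cc: "x GenC * x GenCi = 1" using th.hom_mult[of c ci] cci by (simp add: th_c th.hom_one)

lemma sym_K: "sym Kop K" "sym Kiop Ki"
proof -
  have "K = S * S * x GenCi" by (simp add: inv mult.assoc cc)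
  then show "sym Kop K" unfolding Kop_def using \<sigma>_S sym_ops(2,4) th_c(2) by (metis sym_def)
  have "S * (S * Ki) = x GenC"
    by (simp add: mult.assoc[symmetric] inv(5) cent_comm[OF th_cent(1), of K]) (simp add: mult.assoc inv)
  moreover have "Si * (S * t) = t" for t by (simp add: mult.assoc[symmetric] inv)
  ultimately have "Ki = Si * Si * x GenC" by (metis mult.assoc)
  then show "sym Kiop Ki" unfolding Kiop_def using \<sigma>_Si sym_ops(2,4) th_c(1) by (metis sym_def)
qed

lemma sym_H: "n \<noteq> 0 \<Longrightarrow> sym (Hop n) (H n)" by (simp add: sym_def \<sigma>_H)

lemma sym_G: "sym (Gop k l) (EF_bracket (\<lambda>a. \<theta> (j a)) (x GenC) (x GenCi) K Ki (\<lambda>n. H n) k l)"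
  by (rule EF_bracket_rel[where P = sym])
    (use sym_ops(4)[of c] sym_ops(4)[of ci] in \<open>auto intro: sym_ops sym_K sym_H simp: th_c\<close>)

lemma EF_sym: "E k * F l = F l * E k + EF_bracket (\<lambda>a. \<theta> (j a)) (x GenC) (x GenCi) K Ki (\<lambda>n. H n) k l"
proof -
  have "E k * F l - F l * E k = EF_bracket (\<lambda>a. \<theta> (j a)) (x GenC) (x GenCi) K Ki (\<lambda>n. H n) k l" using R by blast
  then show ?thesis by (simp add: diff_eq_eq add.commute)
qed

lemma \<sigma>_E: "\<sigma> (ap (Eop k) m) = E k * \<sigma> m"
proof (rule \<sigma>_ap)
  fix w u \<mu> i show "\<sigma> (ap (Eop k) (bv w u \<mu> i)) = E k * mono w u \<mu> i"
    unfolding ap_Eop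
  proof (induction w)
    case Nil then show ?case by (simp add: \<sigma>_bv mono_def mult.assoc)
  next
    case (Cons l w)
    have "\<sigma> (efun k (l # w) u \<mu> i) = (F l * E k + EF_bracket (\<lambda>a. \<theta> (j a)) (x GenC) (x GenCi) K Ki (\<lambda>n. H n) k l) * mono w u \<mu> i"
      using sym_G by (simp add: \<sigma>_add \<sigma>_F Cons distrib_right sym_def \<sigma>_bv mult.assoc)
    then show ?case unfolding EF_sym[symmetric] by (simp add: mono_def mult.assoc)
  qed
qed

lemma sym_gen: "sym (fock_gen j c ci g) (x g)"
proof (cases g)
  case (GenH n)
  have "Rep_nonzero_int n \<noteq> 0" using Rep_nonzero_int[of n] by simp
  then show ?thesis using \<sigma>_H[of "Rep_nonzero_int n"] by (simp add: GenH fock_gen_def sym_def Rep_nonzero_int_inverse)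
qed (use sym_K sym_ops(4)[of c] sym_ops(4)[of ci] in \<open>auto simp: fock_gen_def sym_def \<sigma>_E \<sigma>_F \<sigma>_S \<sigma>_Si th_c\<close>)

lemma \<sigma>_N0: "m \<in> N0 \<Longrightarrow> \<sigma> m = 0"
proof (induction rule: N0.induct)
  case (N0_q b k l)
  have "\<sigma> (ap (qE E0op k l) b) = ((E (k + 1) * E l - \<theta> (j (vv ^ 2)) * E l * E (k + 1)) - (\<theta> (j (vv ^ 2)) * E k * E (l + 1) - E (l + 1) * E k)) * \<sigma> b"
    using N0_q by (simp add: qE_def ap_simps \<sigma>_diff \<sigma>_smul \<sigma>_E0 based_E0 left_diff_distrib mult.assoc)
  also have "(E (k + 1) * E l - \<theta> (j (vv ^ 2)) * E l * E (k + 1)) - (\<theta> (j (vv ^ 2)) * E k * E (l + 1) - E (l + 1) * E k) = 0"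
    using R by simp
  finally show ?case by simp
next
  case (N0_E m k) then show ?case by (simp add: \<sigma>_E0[OF N0_based])
qed (auto simp: \<sigma>_zero \<sigma>_add)

text \<open>\<open>N\<close> is generated by the quadratic relations, which hold in the algebra.\<close>

lemma \<sigma>_N: "m \<in> N \<Longrightarrow> \<sigma> m = 0"
proof (induction rule: N.induct)
  case (N_q k l m)
  have "\<sigma> (ap (qF k l) m) = ((F (k + 1) * F l - \<theta> (j (inverse (vv ^ 2))) * F l * F (k + 1)) - (\<theta> (j (inverse (vv ^ 2))) * F k * F (l + 1) - F (l + 1) * F k)) * \<sigma> m"
    by (simp add: qF_def ap_simps \<sigma>_diff \<sigma>_smul \<sigma>_F left_diff_distrib mult.assoc)
  also have "(F (k + 1) * F l - \<theta> (j (inverse (vv ^ 2))) * F l * F (k + 1)) - (\<theta> (j (inverse (vv ^ 2))) * F k * F (l + 1) - F (l + 1) * F k) = 0"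
    using R by simp
  finally show ?case by simp
qed (auto simp: \<sigma>_N0 \<sigma>_add \<sigma>_F)

lemma \<sigma>_vacuum: "\<sigma> (bv [] [] {#} 0) = 1"
  by (simp add: \<sigma>_bv mono_def HP_def)

end

section \<open>The coefficient ring\<close>

type_synonym laurent = "int \<Rightarrow>\<^sub>0 cv poly"

text \<open>The element \<open>c = 1 + t (y - 1)\<close> of \<open>\<complex>(v)[t][y, y\<^sup>-\<^sup>1]\<close>.\<close>

definition C_laurent :: laurent
  where "C_laurent = 1 + Poly_Mapping.single 0 [:0, 1:] * (Poly_Mapping.single 1 1 - 1)"

lemma C_laurent_neq_0: "C_laurent \<noteq> 0"
proof
  assume "C_laurent = 0"
  moreover have "Poly_Mapping.lookup C_laurent 1 = [:0, 1:]"
    by (simp add: C_laurent_def lookup_add lookup_one right_diff_distrib lookup_minus mult_single lookup_single when_def)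
  ultimately show False by simp
qed

text \<open>The localization at \<open>c\<close>, inside the field of fractions.  It maps to the centre of the family, with \<open>y\<close> and \<open>c\<close>
  going to the generators of that name, and it is an integral domain, which provides the regular elements
  for \<open>N_saturated\<close>.\<close>

definition coeff_set :: "laurent fract set"
  where "coeff_set = {Fraction_Field.Fract p (C_laurent ^ n) | p n. True}"

lemma coeff_set_add: "a \<in> coeff_set \<Longrightarrow> b \<in> coeff_set \<Longrightarrow> a + b \<in> coeff_set"
  and coeff_set_mult: "a \<in> coeff_set \<Longrightarrow> b \<in> coeff_set \<Longrightarrow> a * b \<in> coeff_set"
proof -
  assume "a \<in> coeff_set" "b \<in> coeff_set"
  then obtain p n q m where ab: "a = Fraction_Field.Fract p (C_laurent ^ n)" "b = Fraction_Field.Fract q (C_laurent ^ m)"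
    unfolding coeff_set_def by auto
  have "a + b = Fraction_Field.Fract (p * C_laurent ^ m + q * C_laurent ^ n) (C_laurent ^ (n + m))"
    "a * b = Fraction_Field.Fract (p * q) (C_laurent ^ (n + m))"
    using C_laurent_neq_0 by (simp_all add: ab power_add)
  then show "a + b \<in> coeff_set" "a * b \<in> coeff_set" unfolding coeff_set_def by blast+
qed

lemma coeff_set_const: "Fraction_Field.Fract p 1 \<in> coeff_set"
  unfolding coeff_set_def by (intro CollectI exI[of _ p] exI[of _ "0::nat"]) simp

lemma coeff_set_zero: "0 \<in> coeff_set" and coeff_set_one: "1 \<in> coeff_set"
  unfolding Zero_fract_def One_fract_def by (rule coeff_set_const)+

lemma coeff_set_uminus: "a \<in> coeff_set \<Longrightarrow> - a \<in> coeff_set"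
proof -
  assume "a \<in> coeff_set"
  then obtain p n where "a = Fraction_Field.Fract p (C_laurent ^ n)" unfolding coeff_set_def by auto
  then have "- a = Fraction_Field.Fract (- p) (C_laurent ^ n)" by simp
  then show "- a \<in> coeff_set" unfolding coeff_set_def by blast
qed

lemma coeff_set_diff: "a \<in> coeff_set \<Longrightarrow> b \<in> coeff_set \<Longrightarrow> a - b \<in> coeff_set"
  using coeff_set_add[of a "- b"] coeff_set_uminus[of b] by simp

typedef coeff_ring = coeff_set using coeff_set_zero by blast

setup_lifting type_definition_coeff_ring

instantiation coeff_ring :: comm_ring_1
begin
lift_definition zero_coeff_ring :: coeff_ring is 0 by (rule coeff_set_zero)
lift_definition one_coeff_ring :: coeff_ring is 1 by (rule coeff_set_one)
lift_definition plus_coeff_ring :: "coeff_ring \<Rightarrow> coeff_ring \<Rightarrow> coeff_ring" is "(+)" by (rule coeff_set_add)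
lift_definition uminus_coeff_ring :: "coeff_ring \<Rightarrow> coeff_ring" is "uminus" by (rule coeff_set_uminus)
lift_definition minus_coeff_ring :: "coeff_ring \<Rightarrow> coeff_ring \<Rightarrow> coeff_ring" is "(-)" by (rule coeff_set_diff)
lift_definition times_coeff_ring :: "coeff_ring \<Rightarrow> coeff_ring \<Rightarrow> coeff_ring" is "(*)" by (rule coeff_set_mult)
instance by standard (transfer; simp add: algebra_simps)+
end

lift_definition cfrac :: "laurent \<Rightarrow> nat \<Rightarrow> coeff_ring" is "\<lambda>p n. Fraction_Field.Fract p (C_laurent ^ n)"
  unfolding coeff_set_def by blast

lemma cfrac_cases: obtains p n where "r = cfrac p n"
  by (transfer fixing: thesis) (auto simp: coeff_set_def)

lemma cfrac_eq: "cfrac p n = cfrac q m \<longleftrightarrow> p * C_laurent ^ m = q * C_laurent ^ n"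
  using C_laurent_neq_0 by transfer (simp add: eq_fract)
lemma cfrac_ops: "cfrac p n + cfrac q m = cfrac (p * C_laurent ^ m + q * C_laurent ^ n) (n + m)"
  "cfrac p n * cfrac q m = cfrac (p * q) (n + m)" "1 = cfrac 1 0" "0 = cfrac 0 0"
proof -
  note rep = Rep_coeff_ring_inject[symmetric] cfrac.rep_eq plus_coeff_ring.rep_eq times_coeff_ring.rep_eq one_coeff_ring.rep_eq zero_coeff_ring.rep_eq
  show "cfrac p n + cfrac q m = cfrac (p * C_laurent ^ m + q * C_laurent ^ n) (n + m)"
    using C_laurent_neq_0 unfolding rep by (simp add: power_add)
  show "cfrac p n * cfrac q m = cfrac (p * q) (n + m)" unfolding rep power_add by (rule mult_fract)
  show "1 = cfrac 1 0" unfolding rep power_0 by (rule One_fract_def)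
  show "0 = cfrac 0 0" unfolding rep power_0 by (rule Zero_fract_def)
qed

lemma coeff_ring_zero_divisors: "cfrac p 0 * s = 0 \<Longrightarrow> p \<noteq> 0 \<Longrightarrow> s = 0"
  by (rule cfrac_cases[of s]) (simp add: cfrac_ops(2,4) cfrac_eq)

definition coeff_of_poly :: "cv poly \<Rightarrow> coeff_ring" where "coeff_of_poly p = cfrac (Poly_Mapping.single 0 p) 0"

lemma rhom_coeff_of_poly: "rhom coeff_of_poly"
  by unfold_locales (simp_all add: coeff_of_poly_def cfrac_ops cfrac_eq single_add mult_single)

section \<open>The family has no torsion\<close>

definition atg :: "At_gen \<Rightarrow> at_alg" where "atg g = abs_at_alg (gen g)"
definition ats :: "cv poly \<Rightarrow> at_alg" where "ats p = abs_at_alg (scalar p)"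

text \<open>The rings \<open>\<A>\<^sub>t\<close>, \<open>\<A>\<^sub>t/(t)\<close> and \<open>\<A>\<^sub>t/(t - 1)\<close> are treated simultaneously.\<close>

locale At_quotient = rhom h for h :: "(At_gen, cv poly) free_alg \<Rightarrow> 'a::ring_1" +
  assumes surj: "surj h" and kills: "\<And>r. r \<in> At_rels scalar gen \<Longrightarrow> h r = 0"
begin

lemma central_hom_scalars: "central_hom (\<lambda>p. h (scalar p))"
proof
  show "h (scalar a) * z = z * h (scalar a)" for a z
  proof -
    obtain f where "z = h f" using surj by (rule surjE)
    then show ?thesis by (simp add: hom_mult[symmetric] scalar.central)
  qed
qed (simp_all add: homs scalar.homs)

lemma relations:
  "h (gen TildeC) * h (gen TildeCi) = 1" "h (gen TildeCi) * h (gen TildeC) = 1"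
  "cent (h (gen TildeC))" "cent (h (gen TildeCi))"
  "h (gen (Base GenC)) = 1 + h (scalar [:0, 1:]) * (h (gen TildeC) - 1)"
  "cent (h (gen (Base GenC)))" "cent (h (gen (Base GenCi)))"
  "h (gen (Base GenC)) * h (gen (Base GenCi)) = 1" "h (gen (Base GenCi)) * h (gen (Base GenC)) = 1"
  "\<forall>r\<in>drinfeld_rels (\<lambda>a. h (scalar [:a:])) (\<lambda>g. h (gen (Base g))). r = 0"
proof -
  interpret sc: central_hom "\<lambda>p. h (scalar p)" by (rule central_hom_scalars)
  have "\<forall>r\<in>At_rels scalar gen. h r = 0" using kills by blast
  note R = this[unfolded At_rels_hom[OF rhom_axioms surj, where Q = "\<lambda>r. r = 0"], unfolded At_rels_def ball_Un]
  note R1 = R[THEN conjunct1, THEN conjunct1, THEN conjunct1] and R2 = R[THEN conjunct1, THEN conjunct1, THEN conjunct2]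
    and R3 = R[THEN conjunct1, THEN conjunct2] and R4 = R[THEN conjunct2]
  show y: "h (gen TildeC) * h (gen TildeCi) = 1" "h (gen TildeCi) * h (gen TildeC) = 1" using R2 by simp_all
  have "h (gen TildeC) * z - z * h (gen TildeC) = 0" for z
    by (rule R3[rule_format]) (auto simp: central_rels_def commutator_def)
  then show cy: "cent (h (gen TildeC))" by (simp add: cent_def)
  show "cent (h (gen TildeCi))" by (rule cent_inverse[OF cy y])
  show c: "h (gen (Base GenC)) = 1 + h (scalar [:0, 1:]) * (h (gen TildeC) - 1)" using R4 by (simp add: diff_eq_eq)
  show cc: "cent (h (gen (Base GenC)))" unfolding c by (intro cent_add cent_one cent_mult cent_diff cy sc.cent_iota)
  show d: "\<forall>r\<in>drinfeld_rels (\<lambda>a. h (scalar [:a:])) (\<lambda>g. h (gen (Base g))). r = 0" by (rule R1)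
  show e: "h (gen (Base GenC)) * h (gen (Base GenCi)) = 1" "h (gen (Base GenCi)) * h (gen (Base GenC)) = 1"
    using d unfolding ball_drinfeld_rels Let_def by simp_all
  show "cent (h (gen (Base GenCi)))" by (rule cent_inverse[OF cc e])
qed

end

interpretation at: At_quotient abs_at_alg
proof -
  interpret rhom abs_at_alg by (rule rhom_at)
  show "At_quotient abs_at_alg"
    using rel_ideal_superset by unfold_locales (auto simp: surj_at at_eq_0_iff)
qed

lemmas at_rel = at.relations[folded ats_def atg_def]

interpretation ats: central_hom ats
  using at.central_hom_scalars by (simp add: ats_def[abs_def])

definition evL :: "laurent \<Rightarrow> at_alg"
  where "evL = lin_ext (\<lambda>n r. ats r * zpow (atg TildeC) (atg TildeCi) n)"

lemma evL_single: "evL (Poly_Mapping.single n r) = ats r * zpow (atg TildeC) (atg TildeCi) n"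
  by (simp add: evL_def ats.homs)
lemma evL_add: "evL (f + g) = evL f + evL g"
  unfolding evL_def by (rule lin_ext_add) (simp_all add: ats.homs distrib_right)
lemma evL_cent: "cent (evL f)"
proof (induction f rule: poly_mapping_linear_induct)
  case zero then show ?case by (simp add: evL_def cent_def)
next
  case (single k v) show ?case unfolding evL_single by (intro cent_mult ats.cent_iota cent_zpow at_rel)
qed (simp add: evL_add cent_add)

lemma evL_mult: "evL (f * g) = evL f * evL g"
proof (induction f rule: poly_mapping_linear_induct)
  case zero then show ?case by (simp add: evL_def)
next
  case (add f f') then show ?case by (simp add: evL_add distrib_right)
next
  case (single n r)
  show ?case
  proof (induction g rule: poly_mapping_linear_induct)
    case zero then show ?case by (simp add: evL_def)
  next
    case (add f f') then show ?case by (simp add: evL_add distrib_left)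
  next
    case (single n' r')
    show ?case by (simp add: evL_single mult_single ats.hom_mult zpow_add[OF at_rel(1,2)] mult.assoc cent_left[OF ats.cent_iota, where x = "zpow _ _ _"])
  qed
qed

lemma rhom_evL: "rhom evL"
proof
  have "evL (Poly_Mapping.single 0 1) = 1" by (simp only: evL_single ats.hom_one zpow_0 mult_1_left)
  then show "evL 1 = 1" by simp
qed (simp_all add: evL_add evL_mult)

lemma evL_C_laurent: "evL C_laurent = atg (Base GenC)"
  by (simp only: C_laurent_def rhom.homs[OF rhom_evL] evL_single at_rel(5) ats.hom_one zpow_0 zpow_1 mult_1_left mult_1_right)

text \<open>The value does not depend on the fraction since the image of \<open>c\<close> is invertible.\<close>

definition coeff_to_at :: "coeff_ring \<Rightarrow> at_alg"
  where "coeff_to_at r = (SOME a. \<exists>p n. r = cfrac p n \<and> a = evL p * atg (Base GenCi) ^ n)"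

lemma C_pow: "atg (Base GenC) ^ n * atg (Base GenCi) ^ n = 1"
proof (induction n)
  case (Suc n)
  have "atg (Base GenC) ^ Suc n * atg (Base GenCi) ^ Suc n
      = atg (Base GenC) * (atg (Base GenC) ^ n * atg (Base GenCi) ^ n) * atg (Base GenCi)"
    by (simp add: mult.assoc power_commutes)
  then show ?case using Suc at_rel(8) by simp
qed simp

lemma coeff_to_at_cfrac: "coeff_to_at (cfrac p n) = evL p * atg (Base GenCi) ^ n"
proof -
  have "a = evL p * atg (Base GenCi) ^ n" if a: "\<exists>q m. cfrac p n = cfrac q m \<and> a = evL q * atg (Base GenCi) ^ m" for a
  proof -
    obtain q m where q: "p * C_laurent ^ m = q * C_laurent ^ n" "a = evL q * atg (Base GenCi) ^ m"
      using a unfolding cfrac_eq by blast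
    let ?C = "atg (Base GenC)" and ?D = "atg (Base GenCi)"
    have "evL p * ?C ^ m = evL q * ?C ^ n"
      using arg_cong[OF q(1), of evL] by (simp add: rhom.homs[OF rhom_evL] evL_C_laurent)
    then have "evL p * ?C ^ m * (?D ^ m * ?D ^ n) = evL q * ?C ^ n * (?D ^ n * ?D ^ m)"
      by (simp add: power_add[symmetric] add.commute)
    then have "evL p * (?C ^ m * ?D ^ m) * ?D ^ n = evL q * (?C ^ n * ?D ^ n) * ?D ^ m"
      by (simp only: mult.assoc)
    then show ?thesis by (simp add: q(2) C_pow)
  qed
  note uniq = this
  show ?thesis unfolding coeff_to_at_def
  proof (rule some_equality)
    show "\<exists>q m. cfrac p n = cfrac q m \<and> evL p * atg (Base GenCi) ^ n = evL q * atg (Base GenCi) ^ m"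
      by (intro exI[of _ p] exI[of _ n] conjI refl)
  qed (rule uniq)
qed

lemma central_hom_coeff_to_at: "central_hom coeff_to_at"
proof
  fix r s :: coeff_ring and z :: at_alg
  obtain p n where r: "r = cfrac p n" by (rule cfrac_cases)
  obtain q m where s: "s = cfrac q m" by (rule cfrac_cases)
  let ?C = "atg (Base GenC)" and ?D = "atg (Base GenCi)"
  have D: "cent (?D ^ k)" for k by (intro cent_power at_rel)
  have 1: "?C ^ m * (?D ^ n * ?D ^ m) = ?D ^ n" by (simp add: cent_left[OF D, where x = "?C ^ m"] C_pow)
  have 2: "?C ^ n * (?D ^ n * ?D ^ m) = ?D ^ m" by (simp add: mult.assoc[symmetric] C_pow)
  have "evL (p * C_laurent ^ m + q * C_laurent ^ n) * ?D ^ (n + m) = evL p * ?D ^ n + evL q * ?D ^ m"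
    by (simp add: rhom.homs[OF rhom_evL] evL_C_laurent power_add distrib_right mult.assoc 1 2)
  then show "coeff_to_at (r + s) = coeff_to_at r + coeff_to_at s" by (simp add: r s cfrac_ops coeff_to_at_cfrac)
  show "coeff_to_at (r * s) = coeff_to_at r * coeff_to_at s"
    by (simp add: r s cfrac_ops coeff_to_at_cfrac rhom.homs[OF rhom_evL] power_add mult.assoc cent_left[OF D, where x = "evL q"])
  show "coeff_to_at r * z = z * coeff_to_at r"
    unfolding r coeff_to_at_cfrac by (rule cent_comm[symmetric]) (intro cent_mult evL_cent D)
  show "coeff_to_at 1 = 1" by (simp add: cfrac_ops(3) coeff_to_at_cfrac rhom.homs[OF rhom_evL])
qed

lemma coeff_to_at_coeff_of_poly: "coeff_to_at (coeff_of_poly p) = ats p" by (simp add: coeff_of_poly_def coeff_to_at_cfrac evL_single)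

abbreviation "cc \<equiv> cfrac C_laurent 0"
abbreviation "cci \<equiv> cfrac 1 1"
abbreviation "cy \<equiv> cfrac (Poly_Mapping.single 1 1) 0"
abbreviation "cyi \<equiv> cfrac (Poly_Mapping.single (- 1) 1) 0"

lemma coeff_ring_rels: "cc * cci = 1" "cy * cyi = 1" "cc - 1 = coeff_of_poly [:0, 1:] * (cy - 1)"
proof -
  show "cc * cci = 1" "cy * cyi = 1" by (simp_all add: cfrac_ops cfrac_eq mult_single)
  have "cc = cfrac 1 0 + coeff_of_poly [:0, 1:] * (cy - cfrac 1 0)"
    by (simp add: coeff_of_poly_def right_diff_distrib cfrac_ops(1,2) C_laurent_def algebra_simps)
  then show "cc - 1 = coeff_of_poly [:0, 1:] * (cy - 1)" by (simp add: cfrac_ops(3))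
qed

text \<open>If \<open>p a = 0\<close> and \<open>a\<close> is represented by \<open>f\<close>, then \<open>p f\<close> sends the vacuum into \<open>N\<close>, so \<open>f\<close> does as well by saturation;
  \<open>\<sigma>\<close> maps the image of the vacuum under \<open>f\<close> to \<open>a\<close> and kills \<open>N\<close>.\<close>

lemma at_torsion_free:
  assumes "ats p * a = 0" "p \<noteq> 0" shows "a = 0"
proof -
  note fa = fock_At[OF rhom_coeff_of_poly coeff_ring_rels]
  interpret fr: fock_rep "\<lambda>a. coeff_of_poly [:a:]" cc cci by (rule fa(1))
  interpret th: central_hom coeff_to_at by (rule central_hom_coeff_to_at)
  interpret fs: fock_symbol "\<lambda>a. coeff_of_poly [:a:]" cc cci coeff_to_at "\<lambda>g. atg (Base g)"
    by unfold_locales (use at_rel(10) in \<open>simp_all add: coeff_to_at_coeff_of_poly coeff_to_at_cfrac evL_C_laurent rhom.homs[OF rhom_evL]\<close>)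
  interpret ch: central_hom "\<lambda>p. scal (coeff_of_poly p) :: (fock, coeff_ring) endo" by (rule fa(2))
  let ?x = "At_fock_gen (\<lambda>a. coeff_of_poly [:a:]) cc cci cy cyi"
  let ?e = "ev (\<lambda>p. scal (coeff_of_poly p)) ?x"
  let ?v = "bv [] [] {#} 0 :: fock \<Rightarrow>\<^sub>0 coeff_ring"
  have sym: "fs.sym (?e f) (abs_at_alg f)" for f
  proof (induction f rule: free_alg_induct)
    case (scalar r)
    show ?case using fs.sym_ops(4)[of "coeff_of_poly r"] by (simp add: ch.ev_scalar coeff_to_at_coeff_of_poly ats_def)
  next
    case (gen g)
    have "coeff_to_at cy = atg TildeC" "coeff_to_at cyi = atg TildeCi"
      by (simp_all add: coeff_to_at_cfrac evL_single zpow_1 zpow_m1 ats.hom_one)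
    then show ?case using fs.sym_gen fs.sym_ops(4)[of cy] fs.sym_ops(4)[of cyi]
      by (cases g) (simp_all add: ch.ev_gen At_fock_gen_def atg_def)
  qed (simp_all add: ch.ev_add ch.ev_mult rhom.homs[OF rhom_at] fs.sym_ops)
  obtain f where a: "a = abs_at_alg f" using surj_at by (rule surjE)
  have "abs_at_alg (scalar p * f) = 0" using assms(1) by (simp add: a ats_def rhom.homs[OF rhom_at])
  then have "scalar p * f \<in> rel_ideal (At_rels scalar gen)" by (simp add: at_eq_0_iff)
  then have "fr.Nzero (?e (scalar p * f))"
    by (rule fr.rel_ideal_annihilates[OF fa(2) _ fa(3,4), rotated 2]) (rule fr.Nstable_scal)
  then have "smul (coeff_of_poly p) (ap (?e f) ?v) \<in> fr.N"
    by (simp add: fr.Nzero_def ch.ev_mult ch.ev_scalar ap_simps)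
  then have "ap (?e f) ?v \<in> fr.N"
  proof (rule fr.N_saturated[rotated])
    have "Poly_Mapping.single 0 p \<noteq> (0 :: laurent)" using assms(2) by (metis lookup_single_eq lookup_zero)
    then show "s = 0" if "coeff_of_poly p * s = 0" for s
      using coeff_ring_zero_divisors that by (simp add: coeff_of_poly_def)
  qed
  then have "fs.\<sigma> (ap (?e f) ?v) = 0" by (rule fs.\<sigma>_N)
  moreover have "fs.\<sigma> (ap (?e f) ?v) = a" using sym[of f] by (simp add: fs.sym_def fs.\<sigma>_vacuum a)
  ultimately show "a = 0" by simp
qed

section \<open>Finitely generated torsion-free modules are free\<close>

text \<open>The measure on the coefficients of a linear relation that a Euclidean division reduces.\<close>

definition rel_size :: "'r::euclidean_ring \<Rightarrow> nat"
  where "rel_size r = (if r = 0 then 0 else Suc (euclidean_size r))"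

text \<open>Induction on the number of generators.  A linear relation among them is simplified by Euclidean division of
  its coefficients, with a corresponding change of generators, until a single coefficient is left; as there is no
  torsion, its generator is zero and can be omitted.\<close>

lemma torsion_free_fg_basis:
  fixes sc :: "'r::euclidean_ring \<Rightarrow> 'm::ab_group_add \<Rightarrow> 'm" and g :: "nat \<Rightarrow> 'm"
  assumes "Modules.module sc" and tf: "\<And>r x. sc r x = 0 \<Longrightarrow> r = 0 \<or> x = 0" and fin: "finite I"
  shows "\<exists>B. finite B \<and> \<not> module.dependent sc B \<and> g ` I \<subseteq> module.span sc B"
proof -
  interpret M: Modules.module sc by fact
  show ?thesis using fin
  proof (induction "card I" arbitrary: I g)
    case 0
    then have "I = {}" by simp
    then show ?case by (intro exI[of _ "{}"]) (auto simp: M.independent_empty)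
  next
    case (Suc n)
    note IH = Suc.hyps(1)
    have card: "card I = Suc n" and fin: "finite I" using Suc by auto
    have relation: "\<exists>B. finite B \<and> M.independent B \<and> g ` I \<subseteq> M.span B"
      if "(\<Sum>i\<in>I. sc (r i) (g i)) = 0" "\<exists>i\<in>I. r i \<noteq> 0" for g r
      using that
    proof (induction "\<Sum>i\<in>I. rel_size (r i)" arbitrary: g r rule: less_induct)
      case less
      obtain i where i: "i \<in> I" "r i \<noteq> 0" using less.prems(2) by blast
      show ?case
      proof (cases "\<exists>j\<in>I. j \<noteq> i \<and> r j \<noteq> 0")
        case False
        then have "(\<Sum>k\<in>I. sc (r k) (g k)) = (\<Sum>k\<in>{i}. sc (r k) (g k))"
          using i fin by (intro sum.mono_neutral_right) auto
        then have "g i = 0" using less.prems(1) i tf by auto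
        moreover obtain B where "finite B" "M.independent B" "g ` (I - {i}) \<subseteq> M.span B"
          using IH[of "I - {i}" g] card fin i by auto
        ultimately show ?thesis using M.span_zero[of B] by (intro exI[of _ B]) (auto simp: image_subset_iff)
      next
        case True
        then obtain j where j: "j \<in> I" "j \<noteq> i" "r j \<noteq> 0" by blast
        have wlog: "\<exists>B. finite B \<and> M.independent B \<and> g ` I \<subseteq> M.span B"
          if ij: "i \<in> I" "j \<in> I" "i \<noteq> j" "r i \<noteq> 0" "r j \<noteq> 0" "euclidean_size (r i) \<le> euclidean_size (r j)" for i j
        proof -
          define q where "q = r j div r i"
          \<comment> \<open>\<open>r\<^sub>i g\<^sub>i + r\<^sub>j g\<^sub>j = r\<^sub>i (g\<^sub>i + q g\<^sub>j) + (r\<^sub>j mod r\<^sub>i) g\<^sub>j\<close>\<close>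
          define g' where "g' = g(i := g i + sc q (g j))"
          define r' where "r' = r(j := r j mod r i)"
          let ?J = "I - {i} - {j}"
          have I: "I = insert i (insert j ?J)" using ij by auto
          have split: "sum f I = f i + (f j + sum f ?J)" for f :: "nat \<Rightarrow> 'z::comm_monoid_add"
          proof -
            have "sum f I = f i + sum f (I - {i})" using fin ij by (simp add: sum.remove)
            also have "sum f (I - {i}) = f j + sum f ?J" using fin ij by (subst sum.remove[of _ j]) auto
            finally show ?thesis .
          qed
          have eq1: "sc (r i) (g i + sc q (g j)) + (sc (r j mod r i) (g j) + s) = sc (r i) (g i) + (sc (r j) (g j) + s)" for s
          proof -
            have "r j = r i * q + r j mod r i" by (simp add: q_def)
            then have "sc (r j) (g j) = sc (r i * q) (g j) + sc (r j mod r i) (g j)" by (metis M.scale_left_distrib)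
            then show ?thesis by (simp add: M.scale_right_distrib add_ac)
          qed
          have eq2: "(\<Sum>k\<in>?J. sc (r' k) (g' k)) = (\<Sum>k\<in>?J. sc (r k) (g k))"
            by (intro sum.cong) (auto simp: r'_def g'_def)
          have r'_i: "r' i = r i" "r' j = r j mod r i" and g'_i: "g' i = g i + sc q (g j)" "g' j = g j"
            using ij by (auto simp: r'_def g'_def)
          have "(\<Sum>k\<in>I. sc (r' k) (g' k)) = sc (r i) (g i + sc q (g j)) + (sc (r j mod r i) (g j) + (\<Sum>k\<in>?J. sc (r k) (g k)))"
            unfolding split[of "\<lambda>k. sc (r' k) (g' k)"] r'_i g'_i eq2 by (rule refl)
          also have "\<dots> = (\<Sum>k\<in>I. sc (r k) (g k))"
            unfolding split[of "\<lambda>k. sc (r k) (g k)"] by (rule eq1)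
          finally have 0: "(\<Sum>k\<in>I. sc (r' k) (g' k)) = 0" using less.prems(1) by simp
          have "rel_size (r j mod r i) < rel_size (r j)"
            using ij mod_size_less[of "r i" "r j"] by (auto simp: rel_size_def)
          moreover have "(\<Sum>k\<in>?J. rel_size (r' k)) = (\<Sum>k\<in>?J. rel_size (r k))"
            by (intro sum.cong) (auto simp: r'_def)
          ultimately have less': "(\<Sum>k\<in>I. rel_size (r' k)) < (\<Sum>k\<in>I. rel_size (r k))"
            using ij unfolding split by (simp add: r'_def)
          have "\<exists>k\<in>I. r' k \<noteq> 0" using ij by (auto simp: r'_def)
          from less.hyps[OF less' 0 this] obtain B where B: "finite B" "M.independent B" "g' ` I \<subseteq> M.span B" by blast
          have "g k \<in> M.span B" if "k \<in> I" for k
          proof (cases "k = i")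
            case True
            have "g' i - sc q (g' j) \<in> M.span B" using B(3) ij by (intro M.span_diff M.span_scale) auto
            then show ?thesis using ij True by (simp add: g'_def)
          next
            case False
            then have "g k = g' k" by (simp add: g'_def)
            then show ?thesis using B(3) that by auto
          qed
          then show ?thesis using B by blast
        qed
        show ?thesis
        proof (cases "euclidean_size (r i) \<le> euclidean_size (r j)")
          case True then show ?thesis using wlog[of i j] i j by blast
        next
          case False then show ?thesis using wlog[of j i] i j by force
        qed
      qed
    qed
    show ?case
    proof (cases "\<exists>r. (\<Sum>i\<in>I. sc (r i) (g i)) = 0 \<and> (\<exists>i\<in>I. r i \<noteq> 0)")
      case True then show ?thesis using relation by blast
    next
      case False
      have inj: "inj_on g I"
      proof (rule inj_onI, rule ccontr)
        fix i j assume ij: "i \<in> I" "j \<in> I" "g i = g j" "i \<noteq> j"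
        define r where "r k = (if k = i then 1 else if k = j then -1 else 0 :: 'r)" for k
        have "(\<Sum>k\<in>I. sc (r k) (g k)) = (\<Sum>k\<in>{i,j}. sc (r k) (g k))"
          using ij fin by (intro sum.mono_neutral_right) (auto simp: r_def)
        also have "\<dots> = 0" using ij by (simp add: r_def)
        finally have "(\<Sum>k\<in>I. sc (r k) (g k)) = 0" .
        moreover have "r i \<noteq> 0" by (simp add: r_def)
        ultimately show False using False ij(1) by blast
      qed
      have "M.independent (g ` I)"
      proof
        assume "M.dependent (g ` I)"
        then obtain u v where u: "(\<Sum>v\<in>g ` I. sc (u v) v) = 0" "v \<in> g ` I" "u v \<noteq> 0"
          using M.dependent_finite[OF finite_imageI[OF fin]] by auto
        have "(\<Sum>i\<in>I. sc (u (g i)) (g i)) = 0" using u(1) by (simp add: sum.reindex[OF inj] o_def)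
        moreover obtain i where "i \<in> I" "v = g i" using u(2) by blast
        ultimately show False using False u(3) by (auto dest: spec[of _ "\<lambda>i. u (g i)"])
      qed
      then show ?thesis using fin M.span_superset[of "g ` I"] by (intro exI[of _ "g ` I"]) simp
    qed
  qed
qed

section \<open>Torsion-free modules over a Euclidean ring are flat\<close>

text \<open>A module whose carrier is parametrized by a type, which gives access to spans and bases.\<close>

locale typed_module =
  fixes sc :: "'r::euclidean_ring \<Rightarrow> 'm::ab_group_add \<Rightarrow> 'm" and M :: "('r, 'c, 'z) module_scheme" and d :: "'m \<Rightarrow> 'c"
  assumes mod_sc: "Modules.module sc"
    and carrier_M: "carrier M = range d" and inj_d: "inj d"
    and add_d: "d x \<oplus>\<^bsub>M\<^esub> d y = d (x + y)" and zero_d: "\<zero>\<^bsub>M\<^esub> = d 0" and smult_d: "r \<odot>\<^bsub>M\<^esub> d x = d (sc r x)"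
begin

sublocale sc: Modules.module sc by (rule mod_sc)

abbreviation R :: "'r ring" where "R \<equiv> ring_of_type_algebra"

lemma R_simps: "carrier R = UNIV" "x \<oplus>\<^bsub>R\<^esub> y = x + y" "x \<otimes>\<^bsub>R\<^esub> y = x * y" "\<one>\<^bsub>R\<^esub> = 1"
  by (simp_all add: ring_of_type_algebra_def)

lemma module_M: "Module.module R M"
proof (rule moduleI)
  show "abelian_group M"
  proof (rule abelian_groupI)
    fix x assume "x \<in> carrier M"
    then obtain m where "x = d m" using carrier_M by auto
    then have "d (- m) \<in> carrier M" "d (- m) \<oplus>\<^bsub>M\<^esub> x = \<zero>\<^bsub>M\<^esub>" by (auto simp: carrier_M add_d zero_d)
    then show "\<exists>y\<in>carrier M. y \<oplus>\<^bsub>M\<^esub> x = \<zero>\<^bsub>M\<^esub>" by blast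
  qed (auto simp: carrier_M add_d zero_d add_ac)
qed (auto simp: R_simps carrier_M add_d smult_d sc.scale_right_distrib sc.scale_left_distrib intro: cring_from_type_algebra)

lemma mem_carrier: "d x \<in> carrier M" by (simp add: carrier_M)

context
  fixes N :: "('r, 'n) module"
  assumes N: "Module.module R N"
begin

interpretation N: Module.module R N by (rule N)

abbreviation "FA \<equiv> free_Abelian_group (carrier M \<times> carrier N)"
abbreviation "TK \<equiv> tensor_kernel R M N"

lemma FA_diff: "x \<in> carrier FA \<Longrightarrow> y \<in> carrier FA \<Longrightarrow> x - y \<in> carrier FA"
  using keys_diff[of x y] by auto
lemma FA_frag: "y \<in> carrier N \<Longrightarrow> frag_of (d m, y) \<in> carrier FA"
  by (simp add: mem_carrier)

lemma tensor_rels_cases: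
  assumes "z \<in> tensor_rels R M N"
  obtains m m' y where "y \<in> carrier N" "z = frag_of (d (m + m'), y) - frag_of (d m, y) - frag_of (d m', y)"
    | m y y' where "y \<in> carrier N" "y' \<in> carrier N" "z = frag_of (d m, y \<oplus>\<^bsub>N\<^esub> y') - frag_of (d m, y) - frag_of (d m, y')"
    | r m y where "y \<in> carrier N" "z = frag_of (d (sc r m), y) - frag_of (d m, r \<odot>\<^bsub>N\<^esub> y)"
  using assms unfolding tensor_rels_def carrier_M by (auto simp: add_d smult_d)

lemma tensor_rels_carrier: "tensor_rels R M N \<subseteq> carrier FA"
proof
  fix z assume "z \<in> tensor_rels R M N"
  then show "z \<in> carrier FA"
    by (cases rule: tensor_rels_cases) (auto intro!: FA_diff FA_frag simp: R_simps simp del: carrier_free_Abelian_group_iff)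
qed

lemma subgroup_TK: "subgroup TK FA"
  unfolding tensor_kernel_def by (intro group.generate_is_subgroup tensor_rels_carrier) simp

lemma TK_zero: "0 \<in> TK" using subgroup.one_closed[OF subgroup_TK] by simp
lemma TK_add: "x \<in> TK \<Longrightarrow> y \<in> TK \<Longrightarrow> x + y \<in> TK" using subgroup.m_closed[OF subgroup_TK] by simp
lemma TK_carrier: "x \<in> TK \<Longrightarrow> x \<in> carrier FA"
  by (rule subsetD[OF subgroup.subset[OF subgroup_TK]])
lemma TK_minus: "x \<in> TK \<Longrightarrow> - x \<in> TK"
  using subgroup.m_inv_closed[OF subgroup_TK, of x] TK_carrier[of x] by simp
lemma TK_diff: "x \<in> TK \<Longrightarrow> y \<in> TK \<Longrightarrow> x - y \<in> TK"
  using TK_add[of x "- y"] TK_minus by simp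

lemma TK_rels: "x \<in> tensor_rels R M N \<Longrightarrow> x \<in> TK"
  unfolding tensor_kernel_def by (rule generate.incl)

lemma TK_left: "y \<in> carrier N \<Longrightarrow> frag_of (d (m + m'), y) - frag_of (d m, y) - frag_of (d m', y) \<in> TK"
  unfolding add_d[symmetric] by (rule TK_rels) (unfold tensor_rels_def, use mem_carrier in blast)
lemma TK_right: "y \<in> carrier N \<Longrightarrow> y' \<in> carrier N \<Longrightarrow> frag_of (d m, y \<oplus>\<^bsub>N\<^esub> y') - frag_of (d m, y) - frag_of (d m, y') \<in> TK"
  by (rule TK_rels) (unfold tensor_rels_def, use mem_carrier in blast)
lemma TK_scale: "y \<in> carrier N \<Longrightarrow> frag_of (d (sc r m), y) - frag_of (d m, r \<odot>\<^bsub>N\<^esub> y) \<in> TK"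
  unfolding smult_d[symmetric] by (rule TK_rels) (unfold tensor_rels_def R_simps, use mem_carrier in blast)

lemma TK_left_zero: "y \<in> carrier N \<Longrightarrow> frag_of (d 0, y) \<in> TK"
  using TK_minus[OF TK_left[of y 0 0]] by simp
lemma TK_right_zero: "frag_of (d m, \<zero>\<^bsub>N\<^esub>) \<in> TK"
  using TK_minus[OF TK_right[of "\<zero>\<^bsub>N\<^esub>" "\<zero>\<^bsub>N\<^esub>" m]] by simp

lemma TK_sum: "finite B \<Longrightarrow> y \<in> carrier N \<Longrightarrow> frag_of (d (sum f B), y) - (\<Sum>b\<in>B. frag_of (d (f b), y)) \<in> TK"
proof (induction B rule: finite_induct)
  case empty then show ?case by (simp add: TK_left_zero)
next
  case (insert b B)
  then show ?case using TK_add[OF TK_left[of y "f b" "sum f B"] insert.IH] by (simp add: algebra_simps)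
qed

text \<open>Functionals are required to be linear on a submodule only: the coordinates with respect to a basis of a submodule need
  not extend to linear functionals on the whole module.\<close>

definition linear_on :: "('m \<Rightarrow> 'r) \<Rightarrow> 'm set \<Rightarrow> bool"
  where "linear_on \<phi> V \<longleftrightarrow> (\<forall>x\<in>V. \<forall>y\<in>V. \<phi> (x + y) = \<phi> x + \<phi> y) \<and> (\<forall>r. \<forall>x\<in>V. \<phi> (sc r x) = r * \<phi> x)"

text \<open>The map \<open>\<phi> \<otimes> id\<close> with values in \<open>N\<close>, defined on the free abelian group for every function \<open>\<phi>\<close>.  It
  factors through the tensor product when \<open>\<phi>\<close> is linear.\<close>

definition contraction :: "('m \<Rightarrow> 'r) \<Rightarrow> ('c \<times> 'n \<Rightarrow>\<^sub>0 int) \<Rightarrow> 'n"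
  where "contraction \<phi> = (SOME h. h \<in> hom FA (add_monoid N) \<and> (\<forall>m. \<forall>y\<in>carrier N. h (frag_of (d m, y)) = \<phi> m \<odot>\<^bsub>N\<^esub> y))"

lemma contraction:
  "contraction \<phi> \<in> hom FA (add_monoid N)"
  "y \<in> carrier N \<Longrightarrow> contraction \<phi> (frag_of (d m, y)) = \<phi> m \<odot>\<^bsub>N\<^esub> y"
proof -
  have "(\<lambda>(x, y). \<phi> (inv_into UNIV d x) \<odot>\<^bsub>N\<^esub> y) ` (carrier M \<times> carrier N) \<subseteq> carrier (add_monoid N)"
    by (auto simp: R_simps)
  from comm_group.free_Abelian_group_universal[OF N.a_comm_group this] obtain h
    where "h \<in> hom FA (add_monoid N)" "\<And>p. p \<in> carrier M \<times> carrier N \<Longrightarrow> h (frag_of p) = (\<lambda>(x, y). \<phi> (inv_into UNIV d x) \<odot>\<^bsub>N\<^esub> y) p" by blast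
  then have "\<exists>h. h \<in> hom FA (add_monoid N) \<and> (\<forall>m. \<forall>y\<in>carrier N. h (frag_of (d m, y)) = \<phi> m \<odot>\<^bsub>N\<^esub> y)"
    by (intro exI[of _ h]) (auto simp: mem_carrier inv_into_f_f[OF inj_d])
  from someI_ex[OF this] show "contraction \<phi> \<in> hom FA (add_monoid N)"
    "y \<in> carrier N \<Longrightarrow> contraction \<phi> (frag_of (d m, y)) = \<phi> m \<odot>\<^bsub>N\<^esub> y"
    unfolding contraction_def by auto
qed

lemma contraction_add: "x \<in> carrier FA \<Longrightarrow> y \<in> carrier FA \<Longrightarrow> contraction \<phi> (x + y) = contraction \<phi> x \<oplus>\<^bsub>N\<^esub> contraction \<phi> y"
  using hom_mult[OF contraction(1), of x y \<phi>] by simp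
lemma contraction_closed: "x \<in> carrier FA \<Longrightarrow> contraction \<phi> x \<in> carrier N"
  using hom_in_carrier[OF contraction(1), of x \<phi>] by simp
lemma contraction_zero: "contraction \<phi> 0 = \<zero>\<^bsub>N\<^esub>"
  using hom_one[OF contraction(1)[of \<phi>] group_free_Abelian_group N.a_group] by simp
lemma contraction_diff:
  assumes "x \<in> carrier FA" "y \<in> carrier FA"
  shows "contraction \<phi> (x - y) = contraction \<phi> x \<ominus>\<^bsub>N\<^esub> contraction \<phi> y"
proof -
  have xy: "x - y \<in> carrier FA" using assms keys_diff[of x y] by auto
  then have "contraction \<phi> x = contraction \<phi> (x - y) \<oplus>\<^bsub>N\<^esub> contraction \<phi> y"
    using contraction_add[OF xy assms(2), of \<phi>] by simp
  then show ?thesis using contraction_closed[OF xy] contraction_closed[OF assms(2)]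
    by (simp add: a_minus_def N.a_assoc N.r_neg)
qed

lemma tensor_rel_support:
  assumes "z \<in> tensor_rels R M N"
  shows "\<exists>W. finite W \<and> (\<forall>\<phi>. linear_on \<phi> (sc.span W) \<longrightarrow> contraction \<phi> z = \<zero>\<^bsub>N\<^esub>)"
proof -
  from assms show ?thesis
  proof (cases rule: tensor_rels_cases)
    case (1 m m' y)
    have "contraction \<phi> z = \<zero>\<^bsub>N\<^esub>" if "linear_on \<phi> (sc.span {m, m'})" for \<phi>
    proof -
      have "\<phi> (m + m') = \<phi> m + \<phi> m'" using that by (simp add: linear_on_def sc.span_base)
      then show ?thesis using 1 N.smult_l_distr[of "\<phi> m" "\<phi> m'" y]
        by (simp del: carrier_free_Abelian_group_iff add: contraction_diff FA_frag FA_diff mem_carrier contraction(2) R_simps a_minus_def N.a_ac N.r_neg N.minus_add N.r_neg1)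
    qed
    then show ?thesis by (intro exI[of _ "{m, m'}"]) simp
  next
    case (2 m y y')
    have "contraction \<phi> z = \<zero>\<^bsub>N\<^esub>" for \<phi>
      using 2 by (simp del: carrier_free_Abelian_group_iff add: contraction_diff FA_frag FA_diff mem_carrier contraction(2) R_simps N.smult_r_distr a_minus_def N.a_ac N.r_neg N.minus_add N.r_neg1)
    then show ?thesis by blast
  next
    case (3 r m y)
    have "contraction \<phi> z = \<zero>\<^bsub>N\<^esub>" if "linear_on \<phi> (sc.span {m})" for \<phi>
    proof -
      have "\<phi> (sc r m) = \<phi> m * r" using that by (simp add: linear_on_def sc.span_base mult.commute)
      then show ?thesis using 3 N.smult_assoc1[of "\<phi> m" r y]
        by (simp del: carrier_free_Abelian_group_iff add: contraction_diff FA_frag FA_diff mem_carrier contraction(2) R_simps a_minus_def N.r_neg)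
    qed
    then show ?thesis by (intro exI[of _ "{m}"]) simp
  qed
qed

text \<open>An element of the kernel is a combination of finitely many bilinearity relations, and these involve a finite set \<open>W\<close>
  of elements of \<open>M\<close>.\<close>

lemma contraction_kernel:
  assumes "z \<in> TK"
  shows "\<exists>W. finite W \<and> (\<forall>\<phi>. linear_on \<phi> (sc.span W) \<longrightarrow> contraction \<phi> z = \<zero>\<^bsub>N\<^esub>)"
  using assms unfolding tensor_kernel_def
proof (induction rule: generate.induct)
  case one then show ?case by (intro exI[of _ "{}"]) (simp add: contraction_zero)
next
  case (incl z)
  show ?case using tensor_rel_support[OF incl] by blast
next
  case (inv z)
  obtain W where W: "finite W" "\<And>\<phi>. linear_on \<phi> (sc.span W) \<Longrightarrow> contraction \<phi> z = \<zero>\<^bsub>N\<^esub>"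
    using tensor_rel_support[OF inv] by blast
  have z: "z \<in> carrier FA" using inv tensor_rels_carrier by blast
  then have "contraction \<phi> (inv\<^bsub>FA\<^esub> z) = \<zero>\<^bsub>N\<^esub> \<ominus>\<^bsub>N\<^esub> contraction \<phi> z" for \<phi>
    using contraction_diff[of 0 z \<phi>] by (simp add: contraction_zero)
  then show ?case using W by (intro exI[of _ W]) (auto simp: a_minus_def)
next
  case (eng z z')
  obtain W W' where W: "finite W" "\<And>\<phi>. linear_on \<phi> (sc.span W) \<Longrightarrow> contraction \<phi> z = \<zero>\<^bsub>N\<^esub>"
    "finite W'" "\<And>\<phi>. linear_on \<phi> (sc.span W') \<Longrightarrow> contraction \<phi> z' = \<zero>\<^bsub>N\<^esub>" using eng.IH by blast
  have zc: "z \<in> carrier FA" "z' \<in> carrier FA" using eng TK_carrier by (auto simp: tensor_kernel_def)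
  have "linear_on \<phi> (sc.span W) \<and> linear_on \<phi> (sc.span W')" if "linear_on \<phi> (sc.span (W \<union> W'))" for \<phi>
    using that sc.span_mono[of W "W \<union> W'"] sc.span_mono[of W' "W \<union> W'"] unfolding linear_on_def by blast
  then show ?case using W by (intro exI[of _ "W \<union> W'"]) (auto simp: contraction_add[OF zc])
qed

lemma TK_sum_closed: "finite B \<Longrightarrow> (\<And>b. b \<in> B \<Longrightarrow> f b \<in> TK) \<Longrightarrow> sum f B \<in> TK"
  by (induction B rule: finite_induct) (auto simp: TK_zero TK_add)

text \<open>A tensor whose components in \<open>M\<close> lie in a submodule with basis \<open>B\<close> is \<open>\<Sum>\<^sub>b b \<otimes> n\<^sub>b\<close>, where the \<open>n\<^sub>b\<close> are its contractions with the coordinate functionals.\<close>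

lemma contraction_expansion:
  assumes B: "finite B" "\<not> sc.dependent B" and c: "Poly_Mapping.keys c \<subseteq> d ` sc.span B \<times> carrier N"
  shows "c - (\<Sum>b\<in>B. frag_of (d b, contraction (\<lambda>x. sc.representation B x b) c)) \<in> TK"
proof -
  let ?\<phi> = "\<lambda>b x. sc.representation B x b"
  let ?e = "\<lambda>c. \<Sum>b\<in>B. frag_of (d b, contraction (?\<phi> b) c)"
  from c have "c \<in> carrier FA \<and> c - ?e c \<in> TK"
  proof (induction c rule: frag_induction)
    case zero
    show ?case using B TK_minus[OF TK_sum_closed[OF B(1), of "\<lambda>b. frag_of (d b, \<zero>\<^bsub>N\<^esub>)"]]
      by (simp add: contraction_zero TK_right_zero)
  next
    case (one p)
    then obtain m y where p: "p = (d m, y)" "m \<in> sc.span B" "y \<in> carrier N" by auto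
    have e: "?e (frag_of p) = (\<Sum>b\<in>B. frag_of (d b, ?\<phi> b m \<odot>\<^bsub>N\<^esub> y))"
      by (simp add: p contraction(2)[OF p(3)])
    have "frag_of (d (\<Sum>b\<in>B. sc (?\<phi> b m) b), y) - (\<Sum>b\<in>B. frag_of (d (sc (?\<phi> b m) b), y)) \<in> TK"
      using TK_sum[OF B(1) p(3)] .
    moreover have "(\<Sum>b\<in>B. frag_of (d (sc (?\<phi> b m) b), y) - frag_of (d b, ?\<phi> b m \<odot>\<^bsub>N\<^esub> y)) \<in> TK"
      by (intro TK_sum_closed B(1) TK_scale p(3))
    moreover have "(\<Sum>b\<in>B. sc (?\<phi> b m) b) = m"
      using sc.sum_representation_eq[of B m B] B p(2) by auto
    ultimately have "frag_of p - ?e (frag_of p) \<in> TK"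
      using TK_add unfolding e unfolding p(1) sum_subtractf by fastforce
    then show ?case using FA_frag[OF p(3), of m] p(1) by simp
  next
    case (diff x y)
    have t: "frag_of (d b, contraction \<phi> (x - y)) - frag_of (d b, contraction \<phi> x) + frag_of (d b, contraction \<phi> y) \<in> TK" for b \<phi>
    proof -
      have cl: "contraction \<phi> x \<in> carrier N" "contraction \<phi> y \<in> carrier N" "contraction \<phi> (x - y) \<in> carrier N"
        using diff FA_diff by (auto intro!: contraction_closed simp del: carrier_free_Abelian_group_iff)
      have "contraction \<phi> (x - y) \<oplus>\<^bsub>N\<^esub> contraction \<phi> y = contraction \<phi> x"
        using cl diff by (simp add: contraction_diff a_minus_def N.a_assoc N.l_neg)
      then have "frag_of (d b, contraction \<phi> x) - frag_of (d b, contraction \<phi> (x - y)) - frag_of (d b, contraction \<phi> y) \<in> TK"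
        using TK_right[OF cl(3,2), of b] by simp
      from TK_minus[OF this] show ?thesis by (simp add: algebra_simps)
    qed
    have "x - y - ?e (x - y) = (x - ?e x) - (y - ?e y)
        - (\<Sum>b\<in>B. frag_of (d b, contraction (?\<phi> b) (x - y)) - frag_of (d b, contraction (?\<phi> b) x) + frag_of (d b, contraction (?\<phi> b) y))"
      by (simp add: sum.distrib sum_subtractf algebra_simps)
    also have "\<dots> \<in> TK"
      using diff by (intro TK_diff[OF TK_diff TK_sum_closed[OF B(1) t]]) (simp_all only:)
    finally show ?case using diff FA_diff by blast
  qed
  then show ?thesis by simp
qed

lemma linear_on_representation:
  assumes "\<not> sc.dependent B" "V \<subseteq> sc.span B"
  shows "linear_on (\<lambda>x. sc.representation B x b) V"
  using assms unfolding linear_on_def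
  by (auto simp: sc.representation_add sc.representation_scale subset_iff)

end

context
  fixes N :: "('r, 'n) module" and P :: "('r, 'p) module" and f :: "'n \<Rightarrow> 'p"
  assumes N: "Module.module R N" and P: "Module.module R P" and f: "f \<in> linear_maps R N P"
begin

interpretation N: Module.module R N by (rule N)
interpretation P: Module.module R P by (rule P)

lemma f_simps:
  "y \<in> carrier N \<Longrightarrow> f y \<in> carrier P"
  "y \<in> carrier N \<Longrightarrow> y' \<in> carrier N \<Longrightarrow> f (y \<oplus>\<^bsub>N\<^esub> y') = f y \<oplus>\<^bsub>P\<^esub> f y'"
  "y \<in> carrier N \<Longrightarrow> f (r \<odot>\<^bsub>N\<^esub> y) = r \<odot>\<^bsub>P\<^esub> f y"
  using f by (auto simp: linear_maps_def R_simps)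

lemma f_minus:
  assumes "y \<in> carrier N" "y' \<in> carrier N" shows "f (y \<ominus>\<^bsub>N\<^esub> y') = f y \<ominus>\<^bsub>P\<^esub> f y'"
proof -
  have "f (y \<ominus>\<^bsub>N\<^esub> y') \<oplus>\<^bsub>P\<^esub> f y' = f y"
    using assms by (subst f_simps(2)[symmetric]) (auto simp: a_minus_def N.a_assoc N.l_neg)
  moreover have "f (y \<ominus>\<^bsub>N\<^esub> y') \<in> carrier P" "f y' \<in> carrier P" using assms by (auto intro: f_simps(1))
  ultimately show ?thesis by (metis P.add.inv_solve_right P.minus_eq P.a_closed)
qed

lemma f_zero: "f \<zero>\<^bsub>N\<^esub> = \<zero>\<^bsub>P\<^esub>"
proof -
  have "f \<zero>\<^bsub>N\<^esub> \<oplus>\<^bsub>P\<^esub> f \<zero>\<^bsub>N\<^esub> = f \<zero>\<^bsub>N\<^esub>" by (subst f_simps(2)[symmetric]) auto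
  then show ?thesis using f_simps(1)[of "\<zero>\<^bsub>N\<^esub>"] by (simp add: P.add.l_cancel_one)
qed

abbreviation "F \<equiv> frag_extend (\<lambda>(x :: 'c, y). frag_of (x, f y))"

lemma F_carrier: "c \<in> carrier (FA N) \<Longrightarrow> F c \<in> carrier (FA P)"
  unfolding carrier_free_Abelian_group_iff[of c]
proof (induction c rule: frag_induction)
  case zero then show ?case by simp
next
  case (one p) then show ?case by (auto simp: f_simps)
next
  case (diff x y) then show ?case unfolding frag_extend_diff by (rule FA_diff[OF P])
qed

lemma F_contraction:
  assumes "c \<in> carrier (FA N)"
  shows "contraction P \<phi> (F c) = f (contraction N \<phi> c)"
proof -
  have "c \<in> carrier (FA N) \<and> contraction P \<phi> (F c) = f (contraction N \<phi> c)"
    using assms[unfolded carrier_free_Abelian_group_iff]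
  proof (induction c rule: frag_induction)
    case zero then show ?case by (simp add: contraction_zero[OF P] contraction_zero[OF N] f_zero)
  next
    case (one p)
    then obtain m y where p: "p = (d m, y)" "y \<in> carrier N" by (auto simp: carrier_M)
    then show ?case by (simp add: mem_carrier contraction(2)[OF P] contraction(2)[OF N] f_simps)
  next
    case (diff x y)
    then show ?case
      by (simp del: carrier_free_Abelian_group_iff add: FA_diff[OF N] frag_extend_diff contraction_diff[OF P] contraction_diff[OF N] F_carrier f_minus contraction_closed[OF N])
  qed
  then show ?thesis ..
qed

lemma F_tensor_rels:
  assumes "z \<in> tensor_rels R M N" shows "F z \<in> TK P"
  using assms by (cases rule: tensor_rels_cases[OF N, consumes 1])
    (simp_all add: frag_extend_diff f_simps TK_left[OF P] TK_right[OF P] TK_scale[OF P])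

lemma F_kernel: "c \<in> TK N \<Longrightarrow> F c \<in> TK P"
  unfolding tensor_kernel_def[of R M N]
proof (induction rule: generate.induct)
  case one then show ?case by (simp add: TK_zero[OF P])
next
  case (incl z) then show ?case by (rule F_tensor_rels)
next
  case (inv z)
  have "z \<in> carrier (FA N)" by (rule subsetD[OF tensor_rels_carrier[OF N] inv])
  then have "inv\<^bsub>FA N\<^esub> z = - z" by simp
  then show ?case using TK_minus[OF P F_tensor_rels[OF inv]] by (simp add: frag_extend_minus)
next
  case (eng z z') then show ?case by (simp add: frag_extend_add TK_add[OF P])
qed

text \<open>The elements of \<open>M\<close> that occur in \<open>c\<close>, or in a proof that \<open>F c\<close> vanishes in the tensor product, lie in a free
  submodule.  Contraction with its coordinates commutes with \<open>f\<close>, so by injectivity of \<open>f\<close> all contractions of \<open>c\<close>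
  vanish.\<close>

lemma F_kernel_reflect:
  assumes tf: "\<And>r x. sc r x = 0 \<Longrightarrow> r = 0 \<or> x = 0" and inj: "inj_on f (carrier N)"
    and c: "c \<in> carrier (FA N)" and Fc: "F c \<in> TK P"
  shows "c \<in> TK N"
proof -
  obtain W where W: "finite W" "\<And>\<phi>. linear_on \<phi> (sc.span W) \<Longrightarrow> contraction P \<phi> (F c) = \<zero>\<^bsub>P\<^esub>"
    using contraction_kernel[OF P Fc] by blast
  define Y where "Y = W \<union> inv_into UNIV d ` fst ` Poly_Mapping.keys c"
  have "finite Y" using W by (simp add: Y_def)
  then obtain g :: "nat \<Rightarrow> 'm" and n where "Y = g ` {i. i < n}"
    using finite_imp_nat_seg_image_inj_on by blast
  then obtain B where B: "finite B" "\<not> sc.dependent B" "Y \<subseteq> sc.span B"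
    using torsion_free_fg_basis[OF mod_sc tf, of "{i. i < n}" g] by auto
  have "Poly_Mapping.keys c \<subseteq> d ` sc.span B \<times> carrier N"
  proof
    fix p assume p: "p \<in> Poly_Mapping.keys c"
    then obtain m y where my: "p = (d m, y)" "y \<in> carrier N" using c by (fastforce simp: carrier_M)
    then have "m \<in> Y" using p unfolding Y_def by (force simp: inv_into_f_f[OF inj_d] image_iff)
    then show "p \<in> d ` sc.span B \<times> carrier N" using B my by auto
  qed
  note expansion = contraction_expansion[OF N B(1,2) this]
  have "contraction N (\<lambda>x. sc.representation B x b) c = \<zero>\<^bsub>N\<^esub>" for b
  proof -
    have "sc.span W \<subseteq> sc.span B" using B(3) sc.span_minimal[of W "sc.span B"] by (simp add: Y_def)
    then have "f (contraction N (\<lambda>x. sc.representation B x b) c) = f \<zero>\<^bsub>N\<^esub>"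
      using W(2)[OF linear_on_representation[OF N B(2)]] F_contraction[OF c] f_zero by simp
    then show ?thesis using inj contraction_closed[OF N c] by (auto dest: inj_onD)
  qed
  then have "c - (\<Sum>b\<in>B. frag_of (d b, \<zero>\<^bsub>N\<^esub>)) \<in> TK N" using expansion by simp
  from TK_add[OF N this TK_sum_closed[OF N B(1), of "\<lambda>b. frag_of (d b, \<zero>\<^bsub>N\<^esub>)"]]
  show ?thesis by (simp add: TK_right_zero[OF N])
qed

end

lemma coset_eq_iff:
  assumes N: "Module.module R N"
  shows "TK N #>\<^bsub>FA N\<^esub> x = TK N #>\<^bsub>FA N\<^esub> y \<longleftrightarrow> x - y \<in> TK N"
proof -
  have eq: "TK N #>\<^bsub>FA N\<^esub> x = (\<lambda>k. k + x) ` TK N" for x by (auto simp: r_coset_def)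
  show ?thesis unfolding eq
  proof
    assume "(\<lambda>k. k + x) ` TK N = (\<lambda>k. k + y) ` TK N"
    then have "0 + x \<in> (\<lambda>k. k + y) ` TK N" using TK_zero[OF N] by (metis imageI)
    then show "x - y \<in> TK N" by auto
  next
    have sub: "(\<lambda>k. k + x) ` TK N \<subseteq> (\<lambda>k. k + y) ` TK N" if "x - y \<in> TK N" for x y
    proof (rule image_subsetI)
      fix k assume "k \<in> TK N"
      then have "k + (x - y) \<in> TK N" using that by (rule TK_add[OF N])
      then show "k + x \<in> (\<lambda>k. k + y) ` TK N" by (rule rev_image_eqI) simp
    qed
    assume xy: "x - y \<in> TK N"
    then have "y - x \<in> TK N" using TK_minus[OF N xy] by simp
    then show "(\<lambda>k. k + x) ` TK N = (\<lambda>k. k + y) ` TK N" using xy sub by (intro equalityI)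
  qed
qed

lemma torsion_free_imp_flat:
  assumes tf: "\<And>r x. sc r x = 0 \<Longrightarrow> r = 0 \<or> x = 0"
  shows "flat_module TYPE('n) TYPE('p) R M"
  unfolding flat_module_def
proof (intro conjI allI ballI impI module_M)
  fix N :: "('r, 'n) module" and P :: "('r, 'p) module" and f
  assume f: "f \<in> linear_maps R N P" and N: "Module.module R N" and P: "Module.module R P" and inj: "inj_on f (carrier N)"
  let ?F = "frag_extend (\<lambda>(x, y). frag_of (x, f y))"
  have map: "tensor_map R M P f (TK N #>\<^bsub>FA N\<^esub> c) = TK P #>\<^bsub>FA P\<^esub> ?F c" if c: "c \<in> carrier (FA N)" for c
  proof -
    have "TK P #>\<^bsub>FA P\<^esub> ?F c' = TK P #>\<^bsub>FA P\<^esub> ?F c" if c': "c' \<in> TK N #>\<^bsub>FA N\<^esub> c" for c'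
    proof -
      obtain k where k: "k \<in> TK N" "c' = k + c" using c' by (auto simp: r_coset_def)
      then have "?F c' - ?F c \<in> TK P" by (simp add: frag_extend_add F_kernel[OF N P f])
      then show ?thesis using coset_eq_iff[OF P] by blast
    qed
    moreover have "c \<in> TK N #>\<^bsub>FA N\<^esub> c" using TK_zero[OF N] by (force simp: r_coset_def)
    ultimately show ?thesis unfolding tensor_map_def by blast
  qed
  show "inj_on (tensor_map R M P f) (carrier (tensor R M N))"
  proof (rule inj_onI)
    fix u v assume "u \<in> carrier (tensor R M N)" "v \<in> carrier (tensor R M N)" and uv: "tensor_map R M P f u = tensor_map R M P f v"
    then obtain a b where ab: "a \<in> carrier (FA N)" "u = TK N #>\<^bsub>FA N\<^esub> a" "b \<in> carrier (FA N)" "v = TK N #>\<^bsub>FA N\<^esub> b"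
      unfolding tensor_def FactGroup_def RCOSETS_def by auto
    have "?F a - ?F b \<in> TK P"
      using uv unfolding ab(2,4) map[OF ab(1)] map[OF ab(3)] using coset_eq_iff[OF P] by blast
    then have "a - b \<in> TK N"
      by (intro F_kernel_reflect[OF N P f tf inj] FA_diff[OF N] ab) (simp_all add: frag_extend_diff)
    then show "u = v" using ab coset_eq_iff[OF N] by blast
  qed
qed

end

section \<open>Flatness of the family\<close>

lemma rhom_map_poly:
  fixes \<phi> :: "'a::comm_ring_1 \<Rightarrow> 'b::comm_ring_1"
  assumes "rhom \<phi>" shows "rhom (map_poly \<phi>)"
proof
  interpret rhom \<phi> by fact
  show "map_poly \<phi> (p + q) = map_poly \<phi> p + map_poly \<phi> q" for p q
    by (rule poly_eqI) (simp add: coeff_map_poly hom_zero hom_add)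
  show "map_poly \<phi> (p * q) = map_poly \<phi> p * map_poly \<phi> q" for p q
    by (rule poly_eqI) (simp only: coeff_map_poly[of \<phi>, OF hom_zero] coeff_mult hom_sum hom_mult)
  show "map_poly \<phi> 1 = 1" by (simp add: map_poly_1' hom_one)
qed

lemma rhom_const_fract: "rhom (\<lambda>a::complex. Fraction_Field.Fract [:a:] 1)"
  by unfold_locales (simp_all add: One_fract_def pCons_one mult.commute)

lemma rhom_incl_Ct: "rhom incl_Ct"
  unfolding incl_Ct_def by (rule rhom_map_poly[OF rhom_const_fract])

lemma incl_Ct_eq_0: "incl_Ct p = 0 \<Longrightarrow> p = 0"
  unfolding incl_Ct_def by (subst (asm) map_poly_eq_0_iff) (auto simp: Zero_fract_def eq_fract)

definition at_coset :: "at_alg \<Rightarrow> (At_gen, cv poly) free_alg set"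
  where "at_coset a = rel_ideal (At_rels scalar gen) +>\<^bsub>free_algebra\<^esub> rep_at_alg a"

lemma at_coset_abs: "at_coset (abs_at_alg f) = rel_ideal (At_rels scalar gen) +>\<^bsub>free_algebra\<^esub> f"
proof -
  have "abs_at_alg (rep_at_alg (abs_at_alg f)) = abs_at_alg f" by (rule Quotient_abs_rep[OF Quotient_at_alg])
  then have "rep_at_alg (abs_at_alg f) - f \<in> rel_ideal (At_rels scalar gen)" by (simp add: at_alg.abs_eq_iff)
  then show ?thesis using cosets_presented[of "At_rels scalar gen"] unfolding at_coset_def cosets_of_def by blast
qed

lemma typed_module_At: "typed_module (\<lambda>p a. ats (incl_Ct p) * a) (restrict_scalars incl_Ct At) at_coset"
proof -
  let ?M = "restrict_scalars incl_Ct At"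
  have C: "carrier At = range (\<lambda>f. at_coset (abs_at_alg f))"
    "\<And>f g. at_coset (abs_at_alg f) = at_coset (abs_at_alg g) \<longleftrightarrow> f - g \<in> rel_ideal (At_rels scalar gen)"
    "\<And>f g. at_coset (abs_at_alg f) \<oplus>\<^bsub>At\<^esub> at_coset (abs_at_alg g) = at_coset (abs_at_alg (f + g))"
    "\<zero>\<^bsub>At\<^esub> = at_coset (abs_at_alg 0)"
    "\<And>p f. p \<odot>\<^bsub>At\<^esub> at_coset (abs_at_alg f) = at_coset (abs_at_alg (scalar p * f))"
    using cosets_presented[of "At_rels scalar gen", folded At_eq] unfolding cosets_of_def at_coset_abs by blast+
  interpret i: rhom incl_Ct by (rule rhom_incl_Ct)
  have M: "carrier ?M = carrier At" "x \<oplus>\<^bsub>?M\<^esub> y = x \<oplus>\<^bsub>At\<^esub> y" "\<zero>\<^bsub>?M\<^esub> = \<zero>\<^bsub>At\<^esub>" "r \<odot>\<^bsub>?M\<^esub> x = incl_Ct r \<odot>\<^bsub>At\<^esub> x" for x y r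
    by (simp_all add: restrict_scalars_def ring.defs module.defs)
  show ?thesis
  proof
    have "range (\<lambda>f. at_coset (abs_at_alg f)) = at_coset ` range abs_at_alg" by (rule image_image[symmetric])
    then show "carrier ?M = range at_coset" unfolding M C(1) surj_at .
    show "inj at_coset"
    proof (rule injI)
      fix a b assume ab: "at_coset a = at_coset b"
      obtain f g where fg: "a = abs_at_alg f" "b = abs_at_alg g" using surj_at by (metis surjD)
      show "a = b" using ab unfolding fg C(2) at_alg.abs_eq_iff .
    qed
    fix a b
    obtain f g where fg: "a = abs_at_alg f" "b = abs_at_alg g" using surj_at by (metis surjD)
    show "at_coset a \<oplus>\<^bsub>?M\<^esub> at_coset b = at_coset (a + b)"
      unfolding M fg rhom.hom_add[OF rhom_at, symmetric] by (rule C(3))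
    show "\<zero>\<^bsub>?M\<^esub> = at_coset 0" unfolding M rhom.hom_zero[OF rhom_at, symmetric] by (rule C(4))
    fix r
    show "r \<odot>\<^bsub>?M\<^esub> at_coset a = at_coset (ats (incl_Ct r) * a)"
      unfolding M fg ats_def rhom.hom_mult[OF rhom_at, symmetric] by (rule C(5))
  qed (simp_all add: i.homs ats.homs distrib_left distrib_right mult.assoc)
qed

lemma flat_At: "flat_module TYPE('n) TYPE('p) ring_of_type_algebra (restrict_scalars incl_Ct At)"
  by (rule typed_module.torsion_free_imp_flat[OF typed_module_At]) (use at_torsion_free incl_Ct_eq_0 in blast)

section \<open>Specialization\<close>

lemma cosets_of_ideal_image:
  assumes A: "cosets_of A d J s" and I: "two_sided I" "J \<subseteq> I"
  shows "ideal (d ` I) A"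
proof -
  interpret I: two_sided I by fact
  interpret A: ring A by (rule cosets_ring[OF A])
  have c: "carrier A = range d" and m: "\<And>f g. d f \<otimes>\<^bsub>A\<^esub> d g = d (f * g)" and
    a: "\<And>f g. d f \<oplus>\<^bsub>A\<^esub> d g = d (f + g)" and z: "\<zero>\<^bsub>A\<^esub> = d 0"
    using A unfolding cosets_of_def by auto
  show ?thesis
  proof (rule idealI[OF A.ring_axioms])
    show "subgroup (d ` I) (add_monoid A)"
    proof
      show "d ` I \<subseteq> carrier (add_monoid A)" by (auto simp: c)
      show "\<one>\<^bsub>add_monoid A\<^esub> \<in> d ` I" by (auto simp: z I.J_zero)
      fix x assume "x \<in> d ` I"
      then obtain f where f: "f \<in> I" "x = d f" by blast
      have "inv\<^bsub>add_monoid A\<^esub> x = \<ominus>\<^bsub>A\<^esub> x" by (simp add: a_inv_def)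
      also have "\<dots> = d (- f)" by (rule A.minus_equality) (auto simp: f a z c)
      finally show "inv\<^bsub>add_monoid A\<^esub> x \<in> d ` I" using I.J_minus f by auto
      fix y assume "y \<in> d ` I"
      then show "x \<otimes>\<^bsub>add_monoid A\<^esub> y \<in> d ` I" using f I.J_add by (auto simp: a)
    qed
    fix x y assume "x \<in> d ` I" "y \<in> carrier A"
    then show "y \<otimes>\<^bsub>A\<^esub> x \<in> d ` I" "x \<otimes>\<^bsub>A\<^esub> y \<in> d ` I" by (auto simp: c m I.J_left I.J_right)
  qed
qed

lemma cosets_of_ideal_preimage:
  assumes A: "cosets_of A d J s" and K: "ideal K A"
  shows "two_sided {f. d f \<in> K}"
proof -
  interpret K: ideal K A by fact
  have c: "carrier A = range d" and m: "\<And>f g. d (f * g) = d f \<otimes>\<^bsub>A\<^esub> d g" and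
    a: "\<And>f g. d (f + g) = d f \<oplus>\<^bsub>A\<^esub> d g" and z: "d 0 = \<zero>\<^bsub>A\<^esub>"
    using A unfolding cosets_of_def by auto
  show ?thesis by unfold_locales (auto simp: c m a z K.I_l_closed K.I_r_closed)
qed

text \<open>An additional relation may be imposed before or after passing to the quotient.\<close>

lemma cosets_of_genideal:
  assumes A: "cosets_of A d (rel_ideal rels) s"
  shows "{f. d f \<in> genideal A {d g}} = rel_ideal (rels \<union> {g})"
proof
  interpret A: ring A by (rule cosets_ring[OF A])
  have c: "carrier A = range d" and z: "\<zero>\<^bsub>A\<^esub> = d 0" and e: "\<And>f g. d f = d g \<longleftrightarrow> f - g \<in> rel_ideal rels"
    using A unfolding cosets_of_def by auto
  have K: "ideal (genideal A {d g}) A" by (rule A.genideal_ideal) (auto simp: c)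
  let ?I = "rel_ideal (rels \<union> {g})"
  interpret I: two_sided ?I by (rule two_sided_rel_ideal)
  have J: "rel_ideal rels \<subseteq> ?I"
    using rel_ideal_minimal[OF two_sided_rel_ideal, of rels "rels \<union> {g}"] rel_ideal_superset[of "rels \<union> {g}"] by blast
  show "?I \<subseteq> {f. d f \<in> genideal A {d g}}"
  proof (rule rel_ideal_minimal[OF cosets_of_ideal_preimage[OF A K]])
    have "d r \<in> genideal A {d g}" if "r \<in> rels" for r
    proof -
      have "r \<in> rel_ideal rels" using rel_ideal_superset that by blast
      then have "d r = \<zero>\<^bsub>A\<^esub>" using e[of r 0] z by simp
      then show ?thesis using additive_subgroup.zero_closed[OF ideal.axioms(1)[OF K]] by simp
    qed
    moreover have "d g \<in> genideal A {d g}" using A.genideal_self[of "{d g}"] c by auto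
    ultimately show "rels \<union> {g} \<subseteq> {f. d f \<in> genideal A {d g}}" by auto
  qed
  have "genideal A {d g} \<subseteq> d ` ?I"
    using rel_ideal_superset[of "rels \<union> {g}"]
    by (intro A.genideal_minimal cosets_of_ideal_image[OF A I.two_sided_axioms J]) auto
  moreover have "f \<in> ?I" if f: "d f \<in> d ` ?I" for f
  proof -
    obtain f' where f': "f' \<in> ?I" "f - f' \<in> rel_ideal rels" using f e by (auto simp del: Un_insert_right)
    then show ?thesis using I.J_add[of "f - f'" f'] J by auto
  qed
  ultimately show "{f. d f \<in> genideal A {d g}} \<subseteq> ?I" by blast
qed

lemma cosets_of_restrict_scalars:
  "cosets_of A d J s \<Longrightarrow> cosets_of (restrict_scalars \<phi> A) d J (\<lambda>a. s (\<phi> a))"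
  by (auto simp: cosets_of_def restrict_scalars_def ring.defs module.defs)

lemma cosets_specialize:
  "\<exists>d. cosets_of (specialize At p) d (rel_ideal (At_rels scalar gen \<union> {scalar p})) (\<lambda>a. scalar [:a:])"
proof -
  define J where "J = rel_ideal (At_rels (scalar :: cv poly \<Rightarrow> (At_gen, cv poly) free_alg) gen)"
  define d where "d f = J +>\<^bsub>free_algebra\<^esub> f" for f :: "(At_gen, cv poly) free_alg"
  have C: "cosets_of At d J scalar"
    unfolding d_def[abs_def] J_def At_eq by (rule cosets_presented)
  have g: "p \<odot>\<^bsub>At\<^esub> \<one>\<^bsub>At\<^esub> = d (scalar p)" using C unfolding cosets_of_def by simp
  interpret A: ring At by (rule cosets_ring[OF C])
  have K: "ideal (genideal At {d (scalar p)}) At"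
    by (rule A.genideal_ideal) (use C in \<open>auto simp: cosets_of_def\<close>)
  have ts: "two_sided J" unfolding J_def by (rule two_sided_rel_ideal)
  show ?thesis
    using cosets_of_restrict_scalars[OF cosets_quotient[OF C ts K scalar.central], of "\<lambda>a. [:a:]"]
      cosets_of_genideal[OF C[unfolded J_def], of "scalar p"]
    unfolding specialize_def g by auto
qed

section \<open>Rescaling the Drinfeld generators by a central element\<close>

text \<open>Substitution of \<open>y u\<close> for the variable \<open>u\<close>.\<close>

lemma exp_series_rescale:
  assumes y: "cent y" and h': "\<And>j. j \<ge> 1 \<Longrightarrow> h' j = y ^ j * h j"
  shows "exp_series \<iota> q h' $ m = y ^ m * exp_series \<iota> q h $ m"
proof -
  let ?b = "\<lambda>h. Abs_fps (\<lambda>k. if k = 0 then 0 else \<iota> q * h k)"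
  have yk: "cent (y ^ k)" for k by (rule cent_power[OF y])
  have b: "?b h' $ k = y ^ k * ?b h $ k" for k
    using h'[of k] by (cases "k = 0") (simp_all add: cent_left[OF yk, where x = "\<iota> q"])
  have pow: "(?b h' ^ i) $ k = y ^ k * (?b h ^ i) $ k" for i k
  proof (induction i arbitrary: k)
    case 0 then show ?case by (cases k) simp_all
  next
    case (Suc i)
    have "?b h' $ n * (?b h' ^ i) $ (k - n) = y ^ k * (?b h $ n * (?b h ^ i) $ (k - n))" if "n \<in> {0..k}" for n
    proof -
      have "?b h' $ n * (?b h' ^ i) $ (k - n) = y ^ n * (?b h $ n * (y ^ (k - n) * (?b h ^ i) $ (k - n)))"
        by (simp only: b Suc mult.assoc)
      also have "\<dots> = (y ^ n * y ^ (k - n)) * (?b h $ n * (?b h ^ i) $ (k - n))"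
        by (simp only: cent_left[OF yk, where x = "?b h $ n"] mult.assoc)
      also have "y ^ n * y ^ (k - n) = y ^ k" using that by (simp add: power_add[symmetric])
      finally show ?thesis .
    qed
    then show ?case unfolding power_Suc fps_mult_nth by (simp only: sum_distrib_left cong: sum.cong)
  qed
  show ?thesis unfolding exp_series_def fps_compose_nth pow sum_distrib_left
    by (intro sum.cong refl cent_left[OF yk])
qed

text \<open>Multiplication by powers of a central invertible element \<open>z\<close>.  This is used for both directions of the
  isomorphism, with \<open>z\<close> the image of the square root of \<open>C\<close> with a tilde in one direction and its inverse in the other.\<close>

locale rescaling = central_hom \<iota> for \<iota> :: "cv \<Rightarrow> 'a::ring_1" +
  fixes z zi :: 'a
  assumes zzi: "z * zi = 1" "zi * z = 1" and cent_z: "cent z" "cent zi"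
begin

abbreviation "w \<equiv> zpow z zi"

lemma w_add: "w (m + n) = w m * w n" by (rule zpow_add[OF zzi])
lemma cent_w: "cent (w n)" by (intro cent_zpow cent_z)
lemma w_left: "x * (w n * y) = w n * (x * y)" by (rule cent_left[OF cent_w])
lemma w_mult: "(w m * x) * (w n * y) = w (m + n) * (x * y)"
  by (simp add: w_add mult.assoc w_left[of x])
lemma w_commutator: "w m * x * (w n * y) - w n * y * (w m * x) = w (m + n) * (x * y - y * x)"
  by (simp add: w_mult add.commute right_diff_distrib)
lemma w_conj: "p * (w n * x) * p' = w n * (p * x * p')"
  by (simp add: mult.assoc w_left[of p])

lemma w_iota: "\<iota> r * (w n * x) = w n * (\<iota> r * x)" by (rule w_left)

text \<open>All monomials in the quadratic relation have the same total index, so a common power of \<open>z\<close> can be extracted.\<close>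

lemma w_quadratic:
  assumes "(E (k + 1) * E l - \<iota> r * E l * E (k + 1)) - (\<iota> r * E k * E (l + 1) - E (l + 1) * E k) = 0"
    and "\<And>k. E' k = w (k + b) * E k"
  shows "(E' (k + 1) * E' l - \<iota> r * E' l * E' (k + 1)) - (\<iota> r * E' k * E' (l + 1) - E' (l + 1) * E' k) = 0"
proof -
  have m: "E' i * E' j = w (k + l + 1 + 2 * b) * (E i * E j)" if "i + j = k + l + 1" for i j
  proof -
    have "i + b + (j + b) = k + l + 1 + 2 * b" using that by simp
    moreover have "E' i * E' j = w (i + b + (j + b)) * (E i * E j)" unfolding assms(2) by (rule w_mult)
    ultimately show ?thesis by (simp only:)
  qed
  have "(E' (k + 1) * E' l - \<iota> r * E' l * E' (k + 1)) - (\<iota> r * E' k * E' (l + 1) - E' (l + 1) * E' k)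
    = w (k + l + 1 + 2 * b) * ((E (k + 1) * E l - \<iota> r * E l * E (k + 1)) - (\<iota> r * E k * E (l + 1) - E (l + 1) * E k))"
    by (simp add: mult.assoc m w_left[of "\<iota> r"] right_diff_distrib)
  then show ?thesis by (simp only: assms(1) mult_zero_right)
qed

text \<open>The mode of index \<open>k\<close> is the coefficient of \<open>u\<^sup>k\<^sup>+\<^sup>1\<close> of its series, hence the shift in the exponent.  For the
  other series, the coefficient of \<open>u\<^sup>1\<^sup>-\<^sup>k\<close> with \<open>z\<^sup>-\<^sup>1\<close> in place of \<open>z\<close> gives the exponent \<open>k - 1\<close>.\<close>

lemma plus_mode_rescale:
  assumes "\<And>n. n \<noteq> 0 \<Longrightarrow> H' n = w n * H n"
  shows "plus_mode \<iota> a H' k = w (k + 1) * plus_mode \<iota> a H k"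
proof (cases "k < -1")
  case False
  then obtain m where m: "k = int m - 1" by (metis add.commute add_diff_cancel_left' diff_ge_0_iff_ge int_ops(2) linorder_not_less minus_diff_eq nonneg_int_cases uminus_add_conv_diff)
  have "exp_series \<iota> (vv - inverse vv) (\<lambda>j. H' (int j)) $ m = z ^ m * exp_series \<iota> (vv - inverse vv) (\<lambda>j. H (int j)) $ m"
    by (rule exp_series_rescale[OF cent_z(1)]) (simp add: assms zpow_def)
  moreover have "w (k + 1) = z ^ m" by (simp add: m zpow_def)
  ultimately show ?thesis unfolding m plus_mode_nat by (simp add: cent_left[OF cent_power[OF cent_z(1)]] m)
qed (simp add: plus_mode_def)

lemma minus_mode_rescale:
  assumes "\<And>n. n \<noteq> 0 \<Longrightarrow> H' n = w n * H n"
  shows "minus_mode \<iota> a H' k = w (k - 1) * minus_mode \<iota> a H k"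
proof (cases "k > 1")
  case False
  then obtain m where m: "k = 1 - int m" by (metis diff_add_cancel diff_diff_eq2 linorder_not_less zle_iff_zadd add_diff_cancel_right')
  have w: "w (- int j) = zi ^ j" for j by (cases "j = 0") (simp_all add: zpow_def)
  have "exp_series \<iota> (- (vv - inverse vv)) (\<lambda>j. H' (- int j)) $ m = zi ^ m * exp_series \<iota> (- (vv - inverse vv)) (\<lambda>j. H (- int j)) $ m"
    by (rule exp_series_rescale[OF cent_z(2)]) (simp add: assms w)
  moreover have "w (k - 1) = zi ^ m" by (simp add: m w)
  ultimately show ?thesis unfolding m minus_mode_nat by (simp add: cent_left[OF cent_power[OF cent_z(2)]] m)
qed (simp add: minus_mode_def)

lemma mode_scale:
  "plus_mode \<iota> (w n * a) H k = w n * plus_mode \<iota> a H k"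
  "minus_mode \<iota> (w n * a) H k = w n * minus_mode \<iota> a H k"
  by (simp_all add: plus_mode_def minus_mode_def mult.assoc)

lemma conj_inverse:
  assumes "S * Si = 1" "Si * S = 1" "S * x * Si = \<iota> r * x" "r \<noteq> 0"
  shows "Si * x * S = \<iota> (inverse r) * x"
proof -
  have "Si * (S * x * Si) * S = (Si * S) * x * (Si * S)" by (simp only: mult.assoc)
  then have "x = Si * (S * x * Si) * S" by (simp only: assms(2) mult_1_left mult_1_right)
  also have "\<dots> = \<iota> r * (Si * x * S)" unfolding assms(3) by (simp only: mult.assoc cent_left[OF cent_iota, where x = Si])
  finally have "\<iota> (inverse r) * x = \<iota> (inverse r) * (\<iota> r * (Si * x * S))" by (rule arg_cong)
  then show ?thesis using assms(4) by (simp add: mult.assoc[symmetric] hom_mult[symmetric] hom_one)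
qed

text \<open>The exponents are forced: the two series in \<open>[e\<^sub>k, f\<^sub>l]\<close> scale by \<open>z\<close> to the power \<open>k + l + 1\<close> and \<open>k + l - 1\<close>.
  The first is the total weight of \<open>e\<^sub>k\<close> and \<open>f\<^sub>l\<close>, and the second is corrected by the factor \<open>z\<^sup>2\<close> contained
  in the square of \<open>\<phi>\<^sup>-\<close>.\<close>

definition ft_from :: "(drinfeld_gen \<Rightarrow> 'a) \<Rightarrow> ft_gen \<Rightarrow> 'a"
  where "ft_from x g = (case g of Gen_e k \<Rightarrow> w k * x (GenE k) | Gen_f k \<Rightarrow> w (k + 1) * x (GenF k)
    | Gen_h n \<Rightarrow> w (Rep_nonzero_int n) * x (GenH n) | Gen_phip \<Rightarrow> x GenS | Gen_phip_i \<Rightarrow> x GenSi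
    | Gen_phim \<Rightarrow> w 1 * x GenSi | Gen_phim_i \<Rightarrow> w (- 1) * x GenS)"

definition drinfeld_from :: "(ft_gen \<Rightarrow> 'a) \<Rightarrow> drinfeld_gen \<Rightarrow> 'a"
  where "drinfeld_from y g = (case g of GenE k \<Rightarrow> w k * y (Gen_e k) | GenF k \<Rightarrow> w (k + 1) * y (Gen_f k)
    | GenH n \<Rightarrow> w (Rep_nonzero_int n) * y (Gen_h n) | GenS \<Rightarrow> y Gen_phip | GenSi \<Rightarrow> y Gen_phip_i
    | GenK \<Rightarrow> y Gen_phip ^ 2 | GenKi \<Rightarrow> y Gen_phip_i ^ 2 | GenC \<Rightarrow> 1 | GenCi \<Rightarrow> 1)"

lemma Rep_Abs: "n \<noteq> 0 \<Longrightarrow> Rep_nonzero_int (Abs_nonzero_int n) = n"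
  by (rule Abs_nonzero_int_inverse) simp

lemma K_eq_S_squared:
  assumes D: "\<forall>r\<in>drinfeld_rels \<iota> x. r = 0" and c: "x GenC = 1"
  shows "x GenCi = 1" "x GenS * x GenSi = 1" "x GenSi * x GenS = 1" "x GenK = x GenS ^ 2" "x GenKi = x GenSi ^ 2"
proof -
  note R = D[unfolded ball_drinfeld_rels Let_def commutator_def right_minus_eq c]
  show "x GenCi = 1" using R by simp
  show S: "x GenS * x GenSi = 1" "x GenSi * x GenS = 1" using R by simp_all
  show "x GenK = x GenS ^ 2" using R by (simp add: power2_eq_square)
  have "x GenKi = x GenKi * (x GenS * x GenS) * (x GenSi * x GenSi)"
    by (simp add: mult.assoc) (simp add: mult.assoc[symmetric] S)
  also have "x GenKi * (x GenS * x GenS) = 1" using R by simp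
  finally show "x GenKi = x GenSi ^ 2" by (simp add: power2_eq_square)
qed

lemma ft_from_relations:
  assumes D: "\<forall>r\<in>drinfeld_rels \<iota> x. r = 0" and c: "x GenC = 1"
  shows "\<forall>r\<in>ft_rels \<iota> (ft_from x). r = 0"
proof -
  note R = D[unfolded ball_drinfeld_rels Let_def commutator_def right_minus_eq c]
  note ci = K_eq_S_squared(1)[OF D c] and S = K_eq_S_squared(2,3)[OF D c] and K = K_eq_S_squared(4)[OF D c] and Ki = K_eq_S_squared(5)[OF D c]
  note R = R[unfolded ci zpow_one mult_1_right]
  have h: "w (Rep_nonzero_int (Abs_nonzero_int n)) * x (GenH (Abs_nonzero_int n)) = w n * x (GenH (Abs_nonzero_int n))" if "n \<noteq> 0" for n
    using that by (simp add: Rep_Abs)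
  have SH: "x GenSi * x (GenH (Abs_nonzero_int n)) * x GenS = x (GenH (Abs_nonzero_int n))" if "n \<noteq> 0" for n
    using conj_inverse[OF S, of "x (GenH (Abs_nonzero_int n))" 1] R that by (simp add: hom_one)
  have sw: "(w 1 * a) * b * (w (- 1) * d) = a * b * d" for a b d
    using w_mult[of 1 "a * b" "- 1" d] by (simp add: mult.assoc)
  show ?thesis
    unfolding ball_ft_rels Let_def ft_from_def ft_gen.case commutator_def
  proof (intro conjI allI impI, goal_cases)
    case (3) show ?case using w_mult[of 1 "x GenSi" "- 1" "x GenS"] S by simp
  next
    case (4) show ?case using w_mult[of "- 1" "x GenS" 1 "x GenSi"] S by simp
  next
    case (5) show ?case by (simp add: w_left S mult.assoc)
  next
    case (6 k) show ?case unfolding w_conj w_iota using R by simp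
  next
    case (7 k) show ?case unfolding sw w_conj w_iota using R conj_inverse[OF S, of "x (GenE k)" vv] by simp
  next
    case (8 k) show ?case unfolding w_conj w_iota using R by simp
  next
    case (9 k) show ?case unfolding sw w_conj w_iota using R conj_inverse[OF S, of "x (GenF k)" "inverse vv"] by simp
  next
    case (10 n) then show ?case unfolding w_conj w_iota using R by simp
  next
    case (11 n) then show ?case unfolding sw w_conj by (simp add: SH)
  next
    case (12 k l) show ?case by (rule w_quadratic[where E = "\<lambda>k. x (GenE k)" and b = 0]) (use R in simp_all)
  next
    case (13 k l) show ?case by (rule w_quadratic[where E = "\<lambda>k. x (GenF k)" and b = 1]) (use R in simp_all)
  next
    case (14 k l)
    have "x (GenE k) * x (GenF l) - x (GenF l) * x (GenE k) = EF_bracket \<iota> 1 1 (x GenK) (x GenKi) (\<lambda>n. x (GenH (Abs_nonzero_int n))) k l"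
      using R by simp
    moreover have "(w 1 * x GenSi) ^ 2 = w 2 * x GenKi" by (simp add: power2_eq_square w_mult Ki)
    moreover have "w (k + (l + 1)) = w 2 * w (k + l - 1)"
      unfolding w_add[symmetric] by (rule arg_cong[of _ _ w]) simp
    ultimately show ?case
      unfolding w_commutator
      by (simp add: EF_bracket_def K[symmetric] plus_mode_rescale[OF h] minus_mode_rescale[OF h] mode_scale
          w_iota right_diff_distrib mult.assoc add_ac)
  next
    case (15 k l)
    have "x (GenH (Abs_nonzero_int l)) * x (GenE k) - x (GenE k) * x (GenH (Abs_nonzero_int l)) = \<iota> (hcoeff l) * x (GenE (k + l))" using R 15 by blast
    moreover have "l + k = k + l" by simp
    ultimately show ?case using 15 unfolding w_commutator by (simp only: Rep_Abs[OF \<open>l \<noteq> 0\<close>] zpow_one mult_1_right w_iota right_minus_eq)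
  next
    case (16 k l)
    have "x (GenH (Abs_nonzero_int l)) * x (GenF k) - x (GenF k) * x (GenH (Abs_nonzero_int l)) + \<iota> (hcoeff l) * x (GenF (k + l)) = 0" using R 16 by blast
    moreover have "l + (k + 1) = k + l + 1" by simp
    ultimately show ?case using 16 unfolding w_commutator by (simp only: Rep_Abs[OF \<open>l \<noteq> 0\<close>] zpow_one mult_1_right w_iota distrib_left[symmetric] mult_zero_right)
  next
    case (17 k l) then show ?case using R unfolding w_commutator by (auto simp: Rep_Abs)
  qed (use S in simp_all)
qed

lemma drinfeld_from_relations:
  assumes F: "\<forall>r\<in>ft_rels \<iota> y. r = 0" and zi: "zi = y Gen_phip * y Gen_phim"
  shows "\<forall>r\<in>drinfeld_rels \<iota> (drinfeld_from y). r = 0"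
proof -
  note R = F[unfolded ball_ft_rels Let_def commutator_def right_minus_eq]
  have S: "y Gen_phip * y Gen_phip_i = 1" "y Gen_phip_i * y Gen_phip = 1" using R by simp_all
  have P2: "y Gen_phip ^ 2 * y Gen_phip_i ^ 2 = 1" "y Gen_phip_i ^ 2 * y Gen_phip ^ 2 = 1"
    by (simp_all add: power2_eq_square mult.assoc) (simp_all add: mult.assoc[symmetric] S)
  have h: "w (Rep_nonzero_int (Abs_nonzero_int n)) * y (Gen_h (Abs_nonzero_int n)) = w n * y (Gen_h (Abs_nonzero_int n))" if "n \<noteq> 0" for n
    using that by (simp add: Rep_Abs)
  have "y Gen_phim = y Gen_phip_i * zi" by (simp add: zi mult.assoc[symmetric] S)
  then have "y Gen_phim = w (- 1) * y Gen_phip_i" by (simp add: zpow_m1 cent_comm[OF cent_z(2)])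
  then have m2: "y Gen_phim ^ 2 = w (- 2) * y Gen_phip_i ^ 2" by (simp add: power2_eq_square w_mult)
  show ?thesis
    unfolding ball_drinfeld_rels Let_def drinfeld_from_def drinfeld_gen.case commutator_def
  proof (intro conjI allI impI, goal_cases)
    case (8 k) show ?case unfolding w_conj w_iota using R by simp
  next
    case (9 k) show ?case unfolding w_conj w_iota using R by simp
  next
    case (10 n) then show ?case unfolding w_conj w_iota using R by simp
  next
    case (11 k l) show ?case by (rule w_quadratic[where E = "\<lambda>k. y (Gen_e k)" and b = 0]) (use R in simp_all)
  next
    case (12 k l) show ?case by (rule w_quadratic[where E = "\<lambda>k. y (Gen_f k)" and b = 1]) (use R in simp_all)
  next
    case (13 k l)
    have "y (Gen_e k) * y (Gen_f l) - y (Gen_f l) * y (Gen_e k) = \<iota> (1 / (vv - inverse vv)) *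
        (plus_mode \<iota> (y Gen_phip ^ 2) (\<lambda>n. y (Gen_h (Abs_nonzero_int n))) (k + l) - minus_mode \<iota> (y Gen_phim ^ 2) (\<lambda>n. y (Gen_h (Abs_nonzero_int n))) (k + l))"
      using R by simp
    moreover have "w (k + l - 1) = w (k + (l + 1)) * w (- 2)"
      unfolding w_add[symmetric] by (rule arg_cong[of _ _ w]) simp
    ultimately show ?case
      unfolding w_commutator
      by (simp add: EF_bracket_def m2 plus_mode_rescale[OF h] minus_mode_rescale[OF h] mode_scale
          w_iota right_diff_distrib mult.assoc add_ac)
  next
    case (14 k l)
    have "y (Gen_h (Abs_nonzero_int l)) * y (Gen_e k) - y (Gen_e k) * y (Gen_h (Abs_nonzero_int l)) = \<iota> (hcoeff l) * y (Gen_e (k + l))" using R 14 by blast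
    moreover have "l + k = k + l" by simp
    ultimately show ?case using 14 unfolding w_commutator by (simp only: Rep_Abs[OF \<open>l \<noteq> 0\<close>] zpow_one mult_1_right w_iota right_minus_eq)
  next
    case (15 k l)
    have "y (Gen_h (Abs_nonzero_int l)) * y (Gen_f k) - y (Gen_f k) * y (Gen_h (Abs_nonzero_int l)) + \<iota> (hcoeff l) * y (Gen_f (k + l)) = 0" using R 15 by blast
    moreover have "l + (k + 1) = k + l + 1" by simp
    ultimately show ?case using 15 unfolding w_commutator by (simp only: Rep_Abs[OF \<open>l \<noteq> 0\<close>] zpow_one mult_1_right w_iota distrib_left[symmetric] mult_zero_right)
  next
    case (16 k l) then show ?case using R unfolding w_commutator by (auto simp: Rep_Abs)
  qed (use S P2 in \<open>simp_all add: power2_eq_square\<close>)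
qed

end

section \<open>The special fibres as types\<close>

lemma central_hom_compose: "central_hom \<iota> \<Longrightarrow> rhom g \<Longrightarrow> central_hom (\<lambda>a. \<iota> (g a))"
  unfolding central_hom_def central_hom_axioms_def by (auto intro: rhom_compose)
lemma rhom_const_poly: "rhom (\<lambda>a::'a::comm_ring_1. [:a:])"
  by unfold_locales (simp_all add: pCons_one mult.commute)
lemma rhom_poly_eval: "rhom (\<lambda>p. poly p (s::'a::comm_ring_1))"
  by unfold_locales simp_all

text \<open>The fibre at \<open>t = s\<close> acts on the module over \<open>\<complex>(v)\<close> with \<open>c = y = 1\<close>.\<close>

lemma specialized_nontrivial:
  "0 - 1 \<notin> rel_ideal (At_rels (scalar :: cv poly \<Rightarrow> (At_gen, cv poly) free_alg) gen \<union> {scalar [:- s, 1:]})"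
proof -
  have jt: "rhom (\<lambda>p::cv poly. poly p s)" by (rule rhom_poly_eval)
  note fa = fock_At[OF jt, of 1 1 1 1, simplified]
  interpret fr: fock_rep "\<lambda>a. poly [:a:] s" 1 1 using fa(1) by simp
  interpret ch: central_hom "\<lambda>p. scal (poly p s) :: (fock, cv) endo" by (rule fa(2))
  have t: "ev (\<lambda>p. scal (poly p s)) g (scalar [:- s, 1:]) = (0 :: (fock, cv) endo)" for g :: "At_gen \<Rightarrow> (fock, cv) endo"
    using ch.ev_scalar[of g "[:- s, 1:]"] ch.hom_zero by simp
  show ?thesis
  proof (rule fr.one_notin_rel_ideal[OF fa(2) fr.Nstable_scal])
    show "fr.Nstable (At_fock_gen (\<lambda>a. poly [:a:] s) 1 1 1 1 g)" for g using fa(3) by simp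
    show "fr.Nzero (ev (\<lambda>p. scal (poly p s)) (At_fock_gen (\<lambda>a. poly [:a:] s) 1 1 1 1) r)"
      if "r \<in> At_rels scalar gen \<union> {scalar [:- s, 1:]}" for r
      using that fa(4)[of r] fr.Nzero_0[OF t] by auto
  qed
qed

definition fibre_rels :: "cv \<Rightarrow> (At_gen, cv poly) free_alg set"
  where "fibre_rels s = At_rels scalar gen \<union> {scalar [:- s, 1:]}"

quotient_type at0_alg = "(At_gen, cv poly) free_alg" / "\<lambda>x y. x - y \<in> rel_ideal (fibre_rels 0)"
  by (rule two_sided.J_equivp) (rule two_sided_rel_ideal)

instantiation at0_alg :: ring_1
begin
interpretation two_sided "rel_ideal (fibre_rels 0)" by (rule two_sided_rel_ideal)
lift_definition zero_at0_alg :: at0_alg is 0 .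
lift_definition one_at0_alg :: at0_alg is 1 .
lift_definition plus_at0_alg :: "at0_alg \<Rightarrow> at0_alg \<Rightarrow> at0_alg" is "(+)" by (rule J_cong_add)
lift_definition minus_at0_alg :: "at0_alg \<Rightarrow> at0_alg \<Rightarrow> at0_alg" is "(-)" by (rule J_cong_diff)
lift_definition uminus_at0_alg :: "at0_alg \<Rightarrow> at0_alg" is "uminus" by (rule J_cong_minus)
lift_definition times_at0_alg :: "at0_alg \<Rightarrow> at0_alg \<Rightarrow> at0_alg" is "(*)" by (rule J_cong_mult)
instance
proof
  show "(0::at0_alg) \<noteq> 1" using specialized_nontrivial[of 0] unfolding fibre_rels_def[symmetric] by transfer
qed (transfer; simp add: algebra_simps J_zero)+
end

quotient_type at1_alg = "(At_gen, cv poly) free_alg" / "\<lambda>x y. x - y \<in> rel_ideal (fibre_rels 1)"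
  by (rule two_sided.J_equivp) (rule two_sided_rel_ideal)

instantiation at1_alg :: ring_1
begin
interpretation two_sided "rel_ideal (fibre_rels 1)" by (rule two_sided_rel_ideal)
lift_definition zero_at1_alg :: at1_alg is 0 .
lift_definition one_at1_alg :: at1_alg is 1 .
lift_definition plus_at1_alg :: "at1_alg \<Rightarrow> at1_alg \<Rightarrow> at1_alg" is "(+)" by (rule J_cong_add)
lift_definition minus_at1_alg :: "at1_alg \<Rightarrow> at1_alg \<Rightarrow> at1_alg" is "(-)" by (rule J_cong_diff)
lift_definition uminus_at1_alg :: "at1_alg \<Rightarrow> at1_alg" is "uminus" by (rule J_cong_minus)
lift_definition times_at1_alg :: "at1_alg \<Rightarrow> at1_alg \<Rightarrow> at1_alg" is "(*)" by (rule J_cong_mult)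
instance
proof
  show "(0::at1_alg) \<noteq> 1" using specialized_nontrivial[of 1] unfolding fibre_rels_def[symmetric] by transfer
qed (transfer; simp add: algebra_simps J_zero)+
end

lemma rhom_at0: "rhom abs_at0_alg"
  by unfold_locales (transfer; simp add: two_sided.J_zero[OF two_sided_rel_ideal])+
lemma surj_at0: "surj abs_at0_alg"
  by (metis surjI Quotient_abs_rep[OF Quotient_at0_alg])
lemma at0_eq_0_iff: "abs_at0_alg f = 0 \<longleftrightarrow> f \<in> rel_ideal (fibre_rels 0)"
  by (transfer) simp

lemma rhom_at1: "rhom abs_at1_alg"
  by unfold_locales (transfer; simp add: two_sided.J_zero[OF two_sided_rel_ideal])+
lemma surj_at1: "surj abs_at1_alg"
  by (metis surjI Quotient_abs_rep[OF Quotient_at1_alg])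
lemma at1_eq_0_iff: "abs_at1_alg f = 0 \<longleftrightarrow> f \<in> rel_ideal (fibre_rels 1)"
  by (transfer) simp

text \<open>The fibre at \<open>t = s\<close>.\<close>

locale At_fibre = At_quotient h for h :: "(At_gen, cv poly) free_alg \<Rightarrow> 'a::ring_1" +
  fixes s :: cv
  assumes t_eq: "h (scalar [:- s, 1:]) = 0"
begin

lemma scalar_eval: "h (scalar p) = h (scalar [:poly p s:])"
proof -
  have "poly (p - [:poly p s:]) s = 0" by simp
  then have "[:- s, 1:] dvd p - [:poly p s:]" by (simp only: poly_eq_0_iff_dvd)
  then obtain q where q: "p - [:poly p s:] = [:- s, 1:] * q" by (rule dvdE)
  have "h (scalar (p - [:poly p s:])) = 0" unfolding q scalar.hom_mult hom_mult t_eq by simp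
  then show ?thesis by (simp add: scalar.hom_diff hom_diff)
qed

lemma C_eq: "h (gen (Base GenC)) = 1 + h (scalar [:s:]) * (h (gen TildeC) - 1)"
  using relations(5) scalar_eval[of "[:0, 1:]"] by simp

sublocale \<iota>: central_hom "\<lambda>a. h (scalar [:a:])"
  by (rule central_hom_compose[OF central_hom_scalars rhom_const_poly])

end

interpretation at0: At_fibre abs_at0_alg 0
proof -
  interpret rhom abs_at0_alg by (rule rhom_at0)
  show "At_fibre abs_at0_alg 0"
    using rel_ideal_superset[of "fibre_rels 0"]
    by unfold_locales (auto simp: surj_at0 at0_eq_0_iff fibre_rels_def)
qed

interpretation at1: At_fibre abs_at1_alg 1
proof -
  interpret rhom abs_at1_alg by (rule rhom_at1)
  show "At_fibre abs_at1_alg 1"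
    using rel_ideal_superset[of "fibre_rels 1"]
    by unfold_locales (auto simp: surj_at1 at1_eq_0_iff fibre_rels_def)
qed

text \<open>A homomorphism is onto if its image contains generators.\<close>

lemma rhom_surjI:
  fixes h :: "'b::ring_1 \<Rightarrow> 'a::ring_1" and \<pi> :: "('g, 'r::comm_ring_1) free_alg \<Rightarrow> 'a"
  assumes "rhom h" "rhom \<pi>" "surj \<pi>" "\<And>r. \<pi> (scalar r) \<in> range h" "\<And>g. \<pi> (gen g) \<in> range h"
  shows "surj h"
proof -
  interpret h: rhom h by fact
  interpret p: rhom \<pi> by fact
  have "\<pi> f \<in> range h" for f
  proof (induction f rule: free_alg_induct)
    case (add f g)
    then obtain a b where "\<pi> f = h a" "\<pi> g = h b" by blast
    then have "\<pi> (f + g) = h (a + b)" by (simp add: h.homs p.homs)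
    then show ?case by blast
  next
    case (mult f g)
    then obtain a b where "\<pi> f = h a" "\<pi> g = h b" by blast
    then have "\<pi> (f * g) = h (a * b)" by (simp add: h.homs p.homs)
    then show ?case by blast
  qed (use assms in auto)
  then show ?thesis using assms(3) by (metis surjD surjI UNIV_eq_I)
qed

section \<open>The fibre at 1\<close>

lemma (in two_sided) two_sided_preimage:
  assumes "rhom \<eta>" shows "two_sided {f. \<eta> f \<in> J}"
proof -
  interpret rhom \<eta> by fact
  show ?thesis by unfold_locales (auto simp: homs J_zero J_add J_left J_right)
qed

text \<open>In the fibre, \<open>c = y\<close>.  The inverse map \<open>\<eta>\<close> is defined between the free algebras already, so no type for the
  deformed algebra is needed: it suffices that \<open>\<eta>\<close> maps relations to relations.\<close>

lemma iso_at_1: "algebra_isomorphic R (specialize At [:-1, 1:]) deformed_qaffine"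
proof -
  define D :: "(drinfeld_gen, cv) free_alg set" where "D = drinfeld_rels scalar gen \<union> central_rels (gen GenC)"
  interpret J: two_sided "rel_ideal D" by (rule two_sided_rel_ideal)
  define \<theta> :: "(drinfeld_gen, cv) free_alg \<Rightarrow> (At_gen, cv poly) free_alg"
    where "\<theta> = ev (\<lambda>a. scalar [:a:]) (\<lambda>g. gen (Base g))"
  define \<eta> :: "(At_gen, cv poly) free_alg \<Rightarrow> (drinfeld_gen, cv) free_alg"
    where "\<eta> = ev (\<lambda>p. scalar (poly p 1)) (\<lambda>g. case g of Base b \<Rightarrow> gen b | TildeC \<Rightarrow> gen GenC | TildeCi \<Rightarrow> gen GenCi)"
  have c\<theta>: "central_hom (\<lambda>a::cv. scalar [:a:] :: (At_gen, cv poly) free_alg)"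
    by (rule central_hom_compose[OF central_hom_scalar rhom_const_poly])
  have c\<eta>: "central_hom (\<lambda>p::cv poly. scalar (poly p 1) :: (drinfeld_gen, cv) free_alg)"
    by (rule central_hom_compose[OF central_hom_scalar rhom_poly_eval])
  interpret \<theta>: rhom \<theta> unfolding \<theta>_def by (rule central_hom.rhom_ev[OF c\<theta>])
  interpret \<eta>: rhom \<eta> unfolding \<eta>_def by (rule central_hom.rhom_ev[OF c\<eta>])
  have \<theta>_ev: "\<theta> (scalar a) = scalar [:a:]" "\<theta> (gen g) = gen (Base g)" for a g
    by (simp_all add: \<theta>_def central_hom.ev_scalar[OF c\<theta>] central_hom.ev_gen[OF c\<theta>])
  have \<eta>_ev: "\<eta> (scalar p) = scalar (poly p 1)" "\<eta> (gen (Base g)) = gen g" "\<eta> (gen TildeC) = gen GenC" "\<eta> (gen TildeCi) = gen GenCi" for p g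
    by (simp_all add: \<eta>_def central_hom.ev_scalar[OF c\<eta>] central_hom.ev_gen[OF c\<eta>])
  \<comment> \<open>\<open>\<theta>\<close> sends the generators of the deformed algebra to those of the family, and \<open>\<eta>\<close> is a left inverse that identifies \<open>y\<close> with \<open>c\<close>.\<close>
  have \<eta>\<theta>: "\<eta> (\<theta> f) = f" for f
    by (rule rhom_free_alg_eqI[OF rhom_compose[OF \<theta>.rhom_axioms \<eta>.rhom_axioms]]) (unfold_locales, simp_all add: \<theta>_ev \<eta>_ev)
  have D: "r \<in> rel_ideal D" if "r \<in> D" for r using that rel_ideal_superset by blast
  have "\<forall>r\<in>At_rels scalar gen. \<eta> r \<in> rel_ideal D"
  proof -
    have "\<forall>r\<in>drinfeld_rels (\<lambda>a. scalar [:a:]) (\<lambda>g. gen (Base g)). \<eta> r \<in> rel_ideal D"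
      unfolding drinfeld_rels_hom[OF \<eta>.rhom_axioms, where Q = "\<lambda>r. r \<in> rel_ideal D"] \<eta>_ev
      using D by (auto simp: D_def)
    moreover have "\<eta> (gen TildeC * gen TildeCi - 1) \<in> rel_ideal D" "\<eta> (gen TildeCi * gen TildeC - 1) \<in> rel_ideal D"
      unfolding \<eta>.homs \<eta>_ev by (rule D; simp add: D_def drinfeld_rels_def Let_def)+
    moreover have "\<forall>r\<in>central_rels (gen TildeC). \<eta> r \<in> rel_ideal D"
      by (auto simp: central_rels_def commutator_def \<eta>.homs \<eta>_ev intro!: D) (auto simp: D_def central_rels_def commutator_def)
    moreover have "\<eta> ((gen (Base GenC) - 1) - scalar [:0, 1:] * (gen TildeC - 1)) \<in> rel_ideal D"
      by (simp add: \<eta>.homs \<eta>_ev scalar.hom_one J.J_zero)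
    ultimately show ?thesis unfolding At_rels_def by blast
  qed
  moreover have "\<eta> (scalar [:- 1, 1:]) \<in> rel_ideal D" by (simp add: \<eta>_ev scalar.hom_zero J.J_zero)
  ultimately have \<eta>_ideal: "\<eta> f \<in> rel_ideal D" if "f \<in> rel_ideal (fibre_rels 1)" for f
    using rel_ideal_minimal[OF J.two_sided_preimage[OF \<eta>.rhom_axioms], of "fibre_rels 1"] that unfolding fibre_rels_def by blast
  define h' where "h' f = abs_at1_alg (\<theta> f)" for f
  have rh': "rhom h'" unfolding h'_def[abs_def] by (rule rhom_compose[OF \<theta>.rhom_axioms rhom_at1])
  have C: "abs_at1_alg (gen TildeC) = abs_at1_alg (gen (Base GenC))"
    using at1.C_eq by (simp add: at1.\<iota>.hom_one)
  have Ci: "abs_at1_alg (gen TildeCi) = abs_at1_alg (gen (Base GenCi))"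
  proof -
    let ?C = "abs_at1_alg (gen TildeC)" and ?D = "abs_at1_alg (gen TildeCi)" and ?E = "abs_at1_alg (gen (Base GenCi))"
    have "?D = ?D * (?C * ?E)" using at1.relations(8) C by simp
    also have "\<dots> = ?D * ?C * ?E" by (rule mult.assoc[symmetric])
    finally show ?thesis by (simp add: at1.relations)
  qed
  have kill: "h' r = 0" if "r \<in> D" for r
  proof -
    have "\<forall>r\<in>drinfeld_rels scalar gen. h' r = 0"
      unfolding drinfeld_rels_hom[OF rh', where Q = "\<lambda>r. r = 0"] using at1.relations(10) by (simp add: h'_def \<theta>_ev)
    moreover have "\<forall>r\<in>central_rels (gen GenC). h' r = 0"
      using at1.relations(6) by (auto simp: central_rels_def commutator_def rhom.homs[OF rh'] cent_def) (simp add: h'_def \<theta>_ev)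
    ultimately show ?thesis using that by (auto simp: D_def)
  qed
  have ker: "h' f = 0 \<longleftrightarrow> f \<in> rel_ideal D" for f
  proof
    assume "h' f = 0"
    then have "\<eta> (\<theta> f) \<in> rel_ideal D" by (intro \<eta>_ideal) (simp add: h'_def at1_eq_0_iff)
    then show "f \<in> rel_ideal D" by (simp add: \<eta>\<theta>)
  qed (rule rel_ideal_kernel[OF rh' kill])
  have sj: "surj h'"
  proof (rule rhom_surjI[OF rh' rhom_at1 surj_at1])
    have s: "abs_at1_alg (scalar p) = h' (scalar (poly p 1))" for p
      using at1.scalar_eval[of p] by (simp add: h'_def \<theta>_ev)
    show "abs_at1_alg (scalar p) \<in> range h'" for p unfolding s by blast
    have g: "abs_at1_alg (gen g) = h' (gen (case g of Base b \<Rightarrow> b | TildeC \<Rightarrow> GenC | TildeCi \<Rightarrow> GenCi))" for g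
      by (cases g) (simp_all add: h'_def \<theta>_ev C Ci)
    show "abs_at1_alg (gen g) \<in> range h'" for g unfolding g by blast
  qed
  obtain d where cs: "cosets_of (specialize At [:-1, 1:]) d (rel_ideal (fibre_rels 1)) (\<lambda>a. scalar [:a:])"
    using cosets_specialize[of "[:-1, 1:]"] unfolding fibre_rels_def by blast
  have cd: "cosets_of deformed_qaffine (\<lambda>f. rel_ideal D +>\<^bsub>free_algebra\<^esub> f) (rel_ideal D) scalar"
    unfolding deformed_qaffine_def D_def by (rule cosets_presented)
  show ?thesis
    by (rule cosets_algebra_isomorphic[OF cs cd rhom_at1 surj_at1 at1_eq_0_iff rh' sj ker]) (simp add: h'_def \<theta>_ev)
qed

section \<open>The fibre at 0\<close>

interpretation r0: rescaling "\<lambda>a. abs_at0_alg (scalar [:a:])" "abs_at0_alg (gen TildeC)" "abs_at0_alg (gen TildeCi)"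
  by unfold_locales (fact at0.relations)+

text \<open>This map is defined before the type of the shifted algebra, because its existence shows that the shifted algebra
  is not the zero ring.\<close>

definition ft_to_at0 :: "(ft_gen, cv) free_alg \<Rightarrow> at0_alg"
  where "ft_to_at0 = ev (\<lambda>a. abs_at0_alg (scalar [:a:])) (r0.ft_from (\<lambda>g. abs_at0_alg (gen (Base g))))"

lemma ft_to_at0_ev:
  "ft_to_at0 (scalar a) = abs_at0_alg (scalar [:a:])"
  "ft_to_at0 (gen g) = r0.ft_from (\<lambda>g. abs_at0_alg (gen (Base g))) g"
  by (simp_all add: ft_to_at0_def at0.\<iota>.ev_scalar at0.\<iota>.ev_gen)

lemma rhom_ft_to_at0: "rhom ft_to_at0"
  unfolding ft_to_at0_def by (rule at0.\<iota>.rhom_ev)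

lemma at0_C: "abs_at0_alg (gen (Base GenC)) = 1"
  unfolding at0.C_eq at0.\<iota>.hom_zero by simp

lemma ft_to_at0_kills: "r \<in> ft_rels scalar gen \<Longrightarrow> ft_to_at0 r = 0"
proof -
  have "\<forall>r\<in>ft_rels scalar gen. ft_to_at0 r = 0"
    unfolding ft_rels_hom[OF rhom_ft_to_at0, where Q = "\<lambda>r. r = 0"] ft_to_at0_ev
    by (rule r0.ft_from_relations[OF at0.relations(10) at0_C])
  then show "r \<in> ft_rels scalar gen \<Longrightarrow> ft_to_at0 r = 0" by blast
qed

quotient_type ft_alg = "(ft_gen, cv) free_alg" / "\<lambda>x y. x - y \<in> rel_ideal (ft_rels scalar gen)"
  by (rule two_sided.J_equivp) (rule two_sided_rel_ideal)

instantiation ft_alg :: ring_1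
begin
interpretation two_sided "rel_ideal (ft_rels scalar gen)" by (rule two_sided_rel_ideal)
lift_definition zero_ft_alg :: ft_alg is 0 .
lift_definition one_ft_alg :: ft_alg is 1 .
lift_definition plus_ft_alg :: "ft_alg \<Rightarrow> ft_alg \<Rightarrow> ft_alg" is "(+)" by (rule J_cong_add)
lift_definition minus_ft_alg :: "ft_alg \<Rightarrow> ft_alg \<Rightarrow> ft_alg" is "(-)" by (rule J_cong_diff)
lift_definition uminus_ft_alg :: "ft_alg \<Rightarrow> ft_alg" is "uminus" by (rule J_cong_minus)
lift_definition times_ft_alg :: "ft_alg \<Rightarrow> ft_alg \<Rightarrow> ft_alg" is "(*)" by (rule J_cong_mult)
instance
proof
  interpret rhom ft_to_at0 by (rule rhom_ft_to_at0)
  have "0 - 1 \<notin> rel_ideal (ft_rels (scalar :: cv \<Rightarrow> (ft_gen, cv) free_alg) gen)"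
  proof
    assume "0 - 1 \<in> rel_ideal (ft_rels (scalar :: cv \<Rightarrow> (ft_gen, cv) free_alg) gen)"
    from rel_ideal_kernel[OF rhom_ft_to_at0 ft_to_at0_kills this] show False
      by (simp only: hom_diff hom_zero hom_one) simp
  qed
  then show "(0::ft_alg) \<noteq> 1" by transfer
qed (transfer; simp add: algebra_simps J_zero)+
end

lemma rhom_ft: "rhom abs_ft_alg"
  by unfold_locales (transfer; simp add: two_sided.J_zero[OF two_sided_rel_ideal])+
lemma surj_ft: "surj abs_ft_alg"
  by (metis surjI Quotient_abs_rep[OF Quotient_ft_alg])
lemma ft_eq_0_iff: "abs_ft_alg f = 0 \<longleftrightarrow> f \<in> rel_ideal (ft_rels scalar gen)"
  by (transfer) simp

definition ftg :: "ft_gen \<Rightarrow> ft_alg" where "ftg g = abs_ft_alg (gen g)"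
definition fts :: "cv \<Rightarrow> ft_alg" where "fts a = abs_ft_alg (scalar a)"

interpretation fts: central_hom fts
proof
  show "fts a * z = z * fts a" for a z
  proof -
    obtain f where "z = abs_ft_alg f" using surj_ft by (rule surjE)
    then show ?thesis by (simp add: fts_def rhom.hom_mult[OF rhom_ft, symmetric] scalar.central)
  qed
qed (simp_all add: fts_def rhom.homs[OF rhom_ft] scalar.homs)

lemma ft_relations: "\<forall>r\<in>ft_rels fts ftg. r = 0"
proof -
  have "\<forall>r\<in>ft_rels scalar gen. abs_ft_alg r = 0"
    using rel_ideal_superset unfolding ft_eq_0_iff by blast
  then show ?thesis
    unfolding ft_rels_hom[OF rhom_ft, where Q = "\<lambda>r. r = 0"] by (simp add: fts_def[abs_def] ftg_def[abs_def])
qed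

lemmas ft_eqs = ft_relations[unfolded ball_ft_rels Let_def commutator_def right_minus_eq]

lemma ft_inverses:
  "ftg Gen_phip * ftg Gen_phip_i = 1" "ftg Gen_phip_i * ftg Gen_phip = 1"
  "ftg Gen_phim * ftg Gen_phim_i = 1" "ftg Gen_phim_i * ftg Gen_phim = 1"
  "ftg Gen_phip * ftg Gen_phim = ftg Gen_phim * ftg Gen_phip"
  using ft_eqs by simp_all

text \<open>\<open>ftzi\<close> is the image of the square root of \<open>C\<close> with a tilde.\<close>

abbreviation "ftz \<equiv> ftg Gen_phim_i * ftg Gen_phip_i"
abbreviation "ftzi \<equiv> ftg Gen_phip * ftg Gen_phim"

lemma ftz_inverse: "ftz * ftzi = 1" "ftzi * ftz = 1"
proof -
  have "ftz * ftzi = ftg Gen_phim_i * (ftg Gen_phip_i * ftg Gen_phip) * ftg Gen_phim" by (simp only: mult.assoc)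
  then show "ftz * ftzi = 1" by (simp add: ft_inverses)
  have "ftzi * ftz = ftg Gen_phip * (ftg Gen_phim * ftg Gen_phim_i) * ftg Gen_phip_i" by (simp only: mult.assoc)
  then show "ftzi * ftz = 1" by (simp add: ft_inverses)
qed

lemma ftzi_commutes:
  assumes p: "ftg Gen_phip * y * ftg Gen_phip_i = fts r * y" and m: "ftg Gen_phim * y * ftg Gen_phim_i = fts s * y" and rs: "r * s = 1"
  shows "ftzi * y = y * ftzi"
proof -
  have "ftg Gen_phip * y * (ftg Gen_phip_i * ftg Gen_phip) = fts r * y * ftg Gen_phip"
    unfolding p[symmetric] by (simp only: mult.assoc)
  then have p': "ftg Gen_phip * y = fts r * y * ftg Gen_phip" by (simp add: ft_inverses)
  have "ftg Gen_phim * y * (ftg Gen_phim_i * ftg Gen_phim) = fts s * y * ftg Gen_phim"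
    unfolding m[symmetric] by (simp only: mult.assoc)
  then have m': "ftg Gen_phim * y = fts s * y * ftg Gen_phim" by (simp add: ft_inverses)
  have "ftzi * y = ftg Gen_phip * (ftg Gen_phim * y)" by (rule mult.assoc)
  also have "\<dots> = fts s * ((ftg Gen_phip * y) * ftg Gen_phim)"
    unfolding m' by (simp only: mult.assoc cent_left[OF fts.cent_iota, where x = "ftg Gen_phip"])
  also have "\<dots> = (fts s * fts r) * (y * ftzi)" unfolding p' by (simp only: mult.assoc)
  also have "fts s * fts r = 1" using rs by (simp only: fts.hom_mult[symmetric] mult.commute[of s r] fts.hom_one)
  finally show ?thesis by simp
qed

text \<open>\<open>\<phi>\<^sup>+\<close> and \<open>\<phi>\<^sup>-\<close> scale the \<open>e\<^sub>k\<close> by inverse powers of \<open>v\<close>, and similarly for the \<open>f\<^sub>k\<close>, so their product is central.\<close>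

lemma cent_ftzi: "cent ftzi"
  unfolding cent_def
proof
  fix a
  obtain f where a: "a = abs_ft_alg f" using surj_ft by (rule surjE)
  interpret rhom abs_ft_alg by (rule rhom_ft)
  have p1: "ftg Gen_phip * ftg Gen_phip * ftg Gen_phip_i = fts 1 * ftg Gen_phip"
    by (simp add: mult.assoc ft_inverses(1-4) fts.hom_one)
  have p2: "ftg Gen_phim * ftg Gen_phip * ftg Gen_phim_i = fts 1 * ftg Gen_phip"
    unfolding ft_inverses(5)[symmetric] by (simp add: mult.assoc ft_inverses(1-4) fts.hom_one)
  have m1: "ftg Gen_phip * ftg Gen_phim * ftg Gen_phip_i = fts 1 * ftg Gen_phim"
    unfolding ft_inverses(5) by (simp add: mult.assoc ft_inverses(1-4) fts.hom_one)
  have m2: "ftg Gen_phim * ftg Gen_phim * ftg Gen_phim_i = fts 1 * ftg Gen_phim"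
    by (simp add: mult.assoc ft_inverses(1-4) fts.hom_one)
  note pz = ftzi_commutes[OF p1 p2] and mz = ftzi_commutes[OF m1 m2]
  have inv: "ftzi * y' = y' * ftzi" if "ftzi * y = y * ftzi" "y * y' = 1" "y' * y = 1" for y y'
  proof -
    have "y' * (ftzi * y) * y' = y' * (y * ftzi) * y'" by (simp only: that(1))
    then have "y' * ftzi * (y * y') = (y' * y) * ftzi * y'" by (simp only: mult.assoc)
    then show ?thesis by (simp add: that)
  qed
  have g: "ftzi * ftg g = ftg g * ftzi" for g
  proof (cases g)
    case (Gen_e k)
    show ?thesis unfolding Gen_e by (rule ftzi_commutes[where r = vv and s = "inverse vv"]) (use ft_eqs in simp_all)
  next
    case (Gen_f k)
    show ?thesis unfolding Gen_f by (rule ftzi_commutes[where r = "inverse vv" and s = vv]) (use ft_eqs in simp_all)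
  next
    case (Gen_h n)
    have "Rep_nonzero_int n \<noteq> 0" using Rep_nonzero_int by simp
    moreover have "n = Abs_nonzero_int (Rep_nonzero_int n)" by (rule Rep_nonzero_int_inverse[symmetric])
    ultimately obtain j where n: "j \<noteq> 0" "n = Abs_nonzero_int j" by blast
    show ?thesis unfolding Gen_h n(2)
      by (rule ftzi_commutes[where r = 1 and s = 1]) (use ft_eqs n(1) in \<open>simp_all add: fts.hom_one\<close>)
  qed (use pz mz inv[OF pz _ _, OF _ ft_inverses(1,2)] inv[OF mz _ _, OF _ ft_inverses(3,4)] in simp_all)
  have "ftzi * abs_ft_alg f = abs_ft_alg f * ftzi"
  proof (induction f rule: free_alg_induct)
    case (scalar r) show ?case using fts.central[of r] by (simp add: fts_def)
  next
    case (gen k) show ?case using g[of k] by (simp add: ftg_def)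
  next
    case (add f f') then show ?case by (simp only: hom_add distrib_left distrib_right)
  next
    case (mult f f')
    have "ftzi * abs_ft_alg (f * f') = (ftzi * abs_ft_alg f) * abs_ft_alg f'" by (simp only: hom_mult mult.assoc)
    also have "\<dots> = abs_ft_alg f * (ftzi * abs_ft_alg f')" unfolding mult.IH(1) by (rule mult.assoc)
    also have "\<dots> = abs_ft_alg (f * f') * ftzi" unfolding mult.IH(2) by (simp only: hom_mult mult.assoc)
    finally show ?case .
  qed
  then show "ftzi * a = a * ftzi" unfolding a .
qed

interpretation rf: rescaling fts ftz ftzi
  by unfold_locales (fact ftz_inverse cent_ftzi cent_inverse[OF cent_ftzi ftz_inverse(2,1)])+

definition at_to_ft :: "(At_gen, cv poly) free_alg \<Rightarrow> ft_alg"
  where "at_to_ft = ev (\<lambda>p. fts (poly p 0))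
    (\<lambda>g. case g of Base b \<Rightarrow> rf.drinfeld_from ftg b | TildeC \<Rightarrow> ftzi | TildeCi \<Rightarrow> ftz)"

lemma central_hom_fts_eval: "central_hom (\<lambda>p. fts (poly p 0))"
  by (rule central_hom_compose[OF fts.central_hom_axioms rhom_poly_eval])

lemma at_to_ft_ev:
  "at_to_ft (scalar p) = fts (poly p 0)" "at_to_ft (gen (Base b)) = rf.drinfeld_from ftg b"
  "at_to_ft (gen TildeC) = ftzi" "at_to_ft (gen TildeCi) = ftz"
  by (simp_all add: at_to_ft_def central_hom.ev_scalar[OF central_hom_fts_eval] central_hom.ev_gen[OF central_hom_fts_eval])

lemma rhom_at_to_ft: "rhom at_to_ft"
  unfolding at_to_ft_def by (rule central_hom.rhom_ev[OF central_hom_fts_eval])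

lemma at_to_ft_kills:
  assumes "r \<in> fibre_rels 0" shows "at_to_ft r = 0"
proof -
  interpret rhom at_to_ft by (rule rhom_at_to_ft)
  have "\<forall>r\<in>drinfeld_rels (\<lambda>a. scalar [:a:]) (\<lambda>g. gen (Base g)). at_to_ft r = 0"
    unfolding drinfeld_rels_hom[OF rhom_at_to_ft, where Q = "\<lambda>r. r = 0"] at_to_ft_ev
    using rf.drinfeld_from_relations[OF ft_relations refl] by simp
  moreover have "\<forall>r\<in>central_rels (gen TildeC). at_to_ft r = 0"
    using cent_ftzi by (auto simp: central_rels_def commutator_def homs at_to_ft_ev cent_def)
  moreover have "at_to_ft (gen TildeC * gen TildeCi - 1) = 0" "at_to_ft (gen TildeCi * gen TildeC - 1) = 0"
    by (simp_all add: homs at_to_ft_ev ftz_inverse)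
  moreover have "at_to_ft ((gen (Base GenC) - 1) - scalar [:0, 1:] * (gen TildeC - 1)) = 0"
    by (simp add: homs at_to_ft_ev rf.drinfeld_from_def fts.hom_zero)
  moreover have "at_to_ft (scalar [:- 0, 1:]) = 0" by (simp add: at_to_ft_ev fts.hom_zero)
  ultimately show ?thesis using assms unfolding fibre_rels_def At_rels_def by blast
qed

text \<open>The map in the opposite direction, composed with \<open>at_to_ft\<close>, is the projection to the fibre: this can be checked on
  generators, where the powers of the central element cancel.\<close>

lemma at_to_ft_retract:
  assumes "at_to_ft f = 0" shows "f \<in> rel_ideal (fibre_rels 0)"
proof -
  interpret th: rhom ft_to_at0 by (rule rhom_ft_to_at0)
  interpret ft: rhom abs_ft_alg by (rule rhom_ft)
  define k where "k a = ft_to_at0 (rep_ft_alg a)" for a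
  have k: "k (abs_ft_alg g) = ft_to_at0 g" for g
  proof -
    have "abs_ft_alg (rep_ft_alg (abs_ft_alg g)) = abs_ft_alg g" by (rule Quotient_abs_rep[OF Quotient_ft_alg])
    then have "rep_ft_alg (abs_ft_alg g) - g \<in> rel_ideal (ft_rels scalar gen)" by (simp add: ft_alg.abs_eq_iff)
    from rel_ideal_kernel[OF rhom_ft_to_at0 ft_to_at0_kills this] show ?thesis by (simp add: k_def th.hom_diff)
  qed
  interpret k: rhom k
  proof
    fix a b
    obtain f g where fg: "a = abs_ft_alg f" "b = abs_ft_alg g" using surj_ft by (metis surjD)
    show "k (a + b) = k a + k b" unfolding fg ft.hom_add[symmetric] k by (rule th.hom_add)
    show "k (a * b) = k a * k b" unfolding fg ft.hom_mult[symmetric] k by (rule th.hom_mult)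
    show "k 1 = 1" unfolding ft.hom_one[symmetric] k by (rule th.hom_one)
  qed
  have kg: "k (ftg g) = r0.ft_from (\<lambda>g. abs_at0_alg (gen (Base g))) g" "k (fts a) = abs_at0_alg (scalar [:a:])" for g a
    by (simp_all add: ftg_def fts_def k ft_to_at0_ev)
  note K = r0.K_eq_S_squared[OF at0.relations(10) at0_C]
  have kz: "k ftz = abs_at0_alg (gen TildeCi)" "k ftzi = abs_at0_alg (gen TildeC)"
    by (simp_all add: k.hom_mult kg r0.ft_from_def zpow_1 zpow_m1 mult.assoc K cent_left[OF at0.relations(3), where x = "abs_at0_alg (gen (Base GenS))"])
  have cancel: "k (rf.w n) * (r0.w n * a) = a" for n a
  proof -
    have "k (rf.w n) = r0.w (- n)" unfolding zpow_hom[OF k.rhom_axioms] kz by (auto simp: zpow_def)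
    then have "k (rf.w n) * (r0.w n * a) = r0.w (- n + n) * a" by (simp only: r0.w_add mult.assoc)
    then show ?thesis by simp
  qed
  have "k (at_to_ft f) = abs_at0_alg f"
  proof (rule rhom_free_alg_eqI[OF rhom_compose[OF rhom_at_to_ft k.rhom_axioms] rhom_at0])
    show "k (at_to_ft (scalar p)) = abs_at0_alg (scalar p)" for p
      by (simp add: at_to_ft_ev kg at0.scalar_eval[of p])
    show "k (at_to_ft (gen g)) = abs_at0_alg (gen g)" for g
    proof (cases g)
      case (Base b)
      show ?thesis unfolding Base
        by (cases b) (simp_all add: at_to_ft_ev rf.drinfeld_from_def k.homs kg r0.ft_from_def cancel K at0_C)
    qed (simp_all add: at_to_ft_ev kz)
  qed
  then show ?thesis using assms k.hom_zero by (simp add: at0_eq_0_iff)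
qed

lemma surj_at_to_ft: "surj at_to_ft"
proof (rule rhom_surjI[OF rhom_at_to_ft rhom_ft surj_ft])
  interpret rhom at_to_ft by (rule rhom_at_to_ft)
  have "at_to_ft (scalar [:r:]) = abs_ft_alg (scalar r)" for r by (simp add: at_to_ft_ev fts_def)
  then show "abs_ft_alg (scalar r) \<in> range at_to_ft" for r by (metis rangeI)
  let ?z = "zpow (gen TildeC) (gen TildeCi) :: int \<Rightarrow> (At_gen, cv poly) free_alg"
  have cancel: "at_to_ft (?z n) * (rf.w n * a) = a" for n a
  proof -
    have "at_to_ft (?z n) = rf.w (- n)" unfolding zpow_hom[OF rhom_at_to_ft] at_to_ft_ev by (auto simp: zpow_def)
    then have "at_to_ft (?z n) * (rf.w n * a) = rf.w (- n + n) * a" by (simp only: rf.w_add mult.assoc)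
    then show ?thesis by simp
  qed
  have m: "ftg Gen_phip_i * ftzi = ftg Gen_phim" "ftz * ftg Gen_phip = ftg Gen_phim_i"
    by (simp add: mult.assoc[symmetric] ft_inverses(1-4)) (simp add: mult.assoc ft_inverses(1-4))
  define pre where "pre g = (case g of Gen_e k \<Rightarrow> ?z k * gen (Base (GenE k)) | Gen_f k \<Rightarrow> ?z (k + 1) * gen (Base (GenF k))
    | Gen_h n \<Rightarrow> ?z (Rep_nonzero_int n) * gen (Base (GenH n)) | Gen_phip \<Rightarrow> gen (Base GenS) | Gen_phip_i \<Rightarrow> gen (Base GenSi)
    | Gen_phim \<Rightarrow> gen (Base GenSi) * gen TildeC | Gen_phim_i \<Rightarrow> gen TildeCi * gen (Base GenS))" for g
  have "at_to_ft (pre g) = ftg g" for g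
    by (cases g) (simp_all add: pre_def homs at_to_ft_ev rf.drinfeld_from_def cancel m)
  then show "abs_ft_alg (gen g) \<in> range at_to_ft" for g unfolding ftg_def by (metis rangeI)
qed

lemma iso_at_0: "algebra_isomorphic R (specialize At [:0, 1:]) adjoint_shifted_qaffine"
proof -
  obtain d where cs: "cosets_of (specialize At [:0, 1:]) d (rel_ideal (fibre_rels 0)) (\<lambda>a. scalar [:a:])"
    using cosets_specialize[of "[:0, 1:]"] unfolding fibre_rels_def by auto
  have cd: "cosets_of adjoint_shifted_qaffine (\<lambda>f. rel_ideal (ft_rels scalar gen) +>\<^bsub>free_algebra\<^esub> f) (rel_ideal (ft_rels scalar gen)) scalar"
    unfolding adjoint_shifted_qaffine_def by (rule cosets_presented)
  have ker: "at_to_ft f = 0 \<longleftrightarrow> f \<in> rel_ideal (fibre_rels 0)" for f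
    using at_to_ft_retract rel_ideal_kernel[OF rhom_at_to_ft at_to_ft_kills] by blast
  show ?thesis
    by (rule cosets_algebra_isomorphic[OF cs cd rhom_at_to_ft surj_at_to_ft ker rhom_ft surj_ft ft_eq_0_iff])
      (simp add: at_to_ft_ev fts_def)
qed

theorem proposition8p11:
  shows "flat_module TYPE('n) TYPE('p)
           (ring_of_type_algebra :: complex poly ring) (restrict_scalars incl_Ct At)
       \<and> algebra_isomorphic (ring_of_type_algebra :: cv ring)
           (specialize At [:-1, 1:]) deformed_qaffine
       \<and> algebra_isomorphic (ring_of_type_algebra :: cv ring)
           (specialize At [:0, 1:]) adjoint_shifted_qaffine"
  by (intro conjI flat_At iso_at_1 iso_at_0)

end
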